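(* Let $\alpha\in(0,2)$ and define $\nu=\frac1{2-\alpha}$, $\kappa=1-\frac\alpha2$. Let $u$ solve $$\partial_t^2u-x^\alpha\partial_x^2u=0\ \text{ in }(0,1)\times(0,T),\qquad u|_{t=0}=u_0,\quad \partial_tu|_{t=0}=u_1,$$ with zero Dirichlet boundary conditions at $x=0$ and $x=1$. Then for every $T>T^*=2/\kappa$ there exist constants $0<c_T\le C_T$ (independent of the initial data) such that $$c_T\,\mathcal E_\nu[u_0,u_1]\le\int_0^T|\partial_xu(0,t)|^2\,dt\le C_T\,\mathcal E_\nu[u_0,u_1],$$ where $\mathcal E_\nu[u_0,u_1]=\|u_0\|^2_{H^{\nu+\frac12}}+\|u_1\|^2_{H^{\nu-\frac12}}$. Moreover, the threshold $T^*=2/\kappa$ is optimal, i.e. it cannot be replaced by a smaller number.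
   Context: $L^2_\alpha(0,1)$ is the Hilbert space of measurable $f:(0,1)\to\mathbb R$ with $\|f\|^2_{L^2_\alpha}=\int_0^1|f(x)|^2x^{-\alpha}dx<\infty$. The operator $-x^\alpha\partial_x^2$ is self-adjoint and positive on its natural domain in $L^2_\alpha(0,1)$ and has an orthonormal basis of eigenfunctions $(\Phi_k)_{k\ge1}$ with eigenvalues $(\lambda_k)_{k\ge1}$: $-x^\alpha\Phi_k''=\lambda_k\Phi_k$ in $(0,1)$, $\Phi_k(0)=\Phi_k(1)=0$. For $s\ge0$, $H^s=H^s(0,1)=\{u\in L^2_\alpha(0,1):\|u\|_{H^s}<\infty\}$, where $\|u\|_{H^s}^2=\sum_{k\ge1}|a_k|^2\lambda_k^s$ if $u=\sum_{k\ge1}a_k\Phi_k$. Here $\partial_xu(0,t)$ denotes the trace $\lim_{x\to0^+}\partial_xu(x,t)$. *)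

theory Defs
  imports "HOL-Analysis.Analysis"
begin

definition square_integrable :: "real measure \<Rightarrow> (real \<Rightarrow> real) \<Rightarrow> bool" where
  "square_integrable M f \<longleftrightarrow> f \<in> borel_measurable M \<and> integrable M (\<lambda>x. (f x)\<^sup>2)"

definition l2_inner :: "real measure \<Rightarrow> (real \<Rightarrow> real) \<Rightarrow> (real \<Rightarrow> real) \<Rightarrow> real" where
  "l2_inner M f g = (\<integral>x. f x * g x \<partial>M)"

definition l2_normsq :: "real measure \<Rightarrow> (real \<Rightarrow> real) \<Rightarrow> real" where
  "l2_normsq M f = (\<integral>x. (f x)\<^sup>2 \<partial>M)"

definition interval_measure01 :: "real measure" where
  "interval_measure01 = restrict_space lborel {0<..<1}"

definition weighted_measure :: "real \<Rightarrow> real measure" where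
  "weighted_measure \<alpha> = density interval_measure01 (\<lambda>x. ennreal (x powr (- \<alpha>)))"

definition orthonormal_basis :: "real measure \<Rightarrow> (nat \<Rightarrow> real \<Rightarrow> real) \<Rightarrow> bool" where
  "orthonormal_basis M \<Phi> \<longleftrightarrow>
     (\<forall>k. square_integrable M (\<Phi> k)) \<and>
     (\<forall>j k. l2_inner M (\<Phi> j) (\<Phi> k) = (if j = k then 1 else 0)) \<and>
     (\<forall>f. square_integrable M f \<longrightarrow>
        (\<lambda>n. l2_normsq M (\<lambda>x. f x - (\<Sum>k<n. l2_inner M f (\<Phi> k) * \<Phi> k x))) \<longlonglongrightarrow> 0)"

text \<open>
  Eigenpairs are indexed from 0. The boundary values are attained continuously; near 0 the
  solutions of the differential equation that do not tend to 0 are thereby excluded.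
\<close>

definition dirichlet_eigenbasis ::
    "real \<Rightarrow> (nat \<Rightarrow> real \<Rightarrow> real) \<Rightarrow> (nat \<Rightarrow> real) \<Rightarrow> bool" where
  "dirichlet_eigenbasis \<alpha> \<Phi> lam \<longleftrightarrow>
     orthonormal_basis (weighted_measure \<alpha>) \<Phi> \<and>
     (\<forall>k. 0 < lam k \<and>
        continuous_on {0..1} (\<Phi> k) \<and> \<Phi> k 0 = 0 \<and> \<Phi> k 1 = 0 \<and>
        (\<exists>d d2. \<forall>x\<in>{0<..<1}.
           (\<Phi> k has_real_derivative d x) (at x) \<and>
           (d has_real_derivative d2 x) (at x) \<and>
           - (x powr \<alpha>) * d2 x = lam k * \<Phi> k x))"

definition Hs_normsq ::
    "real \<Rightarrow> (nat \<Rightarrow> real \<Rightarrow> real) \<Rightarrow> (nat \<Rightarrow> real) \<Rightarrow> real \<Rightarrow> (real \<Rightarrow> real) \<Rightarrow> real" where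
  "Hs_normsq \<alpha> \<Phi> lam s f =
     (\<Sum>k. (l2_inner (weighted_measure \<alpha>) f (\<Phi> k))\<^sup>2 * lam k powr s)"

definition Hs_space ::
    "real \<Rightarrow> (nat \<Rightarrow> real \<Rightarrow> real) \<Rightarrow> (nat \<Rightarrow> real) \<Rightarrow> real \<Rightarrow> (real \<Rightarrow> real) set" where
  "Hs_space \<alpha> \<Phi> lam s =
     {f. square_integrable (weighted_measure \<alpha>) f \<and>
         summable (\<lambda>k. (l2_inner (weighted_measure \<alpha>) f (\<Phi> k))\<^sup>2 * lam k powr s)}"

definition wave_energy ::
    "real \<Rightarrow> (nat \<Rightarrow> real \<Rightarrow> real) \<Rightarrow> (nat \<Rightarrow> real) \<Rightarrow> real \<Rightarrow> (real \<Rightarrow> real) \<Rightarrow> (real \<Rightarrow> real) \<Rightarrow> real" where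
  "wave_energy \<alpha> \<Phi> lam \<nu> u0 u1 =
     Hs_normsq \<alpha> \<Phi> lam (\<nu> + 1/2) u0 + Hs_normsq \<alpha> \<Phi> lam (\<nu> - 1/2) u1"

text \<open>
  \<open>H10_deriv v dv\<close>: on \<open>[0,1]\<close> the function \<open>v\<close> is absolutely continuous, vanishes at both ends,
  and has weak derivative \<open>dv\<close> in \<open>L\<^sup>2(0,1)\<close>; that is, \<open>v\<close> lies in the usual Sobolev space
  \<open>H\<^sup>1\<^sub>0(0,1)\<close>. The function \<open>dv\<close> is determined only almost everywhere.
\<close>

definition H10_deriv :: "(real \<Rightarrow> real) \<Rightarrow> (real \<Rightarrow> real) \<Rightarrow> bool" where
  "H10_deriv v dv \<longleftrightarrow>
     square_integrable interval_measure01 dv \<and>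
     (\<forall>x\<in>{0..1}. v x = (LINT y:{0<..<x}|lborel. dv y)) \<and> v 1 = 0"

text \<open>
  Finite-energy weak solutions: \<open>u\<close> is continuous in \<open>t\<close> with values in \<open>H\<^sup>1\<^sub>0(0,1)\<close> (which carries
  the Dirichlet conditions), continuously differentiable in \<open>t\<close> with values in the weighted
  \<open>L\<^sup>2\<close> space, and satisfies the equation multiplied by \<open>x powr (- \<alpha>)\<close> and integrated by parts
  in \<open>x\<close> against every test function in \<open>H\<^sup>1\<^sub>0(0,1)\<close>. Here \<open>ux\<close> and \<open>ut\<close> are the partial
  derivatives, and functions of space and time take \<open>x\<close> first.
\<close>

definition wave_solution ::
    "real \<Rightarrow> real \<Rightarrow> (real \<Rightarrow> real) \<Rightarrow> (real \<Rightarrow> real) \<Rightarrow> (real \<Rightarrow> real \<Rightarrow> real) \<Rightarrow> bool" where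
  "wave_solution \<alpha> T u0 u1 u \<longleftrightarrow>
     (\<exists>ux ut.
        (\<forall>t\<in>{0..T}.
           H10_deriv (\<lambda>x. u x t) (\<lambda>x. ux x t) \<and>
           square_integrable (weighted_measure \<alpha>) (\<lambda>x. ut x t) \<and>
           ((\<lambda>s. l2_normsq interval_measure01 (\<lambda>x. ux x s - ux x t)) \<longlongrightarrow> 0)
             (at t within {0..T}) \<and>
           ((\<lambda>s. l2_normsq (weighted_measure \<alpha>) (\<lambda>x. (u x s - u x t) / (s - t) - ut x t)) \<longlongrightarrow> 0)
             (at t within {0..T}) \<and>
           ((\<lambda>s. l2_normsq (weighted_measure \<alpha>) (\<lambda>x. ut x s - ut x t)) \<longlongrightarrow> 0)
             (at t within {0..T}) \<and>
           (\<forall>w dw. H10_deriv w dw \<longrightarrow>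
              ((\<lambda>s. l2_inner (weighted_measure \<alpha>) (\<lambda>x. ut x s) w) has_real_derivative
                 - l2_inner interval_measure01 (\<lambda>x. ux x t) dw) (at t within {0..T}))) \<and>
        (AE x in weighted_measure \<alpha>. u x 0 = u0 x) \<and>
        (AE x in weighted_measure \<alpha>. ut x 0 = u1 x))"

text \<open>
  \<open>g\<close> is the limit of the functions \<open>\<partial>\<^sub>x u(x, \<cdot>)\<close> in \<open>L\<^sup>2(0,T)\<close> as \<open>x\<close> tends to 0 from the right.
  The limit is essential in \<open>x\<close> because \<open>\<partial>\<^sub>x u\<close> is determined only almost everywhere. For data of
  finite energy, a limit for almost every single \<open>t\<close> need not exist.
\<close>

definition dx_trace_at_0 :: "real \<Rightarrow> (real \<Rightarrow> real \<Rightarrow> real) \<Rightarrow> (real \<Rightarrow> real) \<Rightarrow> bool" where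
  "dx_trace_at_0 T u g \<longleftrightarrow>
     square_integrable (restrict_space lborel {0<..<T}) g \<and>
     (\<exists>ux. (\<lambda>(x, t). ux x t) \<in> borel_measurable (borel \<Otimes>\<^sub>M borel) \<and>
        (AE t in lborel. 0 < t \<and> t < T \<longrightarrow> H10_deriv (\<lambda>x. u x t) (\<lambda>x. ux x t)) \<and>
        (\<forall>\<epsilon>>0. \<exists>\<delta>>0. AE x in lborel. 0 < x \<and> x < \<delta> \<longrightarrow>
           (\<integral>\<^sup>+t. ennreal ((ux x t - g t)\<^sup>2) \<partial>restrict_space lborel {0<..<T}) \<le> ennreal \<epsilon>))"

definition trace_estimate ::
    "real \<Rightarrow> (nat \<Rightarrow> real \<Rightarrow> real) \<Rightarrow> (nat \<Rightarrow> real) \<Rightarrow> real \<Rightarrow> real \<Rightarrow> real \<Rightarrow> real \<Rightarrow> bool" where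
  "trace_estimate \<alpha> \<Phi> lam \<nu> T c C \<longleftrightarrow>
     (\<forall>u0 u1 u g.
        u0 \<in> Hs_space \<alpha> \<Phi> lam (\<nu> + 1/2) \<longrightarrow> u1 \<in> Hs_space \<alpha> \<Phi> lam (\<nu> - 1/2) \<longrightarrow>
        wave_solution \<alpha> T u0 u1 u \<longrightarrow> dx_trace_at_0 T u g \<longrightarrow>
        c * wave_energy \<alpha> \<Phi> lam \<nu> u0 u1 \<le> (LINT t:{0<..<T}|lborel. (g t)\<^sup>2) \<and>
        (LINT t:{0<..<T}|lborel. (g t)\<^sup>2) \<le> C * wave_energy \<alpha> \<Phi> lam \<nu> u0 u1)"

end

theory Submission
  imports Defs
begin

text \<open>
  Separation of variables turns the observability estimate into a statement about nonharmonic
  Fourier series. Write \<open>\<beta> = 2 - \<alpha> = 2 \<kappa>\<close>, so that \<open>\<nu> = 1/\<beta>\<close>. A finite energy solution with data in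
  \<open>H\<^sup>\<nu>\<^sup>+\<^sup>1\<^sup>/\<^sup>2 \<times> H\<^sup>\<nu>\<^sup>-\<^sup>1\<^sup>/\<^sup>2\<close> is the series of the \<open>(A\<^sub>k cos (\<mu>\<^sub>k t) + B\<^sub>k sin (\<mu>\<^sub>k t)) \<Phi>\<^sub>k(x)\<close> with
  \<open>\<mu>\<^sub>k\<^sup>2 = \<lambda>\<^sub>k\<close> (\<open>solution_series\<close>), and its trace is the series of the
  \<open>(A\<^sub>k cos (\<mu>\<^sub>k t) + B\<^sub>k sin (\<mu>\<^sub>k t)) \<Phi>\<^sub>k'(0)\<close> (\<open>trace_series\<close>). Two facts about the spectrum decide
  everything: \<open>\<Phi>\<^sub>k'(0)\<^sup>2\<close> is comparable to \<open>\<lambda>\<^sub>k\<^sup>\<nu>\<^sup>+\<^sup>1\<^sup>/\<^sup>2\<close> (\<open>slope_bounds\<close>), which is why the energy has the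
  index \<open>\<nu>\<close>, and the frequencies are separated by at least \<open>\<kappa> \<pi>\<close> (\<open>freq_gap\<close>,
  \<open>freq_ge\<close>). Ingham's inequality (\<open>ingham\<close>) then compares the integral over \<open>(0, T)\<close> with the
  sum of squared amplitudes as soon as \<open>T > 2 \<pi> / (\<kappa> \<pi>) = 2/\<kappa>\<close>.

  Both spectral facts come from the equation \<open>w'' + (1 - m/s\<^sup>2) w = 0\<close> with \<open>m = \<nu>\<^sup>2 - 1/4 > 0\<close>,
  into which \<open>s = \<mu> x\<^sup>\<kappa> / \<kappa>\<close> transforms the eigenvalue equation. Its solution that is regular at 0
  is a power of \<open>s\<close> times a power series, the numbers \<open>\<mu>\<^sub>k/\<kappa>\<close> are exactly its positive zeros (by completeness
  of the basis), and \<open>\<Phi>\<^sub>k'(0)\<close> is expressed through \<open>w'\<close> at the zero. Sturm comparison with the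
  sine bounds the gaps from below by \<open>\<pi>\<close>, since \<open>m > 0\<close>, and two monotone energies keep \<open>w'\<close> at
  the zeros between positive constants.

  The gaps tend to \<open>\<kappa> \<pi>\<close>, so far out in the spectrum the frequencies are nearly in arithmetic
  progression. For \<open>T < 2/\<kappa>\<close> a Dirichlet kernel built from \<open>M\<close> such frequencies, peaking between
  the time \<open>T\<close> and the period \<open>2/\<kappa>\<close>, stays bounded on \<open>[0, T]\<close> while its energy grows like \<open>M\<close>
  (\<open>no_estimate_for_short_time\<close>).

  Everywhere the bound \<open>\<bar>\<Phi>\<^sub>k'(x)\<bar> \<le> \<bar>\<Phi>\<^sub>k'(0)\<bar>\<close> (\<open>dmode_bound\<close>) makes estimates at the boundary
  uniform in \<open>x\<close>; it is what allows the passage to the limit \<open>x \<rightarrow> 0\<close> in \<open>trace_series\<close> and the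
  construction of the trace in \<open>trace_exists\<close>.
\<close>

section \<open>Square integrable functions\<close>

lemma square_integrable_mult_integrable:
  assumes "square_integrable M f" "square_integrable M g"
  shows "integrable M (\<lambda>x. f x * g x)"
proof (rule Bochner_Integration.integrable_bound)
  show "integrable M (\<lambda>x. (f x)\<^sup>2 + (g x)\<^sup>2)"
    using assms by (auto simp: square_integrable_def)
  show "(\<lambda>x. f x * g x) \<in> borel_measurable M"
    using assms by (auto simp: square_integrable_def)
  have "\<bar>a * b\<bar> \<le> a\<^sup>2 + b\<^sup>2" for a b :: real
  proof -
    have "2 * (\<bar>a\<bar> * \<bar>b\<bar>) \<le> a\<^sup>2 + b\<^sup>2"
      using sum_squares_bound[of "\<bar>a\<bar>" "\<bar>b\<bar>"] by (simp add: mult.assoc)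
    moreover have "0 \<le> \<bar>a\<bar> * \<bar>b\<bar>" by simp
    ultimately show ?thesis unfolding abs_mult by linarith
  qed
  then show "AE x in M. norm (f x * g x) \<le> norm ((f x)\<^sup>2 + (g x)\<^sup>2)"
    by simp
qed

lemma square_integrable_scale:
  "square_integrable M f \<Longrightarrow> square_integrable M (\<lambda>x. c * f x)"
  by (auto simp: square_integrable_def power_mult_distrib)

lemma square_integrable_add:
  assumes "square_integrable M f" "square_integrable M g"
  shows "square_integrable M (\<lambda>x. f x + g x)"
  using assms square_integrable_mult_integrable[OF assms]
  by (auto simp: square_integrable_def power2_sum mult.assoc)

lemma square_integrable_diff:
  assumes "square_integrable M f" "square_integrable M g"
  shows "square_integrable M (\<lambda>x. f x - g x)"
  using square_integrable_add[OF assms(1) square_integrable_scale[OF assms(2), of "-1"]] by simp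

lemma square_integrable_zero: "square_integrable M (\<lambda>x. 0)"
  by (auto simp: square_integrable_def)

lemma square_integrable_sum:
  "(\<And>k. k \<in> K \<Longrightarrow> square_integrable M (f k)) \<Longrightarrow> square_integrable M (\<lambda>x. \<Sum>k\<in>K. f k x)"
  by (induction K rule: infinite_finite_induct)
     (auto simp: square_integrable_zero intro: square_integrable_add)

lemma l2_normsq_eq_inner: "l2_normsq M f = l2_inner M f f"
  by (simp add: l2_normsq_def l2_inner_def power2_eq_square)

lemma l2_normsq_nonneg [simp]: "0 \<le> l2_normsq M f"
  by (simp add: l2_normsq_def)

lemma l2_inner_commute: "l2_inner M f g = l2_inner M g f"
  by (simp add: l2_inner_def mult.commute)

lemma l2_inner_diff_left:
  assumes "square_integrable M f" "square_integrable M g" "square_integrable M h"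
  shows "l2_inner M (\<lambda>x. f x - g x) h = l2_inner M f h - l2_inner M g h"
  using assms by (simp add: l2_inner_def left_diff_distrib square_integrable_mult_integrable)

lemma l2_inner_scale_left: "l2_inner M (\<lambda>x. c * f x) h = c * l2_inner M f h"
  by (simp add: l2_inner_def mult.assoc)

lemma l2_normsq_scale: "l2_normsq M (\<lambda>x. c * f x) = c\<^sup>2 * l2_normsq M f"
  by (simp add: l2_normsq_def power_mult_distrib)

lemma l2_inner_sum_left:
  assumes "\<And>k. k \<in> K \<Longrightarrow> square_integrable M (f k)" "square_integrable M h"
  shows "l2_inner M (\<lambda>x. \<Sum>k\<in>K. c k * f k x) h = (\<Sum>k\<in>K. c k * l2_inner M (f k) h)"
proof -
  have "l2_inner M (\<lambda>x. \<Sum>k\<in>K. c k * f k x) h = (\<integral>x. (\<Sum>k\<in>K. c k * (f k x * h x)) \<partial>M)"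
    unfolding l2_inner_def by (simp add: sum_distrib_right mult.assoc)
  also have "\<dots> = (\<Sum>k\<in>K. c k * l2_inner M (f k) h)"
    using assms by (subst Bochner_Integration.integral_sum)
      (auto simp: l2_inner_def square_integrable_mult_integrable)
  finally show ?thesis .
qed

lemma l2_normsq_orthogonal_sum:
  assumes fin: "finite K" and sq: "\<And>k. k \<in> K \<Longrightarrow> square_integrable M (e k)"
    and orth: "\<And>j k. j \<in> K \<Longrightarrow> k \<in> K \<Longrightarrow> l2_inner M (e j) (e k) = (if j = k then d k else 0)"
  shows "l2_normsq M (\<lambda>x. \<Sum>k\<in>K. c k * e k x) = (\<Sum>k\<in>K. (c k)\<^sup>2 * d k)"
proof -
  have sqs: "square_integrable M (\<lambda>x. \<Sum>k\<in>K. c k * e k x)"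
    by (intro square_integrable_sum square_integrable_scale sq)
  have "l2_normsq M (\<lambda>x. \<Sum>k\<in>K. c k * e k x)
      = (\<Sum>j\<in>K. c j * l2_inner M (e j) (\<lambda>x. \<Sum>k\<in>K. c k * e k x))"
    unfolding l2_normsq_eq_inner using sq sqs by (rule l2_inner_sum_left)
  also have "\<dots> = (\<Sum>j\<in>K. c j * (\<Sum>k\<in>K. c k * l2_inner M (e k) (e j)))"
  proof (rule sum.cong[OF refl])
    fix j assume "j \<in> K"
    show "c j * l2_inner M (e j) (\<lambda>x. \<Sum>k\<in>K. c k * e k x)
        = c j * (\<Sum>k\<in>K. c k * l2_inner M (e k) (e j))"
      by (subst l2_inner_commute, subst l2_inner_sum_left) (auto simp: sq \<open>j \<in> K\<close>)
  qed
  also have "\<dots> = (\<Sum>j\<in>K. c j * (c j * d j))"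
  proof (rule sum.cong[OF refl])
    fix j assume j: "j \<in> K"
    have "(\<Sum>k\<in>K. c k * l2_inner M (e k) (e j)) = (\<Sum>k\<in>K. if k = j then c k * d k else 0)"
      by (rule sum.cong) (auto simp: orth j)
    then show "c j * (\<Sum>k\<in>K. c k * l2_inner M (e k) (e j)) = c j * (c j * d j)"
      using fin j by (simp add: sum.delta)
  qed
  finally show ?thesis by (simp add: power2_eq_square mult.assoc)
qed

lemma l2_normsq_add:
  assumes "square_integrable M f" "square_integrable M g"
  shows "l2_normsq M (\<lambda>x. f x + g x) = l2_normsq M f + 2 * l2_inner M f g + l2_normsq M g"
  using assms square_integrable_mult_integrable[OF assms]
  by (simp add: l2_normsq_def l2_inner_def square_integrable_def power2_sum mult.assoc)

lemma l2_Cauchy_Schwarz: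
  assumes f: "square_integrable M f" and g: "square_integrable M g"
  shows "(l2_inner M f g)\<^sup>2 \<le> l2_normsq M f * l2_normsq M g"
proof -
  define A B C where "A = l2_normsq M f" and "B = l2_normsq M g" and "C = l2_inner M f g"
  have q: "0 \<le> A + 2 * a * C + a\<^sup>2 * B" for a
  proof -
    have "l2_normsq M (\<lambda>x. f x + a * g x) = A + 2 * a * C + a\<^sup>2 * B"
      unfolding A_def B_def C_def l2_normsq_add[OF f square_integrable_scale[OF g]] l2_normsq_scale
      by (simp add: l2_inner_commute[of M f] l2_inner_scale_left)
    then show ?thesis using l2_normsq_nonneg[of M "\<lambda>x. f x + a * g x"] by simp
  qed
  show ?thesis
  proof (cases "B = 0")
    case True
    have "C = 0"
    proof (rule ccontr)
      assume "C \<noteq> 0"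
      with q[of "- (A + 1) / (2 * C)"] True show False by (simp add: field_simps)
    qed
    then show ?thesis by (simp add: A_def B_def C_def)
  next
    case False
    then have "0 < B" using l2_normsq_nonneg[of M g] unfolding B_def by linarith
    with q[of "- C / B"] have "0 \<le> A - C\<^sup>2 / B"
      by (simp add: power2_eq_square field_simps)
    with \<open>0 < B\<close> have "C\<^sup>2 \<le> A * B" by (simp add: field_simps)
    then show ?thesis by (simp add: A_def B_def C_def)
  qed
qed

lemma l2_abs_inner_le:
  assumes "square_integrable M f" "square_integrable M g"
  shows "\<bar>l2_inner M f g\<bar> \<le> sqrt (l2_normsq M f) * sqrt (l2_normsq M g)"
  using l2_Cauchy_Schwarz[OF assms] by (metis real_sqrt_abs real_sqrt_le_mono real_sqrt_mult)

lemma l2_triangle: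
  assumes f: "square_integrable M f" and g: "square_integrable M g"
  shows "sqrt (l2_normsq M (\<lambda>x. f x + g x)) \<le> sqrt (l2_normsq M f) + sqrt (l2_normsq M g)"
proof (rule real_le_lsqrt)
  show "l2_normsq M (\<lambda>x. f x + g x) \<le> (sqrt (l2_normsq M f) + sqrt (l2_normsq M g))\<^sup>2"
    using l2_abs_inner_le[OF f g] by (simp add: l2_normsq_add[OF f g] power2_sum)
qed auto

text \<open>Fatou's lemma, in the form in which it identifies an almost everywhere limit as a limit
  in mean square.\<close>

lemma l2_AE_limit:
  fixes f :: "nat \<Rightarrow> real \<Rightarrow> real"
  assumes f: "\<And>i. square_integrable M (f i)" and F: "F \<in> borel_measurable M"
    and lim: "AE x in M. (\<lambda>i. f i x) \<longlonglongrightarrow> F x" and g: "square_integrable M g"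
    and bd: "eventually (\<lambda>i. l2_normsq M (\<lambda>x. f i x - g x) \<le> c) sequentially"
  shows "square_integrable M F" and "l2_normsq M (\<lambda>x. F x - g x) \<le> c"
proof -
  have m[measurable]: "\<And>i. f i \<in> borel_measurable M" "F \<in> borel_measurable M"
      "g \<in> borel_measurable M"
    using f F g by (auto simp: square_integrable_def)
  have c: "0 \<le> c"
    using eventually_happens'[OF _ bd] l2_normsq_nonneg order_trans by (metis trivial_limit_sequentially)
  have "(\<integral>\<^sup>+x. ennreal ((F x - g x)\<^sup>2) \<partial>M)
      = (\<integral>\<^sup>+x. liminf (\<lambda>i. ennreal ((f i x - g x)\<^sup>2)) \<partial>M)"
  proof (rule nn_integral_cong_AE, use lim in eventually_elim)
    fix x assume "(\<lambda>i. f i x) \<longlonglongrightarrow> F x"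
    then have "(\<lambda>i. ennreal ((f i x - g x)\<^sup>2)) \<longlonglongrightarrow> ennreal ((F x - g x)\<^sup>2)"
      by (intro tendsto_ennrealI tendsto_intros)
    then show "ennreal ((F x - g x)\<^sup>2) = liminf (\<lambda>i. ennreal ((f i x - g x)\<^sup>2))"
      by (rule lim_imp_Liminf[OF trivial_limit_sequentially, symmetric])
  qed
  also have "\<dots> \<le> liminf (\<lambda>i. \<integral>\<^sup>+x. ennreal ((f i x - g x)\<^sup>2) \<partial>M)"
    by (intro nn_integral_liminf) auto
  also have "\<dots> \<le> ennreal c"
  proof (rule Liminf_le)
    show "eventually (\<lambda>i. (\<integral>\<^sup>+x. ennreal ((f i x - g x)\<^sup>2) \<partial>M) \<le> ennreal c) sequentially"
      using bd
    proof eventually_elim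
      case (elim i)
      have "(\<integral>\<^sup>+x. ennreal ((f i x - g x)\<^sup>2) \<partial>M) = ennreal (l2_normsq M (\<lambda>x. f i x - g x))"
        unfolding l2_normsq_def
        using square_integrable_diff[OF f[of i] g]
        by (intro nn_integral_eq_integral) (auto simp: square_integrable_def)
      then show ?case using elim by (simp add: ennreal_leI)
    qed
  qed auto
  finally have b: "(\<integral>\<^sup>+x. ennreal ((F x - g x)\<^sup>2) \<partial>M) \<le> ennreal c" .
  then have "integrable M (\<lambda>x. (F x - g x)\<^sup>2)"
    by (intro integrableI_nonneg) (auto simp: le_less_trans)
  then have d: "square_integrable M (\<lambda>x. F x - g x)" by (simp add: square_integrable_def)
  from square_integrable_add[OF d g] show "square_integrable M F" by simp
  have "ennreal (l2_normsq M (\<lambda>x. F x - g x)) = (\<integral>\<^sup>+x. ennreal ((F x - g x)\<^sup>2) \<partial>M)"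
    unfolding l2_normsq_def using d
    by (intro nn_integral_eq_integral[symmetric]) (auto simp: square_integrable_def)
  with b c show "l2_normsq M (\<lambda>x. F x - g x) \<le> c" by (metis ennreal_le_iff)
qed

text \<open>On a finite measure space the bound \<open>2 \<bar>d\<bar> \<le> a + d\<^sup>2/a\<close> makes a mean square Cauchy sequence
  Cauchy in the mean, and such a sequence has an almost everywhere convergent subsequence.\<close>

lemma mean_square_Cauchy_AE_subseq:
  fixes f :: "nat \<Rightarrow> 'a \<Rightarrow> real"
  assumes M: "finite_measure M" and f[measurable]: "\<And>i. f i \<in> borel_measurable M"
    and f2: "\<And>i. integrable M (\<lambda>x. (f i x)\<^sup>2)"
    and C: "\<And>e. e > 0 \<Longrightarrow> \<exists>N. \<forall>i\<ge>N. \<forall>j\<ge>N. (\<integral>x. (f i x - f j x)\<^sup>2 \<partial>M) \<le> e"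
  obtains r where "strict_mono r" "AE x in M. Cauchy (\<lambda>i. f (r i) x)"
proof -
  interpret finite_measure M by fact
  have le: "\<bar>d\<bar> \<le> (a + d\<^sup>2 / a) / 2" if "a > 0" for a d :: real
  proof -
    have "0 \<le> (\<bar>d\<bar> - a)\<^sup>2 / a" using that by simp
    also have "(\<bar>d\<bar> - a)\<^sup>2 = d\<^sup>2 - 2 * \<bar>d\<bar> * a + a * a"
      by (simp add: power2_diff power2_eq_square[of a])
    also have "\<dots> / a = a + d\<^sup>2 / a - 2 * \<bar>d\<bar>"
      using that by (simp add: field_simps)
    finally show ?thesis by simp
  qed
  have int: "integrable M (f i)" for i
  proof (rule Bochner_Integration.integrable_bound)
    show "integrable M (\<lambda>x. (1 + (f i x)\<^sup>2 / 1) / 2)" using f2 by simp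
    show "AE x in M. norm (f i x) \<le> norm ((1 + (f i x)\<^sup>2 / 1) / 2)"
      using le[of 1] by (auto simp: abs_of_nonneg)
  qed simp
  have d2: "integrable M (\<lambda>x. (f i x - f j x)\<^sup>2)" for i j
  proof (rule Bochner_Integration.integrable_bound)
    show "integrable M (\<lambda>x. 2 * (f i x)\<^sup>2 + 2 * (f j x)\<^sup>2)" using f2 by simp
    have "(a - b)\<^sup>2 \<le> 2 * a\<^sup>2 + 2 * b\<^sup>2" for a b :: real
      using zero_le_power2[of "a + b"] by (simp add: power2_sum power2_diff)
    then show "AE x in M. norm ((f i x - f j x)\<^sup>2) \<le> norm (2 * (f i x)\<^sup>2 + 2 * (f j x)\<^sup>2)"
      by simp
  qed simp
  show ?thesis
  proof (rule cauchy_L1_AE_cauchy_subseq[of M f])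
    show "integrable M (f n)" for n by (rule int)
    fix e :: real assume e: "e > 0"
    define m where "m = measure M (space M) + 1"
    have m: "m > 0" by (simp add: m_def add_nonneg_pos)
    define a where "a = e / m"
    have a: "a > 0" using e m by (simp add: a_def)
    obtain N where N: "\<forall>i\<ge>N. \<forall>j\<ge>N. (\<integral>x. (f i x - f j x)\<^sup>2 \<partial>M) \<le> e * a / 2"
      using C[of "e * a / 2"] e a by auto
    show "\<exists>N. \<forall>i\<ge>N. \<forall>j\<ge>N. LINT x|M. norm (f i x - f j x) < e"
    proof (intro exI allI impI)
      fix i j assume ij: "i \<ge> N" "j \<ge> N"
      have "(LINT x|M. norm (f i x - f j x)) \<le> (LINT x|M. (a + (f i x - f j x)\<^sup>2 / a) / 2)"
        using d2 int le[OF a] by (intro integral_mono) auto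
      also have "\<dots> = (a * measure M (space M) + (LINT x|M. (f i x - f j x)\<^sup>2) / a) / 2"
        using d2 by simp
      also have "\<dots> \<le> (a * m + (e * a / 2) / a) / 2"
        using N ij a by (intro divide_right_mono add_mono mult_left_mono) (auto simp: m_def)
      also have "\<dots> < e" using e m a by (simp add: a_def)
      finally show "LINT x|M. norm (f i x - f j x) < e" .
    qed
  qed (use that in blast)
qed

section \<open>Calculus on an open interval\<close>

lemma MVT_open:
  fixes f :: "real \<Rightarrow> real"
  assumes "a < b" "continuous_on {a..b} f"
    and D: "\<And>x. a < x \<Longrightarrow> x < b \<Longrightarrow> (f has_real_derivative f' x) (at x)"
  obtains z where "a < z" "z < b" "f b - f a = (b - a) * f' z"
proof -
  have "\<exists>l z. a < z \<and> z < b \<and> DERIV f z :> l \<and> f b - f a = (b - a) * l"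
    using assms by (intro MVT) (auto simp: real_differentiable_def)
  then show ?thesis using that D DERIV_unique by metis
qed

lemma set_integral_FTC:
  fixes f F :: "real \<Rightarrow> real"
  assumes "a \<le> b" and F: "continuous_on {a..b} F"
    and D: "\<And>x. a < x \<Longrightarrow> x < b \<Longrightarrow> (F has_real_derivative f x) (at x)"
    and f: "set_integrable lborel {a<..<b} f"
  shows "(LINT x:{a<..<b}|lborel. f x) = F b - F a"
proof -
  have "(f has_integral F b - F a) {a..b}"
    using assms by (intro fundamental_theorem_of_calculus_interior)
      (auto simp: has_real_derivative_iff_has_vector_derivative[symmetric])
  then have "integral {a<..<b} f = F b - F a"
    by (metis integral_open_interval_real integral_unique)
  with set_borel_integral_eq_integral(2)[OF f] show ?thesis by simp
qed

lemma set_integrable_continuous_Ioo: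
  fixes f :: "real \<Rightarrow> real"
  assumes "continuous_on {a..b} f"
  shows "set_integrable lborel {a<..<b} f"
  by (rule set_integrable_subset[OF borel_integrable_atLeastAtMost'[OF assms]]) auto

lemma set_integrable_powr_Ioo:
  assumes a: "a > -1"
  shows "set_integrable lborel {0<..<1} (\<lambda>x::real. x powr a)"
proof -
  have "(\<lambda>x::real. x powr a) absolutely_integrable_on {0..1}"
    using integrable_on_powr_from_0[OF a, of 1] by (intro nonnegative_absolutely_integrable_1) auto
  then have "integrable lebesgue (\<lambda>x. indicator {0..1} x *\<^sub>R x powr a)"
    by (simp add: set_integrable_def)
  then have "integrable lborel (\<lambda>x. indicator {0..1} x *\<^sub>R x powr a)"
    by (subst (asm) integrable_completion) auto
  then have "set_integrable lborel {0..1} (\<lambda>x::real. x powr a)"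
    by (simp add: set_integrable_def)
  then show ?thesis by (rule set_integrable_subset) auto
qed

section \<open>The entire function behind the eigenfunctions\<close>

definition bessel_coeff :: "real \<Rightarrow> nat \<Rightarrow> real" where
  "bessel_coeff \<beta> n = (\<Prod>j=1..n. - 1 / (real j * \<beta> * (real j * \<beta> + 1)))"

text \<open>Up to a constant, \<open>bessel_G \<beta> r\<close> is \<open>s\<^sup>-\<^sup>\<nu> J\<^sub>\<nu>(s)\<close> for the Bessel function of order \<open>\<nu> = 1/\<beta>\<close>, where
  \<open>s = 2 \<surd>r / \<beta>\<close>. In the variable \<open>r\<close> it is entire.\<close>

definition bessel_G :: "real \<Rightarrow> real \<Rightarrow> real" where
  "bessel_G \<beta> r = (\<Sum>n. bessel_coeff \<beta> n * r ^ n)"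

definition bessel_G' :: "real \<Rightarrow> real \<Rightarrow> real" where
  "bessel_G' \<beta> r = (\<Sum>n. diffs (bessel_coeff \<beta>) n * r ^ n)"

definition bessel_G'' :: "real \<Rightarrow> real \<Rightarrow> real" where
  "bessel_G'' \<beta> r = (\<Sum>n. diffs (diffs (bessel_coeff \<beta>)) n * r ^ n)"

lemma bessel_coeff_0 [simp]: "bessel_coeff \<beta> 0 = 1"
  by (simp add: bessel_coeff_def)

lemma bessel_coeff_Suc:
  "bessel_coeff \<beta> (Suc n) = - bessel_coeff \<beta> n / (real (Suc n) * \<beta> * (real (Suc n) * \<beta> + 1))"
  by (simp add: bessel_coeff_def)

lemma bessel_coeff_bound:
  assumes "\<beta> > 0"
  shows "\<bar>bessel_coeff \<beta> n\<bar> \<le> (1 / \<beta>) ^ n / fact n"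
proof (induction n)
  case (Suc n)
  have "1 \<le> real (Suc n) * \<beta> + 1" using assms by simp
  then have d: "real (Suc n) * \<beta> \<le> real (Suc n) * \<beta> * (real (Suc n) * \<beta> + 1)"
    using assms mult_left_mono[of 1 "real (Suc n) * \<beta> + 1" "real (Suc n) * \<beta>"] by simp
  have "\<bar>bessel_coeff \<beta> (Suc n)\<bar>
      = \<bar>bessel_coeff \<beta> n\<bar> / (real (Suc n) * \<beta> * (real (Suc n) * \<beta> + 1))"
    unfolding bessel_coeff_Suc using assms by (simp add: abs_mult)
  also have "\<dots> \<le> ((1 / \<beta>) ^ n / fact n) / (real (Suc n) * \<beta>)"
    using assms by (intro frac_le Suc d) auto
  also have "\<dots> = (1 / \<beta>) ^ Suc n / fact (Suc n)" by (simp add: field_simps)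
  finally show ?case .
qed simp

lemma bessel_summable:
  assumes "\<beta> > 0"
  shows "summable (\<lambda>n. bessel_coeff \<beta> n * r ^ n)"
proof (rule summable_comparison_test')
  show "summable (\<lambda>n. inverse (fact n) * (\<bar>r\<bar> / \<beta>) ^ n)" by (rule summable_exp)
  fix n
  have "norm (bessel_coeff \<beta> n * r ^ n) \<le> ((1 / \<beta>) ^ n / fact n) * \<bar>r\<bar> ^ n"
    unfolding real_norm_def abs_mult power_abs[symmetric]
    by (intro mult_right_mono bessel_coeff_bound assms) auto
  also have "\<dots> = inverse (fact n) * (\<bar>r\<bar> / \<beta>) ^ n"
    by (simp add: field_simps power_divide)
  finally show "norm (bessel_coeff \<beta> n * r ^ n) \<le> inverse (fact n) * (\<bar>r\<bar> / \<beta>) ^ n" .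
qed

lemma bessel_summable':
  assumes "\<beta> > 0"
  shows "summable (\<lambda>n. diffs (bessel_coeff \<beta>) n * r ^ n)"
    and "summable (\<lambda>n. diffs (diffs (bessel_coeff \<beta>)) n * r ^ n)"
  by (intro termdiff_converges_all bessel_summable assms)+

lemma bessel_G_deriv:
  assumes "\<beta> > 0"
  shows "(bessel_G \<beta> has_real_derivative bessel_G' \<beta> r) (at r)"
  unfolding bessel_G_def[abs_def] bessel_G'_def
  by (intro termdiffs_strong_converges_everywhere bessel_summable assms)

lemma bessel_G'_deriv:
  assumes "\<beta> > 0"
  shows "(bessel_G' \<beta> has_real_derivative bessel_G'' \<beta> r) (at r)"
  unfolding bessel_G'_def[abs_def] bessel_G''_def
  by (intro termdiffs_strong_converges_everywhere bessel_summable' assms)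

lemma bessel_G_0 [simp]: "bessel_G \<beta> 0 = 1"
  using powser_zero[of "bessel_coeff \<beta>"] by (simp add: bessel_G_def)

text \<open>Bessel's equation in the variable \<open>r\<close>; on coefficients it is the recursion
  \<open>bessel_coeff_Suc\<close>.\<close>

lemma bessel_ode:
  assumes b: "\<beta> > 0"
  shows "\<beta>\<^sup>2 * r * bessel_G'' \<beta> r + \<beta> * (\<beta> + 1) * bessel_G' \<beta> r + bessel_G \<beta> r = 0"
proof -
  let ?c = "bessel_coeff \<beta>"
  have "(\<lambda>n. r * (of_nat n * diffs ?c n * r ^ (n - Suc 0))) sums (r * bessel_G'' \<beta> r)"
    unfolding bessel_G''_def by (intro sums_mult diffs_equiv bessel_summable' b)
  moreover have "r * (of_nat n * diffs ?c n * r ^ (n - Suc 0)) = real n * diffs ?c n * r ^ n" for n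
    by (cases n) auto
  ultimately have 2: "(\<lambda>n. real n * diffs ?c n * r ^ n) sums (r * bessel_G'' \<beta> r)" by simp
  have 1: "(\<lambda>n. diffs ?c n * r ^ n) sums bessel_G' \<beta> r"
    unfolding bessel_G'_def by (intro summable_sums bessel_summable' b)
  have 0: "(\<lambda>n. ?c n * r ^ n) sums bessel_G \<beta> r"
    unfolding bessel_G_def by (intro summable_sums bessel_summable b)
  have "(\<lambda>n. \<beta>\<^sup>2 * (real n * diffs ?c n * r ^ n) + \<beta> * (\<beta> + 1) * (diffs ?c n * r ^ n) + ?c n * r ^ n)
      sums (\<beta>\<^sup>2 * (r * bessel_G'' \<beta> r) + \<beta> * (\<beta> + 1) * bessel_G' \<beta> r + bessel_G \<beta> r)"
    by (intro sums_add sums_mult 0 1 2)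
  moreover have "\<beta>\<^sup>2 * (real n * diffs ?c n * r ^ n) + \<beta> * (\<beta> + 1) * (diffs ?c n * r ^ n) + ?c n * r ^ n = 0" for n
  proof -
    define D where "D = real (Suc n) * \<beta> * (real (Suc n) * \<beta> + 1)"
    have D: "D > 0" unfolding D_def using b by (intro mult_pos_pos add_pos_pos) auto
    have "?c (Suc n) * D = - ?c n"
      unfolding bessel_coeff_Suc D_def[symmetric] using D by simp
    moreover have "\<beta>\<^sup>2 * (real n * diffs ?c n) + \<beta> * (\<beta> + 1) * diffs ?c n = ?c (Suc n) * D"
      unfolding diffs_def D_def by (simp add: algebra_simps power2_eq_square)
    ultimately have "(\<beta>\<^sup>2 * (real n * diffs ?c n) + \<beta> * (\<beta> + 1) * diffs ?c n + ?c n) * r ^ n = 0"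
      by simp
    then show ?thesis by (simp add: algebra_simps)
  qed
  ultimately show ?thesis by (simp add: sums_unique2[OF _ sums_zero] mult.assoc)
qed

section \<open>The eigenvalue equation with initial slope 1\<close>

text \<open>The solution of \<open>- y'' = l x\<^sup>\<beta>\<^sup>-\<^sup>2 y\<close>, that is of \<open>- x\<^sup>\<alpha> y'' = l y\<close> for \<open>\<alpha> = 2 - \<beta>\<close>, with \<open>y(0) = 0\<close>
  and \<open>y'(0) = 1\<close>. Solutions that are not multiples of it do not tend to 0 at 0.\<close>

definition mode :: "real \<Rightarrow> real \<Rightarrow> real \<Rightarrow> real" where
  "mode \<beta> l x = x * bessel_G \<beta> (l * x powr \<beta>)"

definition dmode :: "real \<Rightarrow> real \<Rightarrow> real \<Rightarrow> real" where
  "dmode \<beta> l x = bessel_G \<beta> (l * x powr \<beta>) + \<beta> * (l * x powr \<beta>) * bessel_G' \<beta> (l * x powr \<beta>)"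

lemma mode_0 [simp]: "mode \<beta> l 0 = 0" by (simp add: mode_def)

lemma dmode_0 [simp]: "dmode \<beta> l 0 = 1" by (simp add: dmode_def)

lemma mult_powr_minus_1: "x > 0 \<Longrightarrow> x * x powr (\<beta> - 1) = (x::real) powr \<beta>"
  using powr_mult_base[of x "\<beta> - 1"] by simp

lemma bessel_arg_deriv:
  assumes "x > 0"
  shows "((\<lambda>x. l * x powr \<beta>) has_real_derivative l * (\<beta> * x powr (\<beta> - 1))) (at x)"
  using assms by (auto intro!: derivative_eq_intros)

lemma bessel_G_arg_deriv:
  assumes "\<beta> > 0" "x > 0"
  shows "((\<lambda>x. bessel_G \<beta> (l * x powr \<beta>)) has_real_derivative
      bessel_G' \<beta> (l * x powr \<beta>) * (l * (\<beta> * x powr (\<beta> - 1)))) (at x)"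
  by (rule DERIV_chain2[OF bessel_G_deriv bessel_arg_deriv]) fact+

lemma bessel_G'_arg_deriv:
  assumes "\<beta> > 0" "x > 0"
  shows "((\<lambda>x. bessel_G' \<beta> (l * x powr \<beta>)) has_real_derivative
      bessel_G'' \<beta> (l * x powr \<beta>) * (l * (\<beta> * x powr (\<beta> - 1)))) (at x)"
  by (rule DERIV_chain2[OF bessel_G'_deriv bessel_arg_deriv]) fact+

lemma mode_deriv:
  assumes "\<beta> > 0" "x > 0"
  shows "(mode \<beta> l has_real_derivative dmode \<beta> l x) (at x)"
proof -
  let ?r = "l * x powr \<beta>"
  have "(mode \<beta> l has_real_derivative
      1 * bessel_G \<beta> ?r + (bessel_G' \<beta> ?r * (l * (\<beta> * x powr (\<beta> - 1)))) * x) (at x)"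
    unfolding mode_def[abs_def] by (intro DERIV_mult' DERIV_mult DERIV_ident bessel_G_arg_deriv assms)
  also have "1 * bessel_G \<beta> ?r + (bessel_G' \<beta> ?r * (l * (\<beta> * x powr (\<beta> - 1)))) * x
      = bessel_G \<beta> ?r + \<beta> * (l * (x * x powr (\<beta> - 1))) * bessel_G' \<beta> ?r"
    by (simp add: algebra_simps)
  also have "\<dots> = dmode \<beta> l x"
    unfolding mult_powr_minus_1[OF assms(2)] dmode_def ..
  finally show ?thesis .
qed

lemma dmode_deriv:
  assumes b: "\<beta> > 0" and x: "x > 0"
  shows "(dmode \<beta> l has_real_derivative - l * x powr (\<beta> - 2) * mode \<beta> l x) (at x)"
proof -
  let ?r = "l * x powr \<beta>" and ?d = "l * (\<beta> * x powr (\<beta> - 1))"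
  have "(dmode \<beta> l has_real_derivative bessel_G' \<beta> ?r * ?d +
      ((\<beta> * ?d) * bessel_G' \<beta> ?r + (bessel_G'' \<beta> ?r * ?d) * (\<beta> * ?r))) (at x)"
    unfolding dmode_def[abs_def]
    by (intro DERIV_add DERIV_mult DERIV_cmult bessel_G_arg_deriv bessel_G'_arg_deriv bessel_arg_deriv assms)
  also have "bessel_G' \<beta> ?r * ?d +
      ((\<beta> * ?d) * bessel_G' \<beta> ?r + (bessel_G'' \<beta> ?r * ?d) * (\<beta> * ?r))
      = l * x powr (\<beta> - 1) * (\<beta>\<^sup>2 * ?r * bessel_G'' \<beta> ?r + \<beta> * (\<beta> + 1) * bessel_G' \<beta> ?r)"
    by (simp add: algebra_simps power2_eq_square)
  also have "\<beta>\<^sup>2 * ?r * bessel_G'' \<beta> ?r + \<beta> * (\<beta> + 1) * bessel_G' \<beta> ?r = - bessel_G \<beta> ?r"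
    using bessel_ode[OF b, of ?r] by linarith
  also have "x powr (\<beta> - 1) = x * x powr (\<beta> - 2)"
    using powr_mult_base[of x "\<beta> - 2"] x by simp
  finally show ?thesis by (simp add: mode_def algebra_simps)
qed

lemma continuous_on_powr_nonneg:
  assumes "\<beta> > 0" shows "continuous_on {0..} (\<lambda>x::real. x powr \<beta>)"
  by (rule continuous_on_powr') (use assms in \<open>auto intro!: continuous_intros\<close>)

lemma continuous_on_bessel_arg:
  assumes "\<beta> > 0"
  shows "continuous_on {0..} (\<lambda>x. bessel_G \<beta> (l * x powr \<beta>))"
    and "continuous_on {0..} (\<lambda>x. bessel_G' \<beta> (l * x powr \<beta>))"
proof -
  have c: "continuous_on UNIV (bessel_G \<beta>)" "continuous_on UNIV (bessel_G' \<beta>)"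
    using bessel_G_deriv[OF assms] bessel_G'_deriv[OF assms] DERIV_isCont
    by (auto simp: continuous_on_eq_continuous_at intro: DERIV_isCont)
  have a: "continuous_on {0..} (\<lambda>x::real. l * x powr \<beta>)"
    by (intro continuous_intros continuous_on_powr_nonneg assms)
  show "continuous_on {0..} (\<lambda>x. bessel_G \<beta> (l * x powr \<beta>))"
    by (rule continuous_on_compose2[OF c(1) a]) auto
  show "continuous_on {0..} (\<lambda>x. bessel_G' \<beta> (l * x powr \<beta>))"
    by (rule continuous_on_compose2[OF c(2) a]) auto
qed

lemma continuous_on_mode:
  assumes "\<beta> > 0" shows "continuous_on {0..} (mode \<beta> l)" "continuous_on {0..} (dmode \<beta> l)"
  unfolding mode_def[abs_def] dmode_def[abs_def]
  by (intro continuous_intros continuous_on_bessel_arg continuous_on_powr_nonneg assms)+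

text \<open>The energy \<open>y'\<^sup>2 + l x\<^sup>-\<^sup>\<alpha> y\<^sup>2\<close> of a solution decreases in \<open>x\<close> because its weight does.
  Hence the slope at the degenerate end dominates the slope everywhere, which makes every
  bound below uniform in \<open>x\<close>.\<close>

lemma dmode_bound:
  assumes b: "0 < \<beta>" "\<beta> < 2" and l: "l \<ge> 0" and x: "x \<ge> 0"
  shows "\<bar>dmode \<beta> l x\<bar> \<le> 1"
proof -
  define E where "E = (\<lambda>x. (dmode \<beta> l x)\<^sup>2 + l * x powr \<beta> * (bessel_G \<beta> (l * x powr \<beta>))\<^sup>2)"
  have c: "continuous_on {0..x} E"
    unfolding E_def
    by (intro continuous_intros continuous_on_subset[OF continuous_on_mode(2)[OF b(1)]]
        continuous_on_subset[OF continuous_on_bessel_arg(1)[OF b(1)]]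
        continuous_on_subset[OF continuous_on_powr_nonneg[OF b(1)]]) auto
  have D: "(E has_real_derivative l * z powr (\<beta> - 1) * (\<beta> - 2) * (bessel_G \<beta> (l * z powr \<beta>))\<^sup>2) (at z)"
    if z: "z > 0" for z
  proof -
    let ?r = "l * z powr \<beta>" and ?d = "l * (\<beta> * z powr (\<beta> - 1))"
    let ?G = "bessel_G \<beta> ?r" and ?G' = "bessel_G' \<beta> ?r"
    have "(E has_real_derivative
        2 * dmode \<beta> l z * (- l * z powr (\<beta> - 2) * mode \<beta> l z)
        + (?d * ?G\<^sup>2 + (2 * ?G * (?G' * ?d)) * ?r)) (at z)"
      unfolding E_def
      apply (intro DERIV_add DERIV_mult bessel_arg_deriv z)
      subgoal using DERIV_power[OF dmode_deriv[OF b(1) z, of l], of 2] by (simp add: mult_ac)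
      subgoal using DERIV_power[OF bessel_G_arg_deriv[OF b(1) z, of l], of 2] by (simp add: mult_ac)
      done
    also have "z powr (\<beta> - 2) * mode \<beta> l z = z powr (\<beta> - 1) * ?G"
      using powr_mult_base[of z "\<beta> - 2"] z by (simp add: mode_def mult_ac)
    then have "2 * dmode \<beta> l z * (- l * z powr (\<beta> - 2) * mode \<beta> l z)
        = - 2 * dmode \<beta> l z * l * (z powr (\<beta> - 1) * ?G)"
      by (metis (no_types, opaque_lifting) mult.assoc mult.left_commute mult_minus_left mult_minus_right)
    also have "- 2 * dmode \<beta> l z * l * (z powr (\<beta> - 1) * ?G) + (?d * ?G\<^sup>2 + (2 * ?G * (?G' * ?d)) * ?r)
       = l * z powr (\<beta> - 1) * (\<beta> - 2) * ?G\<^sup>2"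
      unfolding dmode_def by (simp add: algebra_simps power2_eq_square)
    finally show ?thesis .
  qed
  have "E x \<le> E 0"
  proof (rule DERIV_nonpos_imp_decreasing_open[OF x _ c])
    fix z assume "0 < z" "z < x"
    moreover have "0 \<le> (l * z powr (\<beta> - 1) * (2 - \<beta>)) * (bessel_G \<beta> (l * z powr \<beta>))\<^sup>2"
      using b l by (intro mult_nonneg_nonneg) auto
    then have "l * z powr (\<beta> - 1) * (\<beta> - 2) * (bessel_G \<beta> (l * z powr \<beta>))\<^sup>2 \<le> 0"
      by (simp add: algebra_simps)
    ultimately show "\<exists>y. DERIV E z :> y \<and> y \<le> 0"
      using D by blast
  qed
  then have "(dmode \<beta> l x)\<^sup>2 + l * x powr \<beta> * (bessel_G \<beta> (l * x powr \<beta>))\<^sup>2 \<le> 1"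
    by (simp add: E_def)
  moreover have "0 \<le> l * x powr \<beta> * (bessel_G \<beta> (l * x powr \<beta>))\<^sup>2" using l by simp
  ultimately have "(dmode \<beta> l x)\<^sup>2 \<le> 1\<^sup>2" by simp
  then show ?thesis by (metis abs_le_square_iff abs_one)
qed

lemma mode_bound:
  assumes b: "0 < \<beta>" "\<beta> < 2" and l: "l \<ge> 0" and x: "x \<ge> 0"
  shows "\<bar>mode \<beta> l x\<bar> \<le> x"
proof (cases "x = 0")
  case False
  then have x: "0 < x" using x by simp
  obtain z where z: "0 < z" "z < x" "mode \<beta> l x - mode \<beta> l 0 = (x - 0) * dmode \<beta> l z"
    by (rule MVT_open[OF x, of "mode \<beta> l" "dmode \<beta> l"])
      (auto intro: mode_deriv b continuous_on_subset[OF continuous_on_mode(1)[OF b(1)]])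
  then have "\<bar>mode \<beta> l x\<bar> = x * \<bar>dmode \<beta> l z\<bar>" using x by (simp add: abs_mult)
  then show ?thesis using dmode_bound[OF b l, of z] z x by (simp add: mult_left_le)
qed simp

text \<open>Multiplying the equation by \<open>x y'\<close> gives an explicit primitive
  \<open>x y'\<^sup>2 + l x\<^sup>1\<^sup>-\<^sup>\<alpha> y\<^sup>2 - y y'\<close> of \<open>l \<beta> x\<^sup>-\<^sup>\<alpha> y\<^sup>2\<close>. It vanishes at 0, and at 1 only the first term
  survives when \<open>y(1) = 0\<close>.\<close>

lemma weighted_norm_mode:
  assumes b: "0 < \<beta>" "\<beta> < 2" and l: "l > 0" and end1: "bessel_G \<beta> l = 0"
  shows "(LINT x:{0<..<1}|lborel. x powr (\<beta> - 2) * (mode \<beta> l x)\<^sup>2) = (dmode \<beta> l 1)\<^sup>2 / (l * \<beta>)"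
proof -
  let ?g = "\<lambda>x. bessel_G \<beta> (l * x powr \<beta>)"
  define P where "P = (\<lambda>x. x * ((dmode \<beta> l x)\<^sup>2 + l * x powr \<beta> * (?g x)\<^sup>2 - ?g x * dmode \<beta> l x))"
  have eq: "x powr (\<beta> - 2) * (mode \<beta> l x)\<^sup>2 = x powr \<beta> * (?g x)\<^sup>2" if "x > 0" for x
  proof -
    have "x powr (\<beta> - 2) * (x * x) = x powr \<beta>"
      using powr_mult_base[of x "\<beta> - 2"] powr_mult_base[of x "\<beta> - 1"] that
      by (metis (no_types, opaque_lifting) add_diff_cancel_left' diff_add_cancel diff_diff_eq2
          less_eq_real_def mult.assoc mult.commute mult_powr_minus_1 one_add_one)
    then show ?thesis by (simp add: mode_def power2_eq_square mult_ac)
  qed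
  have D: "(P has_real_derivative l * \<beta> * (z powr \<beta> * (?g z)\<^sup>2)) (at z)" if z: "z > 0" for z
  proof -
    let ?r = "l * z powr \<beta>" and ?d = "l * (\<beta> * z powr (\<beta> - 1))"
    let ?G = "bessel_G \<beta> ?r" and ?G' = "bessel_G' \<beta> ?r"
    let ?dd = "- l * z powr (\<beta> - 2) * mode \<beta> l z"
    have "(P has_real_derivative
        1 * ((dmode \<beta> l z)\<^sup>2 + ?r * ?G\<^sup>2 - ?G * dmode \<beta> l z)
        + (2 * dmode \<beta> l z * ?dd + (?d * ?G\<^sup>2 + (2 * ?G * (?G' * ?d)) * ?r)
            - ((?G' * ?d) * dmode \<beta> l z + ?dd * ?G)) * z) (at z)"
      unfolding P_def
      apply (intro DERIV_add DERIV_diff DERIV_mult DERIV_ident bessel_arg_deriv bessel_G_arg_deriv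
          dmode_deriv b z)
      subgoal using DERIV_power[OF dmode_deriv[OF b(1) z, of l], of 2] by (simp add: mult_ac)
      subgoal using DERIV_power[OF bessel_G_arg_deriv[OF b(1) z, of l], of 2] by (simp add: mult_ac)
      done
    also have "?dd = - l * z powr (\<beta> - 1) * ?G"
      using powr_mult_base[of z "\<beta> - 2"] z by (simp add: mode_def mult_ac)
    also have "1 * ((dmode \<beta> l z)\<^sup>2 + ?r * ?G\<^sup>2 - ?G * dmode \<beta> l z)
        + (2 * dmode \<beta> l z * (- l * z powr (\<beta> - 1) * ?G) + (?d * ?G\<^sup>2 + (2 * ?G * (?G' * ?d)) * ?r)
            - ((?G' * ?d) * dmode \<beta> l z + (- l * z powr (\<beta> - 1) * ?G) * ?G)) * z
      = (dmode \<beta> l z)\<^sup>2 + ?r * ?G\<^sup>2 - ?G * dmode \<beta> l z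
        + (l * (z * z powr (\<beta> - 1))) * (- 2 * dmode \<beta> l z * ?G + \<beta> * ?G\<^sup>2 + 2 * ?G * ?G' * \<beta> * ?r
            - \<beta> * ?G' * dmode \<beta> l z + ?G\<^sup>2)"
      by (simp add: algebra_simps power2_eq_square)
    also have "\<dots> = l * \<beta> * (z powr \<beta> * ?G\<^sup>2)"
      unfolding mult_powr_minus_1[OF z] dmode_def by (simp add: algebra_simps power2_eq_square)
    finally show ?thesis .
  qed
  have cg: "continuous_on {0..1} ?g" "continuous_on {0..1} (dmode \<beta> l)" "continuous_on {0..1} (\<lambda>x::real. x powr \<beta>)"
    by (rule continuous_on_subset[OF continuous_on_bessel_arg(1)[OF b(1)]]
        continuous_on_subset[OF continuous_on_mode(2)[OF b(1)]]
        continuous_on_subset[OF continuous_on_powr_nonneg[OF b(1)]], force)+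
  have cP: "continuous_on {0..1} P"
    unfolding P_def by (intro continuous_intros cg)
  have "(LINT x:{0<..<1}|lborel. l * \<beta> * (x powr \<beta> * (?g x)\<^sup>2)) = P 1 - P 0"
    by (rule set_integral_FTC[OF _ cP D]) (auto intro!: set_integrable_continuous_Ioo continuous_intros cg)
  also have "P 1 - P 0 = (dmode \<beta> l 1)\<^sup>2" by (simp add: P_def end1)
  finally have "l * \<beta> * (LINT x:{0<..<1}|lborel. x powr \<beta> * (?g x)\<^sup>2) = (dmode \<beta> l 1)\<^sup>2"
    by simp
  moreover have "(LINT x:{0<..<1}|lborel. x powr (\<beta> - 2) * (mode \<beta> l x)\<^sup>2)
      = (LINT x:{0<..<1}|lborel. x powr \<beta> * (?g x)\<^sup>2)"
    by (rule set_lebesgue_integral_cong) (auto simp: eq)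
  ultimately show ?thesis using l b by (simp add: field_simps)
qed

section \<open>Spacing of the zeros\<close>

locale bessel_order =
  fixes \<beta> :: real
  assumes b0: "0 < \<beta>" and b2: "\<beta> < 2"
begin

text \<open>Liouville's normal form. With \<open>s = 2 \<surd>l x\<^bsup>\<beta>/2\<^esup> / \<beta>\<close> and \<open>y = const x\<^bsup>\<alpha>/4\<^esup> w(s)\<close>, where \<open>\<alpha> = 2 - \<beta>\<close>, every
  \<open>mode \<beta> l\<close> becomes the same solution of \<open>w'' + q w = 0\<close>. Here \<open>p = \<nu> + 1/2\<close> and
  \<open>m = \<nu>\<^sup>2 - 1/4\<close> for \<open>\<nu> = 1/\<beta>\<close>, so that \<open>w(s) = const \<surd>s J\<^sub>\<nu>(s)\<close>.\<close>

definition p :: real where "p = 1 / \<beta> + 1 / 2"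
definition m :: real where "m = p * (p - 1)"
definition q :: "real \<Rightarrow> real" where "q s = 1 - m / s\<^sup>2"
definition w :: "real \<Rightarrow> real" where "w s = s powr p * bessel_G \<beta> ((\<beta> / 2)\<^sup>2 * s\<^sup>2)"
definition dw :: "real \<Rightarrow> real" where
  "dw s = p * s powr (p - 1) * bessel_G \<beta> ((\<beta> / 2)\<^sup>2 * s\<^sup>2)
     + s powr p * (\<beta>\<^sup>2 / 2 * s) * bessel_G' \<beta> ((\<beta> / 2)\<^sup>2 * s\<^sup>2)"

lemma p_gt_1: "p > 1"
  using b0 b2 by (simp add: p_def field_simps)

lemma m_pos: "m > 0"
  using p_gt_1 by (simp add: m_def)

lemma arg_deriv: "((\<lambda>s. (\<beta> / 2)\<^sup>2 * s\<^sup>2) has_real_derivative \<beta>\<^sup>2 / 2 * s) (at s)"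
  by (auto intro!: derivative_eq_intros simp: power_divide)

lemma w_deriv:
  assumes s: "s > 0"
  shows "(w has_real_derivative dw s) (at s)"
proof -
  have P: "((\<lambda>s. s powr p) has_real_derivative p * s powr (p - 1)) (at s)"
    using s by (auto intro!: derivative_eq_intros)
  have G: "((\<lambda>s. bessel_G \<beta> ((\<beta> / 2)\<^sup>2 * s\<^sup>2)) has_real_derivative
      bessel_G' \<beta> ((\<beta> / 2)\<^sup>2 * s\<^sup>2) * (\<beta>\<^sup>2 / 2 * s)) (at s)"
    by (rule DERIV_chain2[OF bessel_G_deriv[OF b0] arg_deriv])
  show ?thesis
    using DERIV_mult[OF P G] unfolding w_def[abs_def] dw_def by (simp add: mult_ac)
qed

lemma dw_deriv:
  assumes s: "s > 0"
  shows "(dw has_real_derivative - q s * w s) (at s)"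
proof -
  let ?r = "(\<beta> / 2)\<^sup>2 * s\<^sup>2" and ?d = "\<beta>\<^sup>2 / 2 * s"
  let ?G = "bessel_G \<beta> ?r" and ?G' = "bessel_G' \<beta> ?r" and ?G'' = "bessel_G'' \<beta> ?r"
  define A where "A = s powr (p - 2)"
  have A1: "s powr (p - 1) = s * A" and A0: "s powr p = s\<^sup>2 * A"
    using powr_mult_base[of s "p - 2"] powr_mult_base[of s "p - 1"] s
    by (simp_all add: A_def power2_eq_square mult.assoc)
  have P: "((\<lambda>s. s powr p) has_real_derivative p * (s * A)) (at s)"
    unfolding A1[symmetric] using s by (auto intro!: derivative_eq_intros)
  have P1: "((\<lambda>s. p * s powr (p - 1)) has_real_derivative p * ((p - 1) * A)) (at s)"
    unfolding A_def using s by (auto intro!: derivative_eq_intros)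
  have G: "((\<lambda>s. bessel_G \<beta> ((\<beta> / 2)\<^sup>2 * s\<^sup>2)) has_real_derivative ?G' * ?d) (at s)"
    by (rule DERIV_chain2[OF bessel_G_deriv[OF b0] arg_deriv])
  have G': "((\<lambda>s. bessel_G' \<beta> ((\<beta> / 2)\<^sup>2 * s\<^sup>2)) has_real_derivative ?G'' * ?d) (at s)"
    by (rule DERIV_chain2[OF bessel_G'_deriv[OF b0] arg_deriv])
  have L: "((\<lambda>s. \<beta>\<^sup>2 / 2 * s) has_real_derivative \<beta>\<^sup>2 / 2) (at s)"
    by (auto intro!: derivative_eq_intros)
  have "(dw has_real_derivative
      (p * ((p - 1) * A) * ?G + (?G' * ?d) * (p * s powr (p - 1)))
      + ((p * (s * A) * ?d + \<beta>\<^sup>2 / 2 * s powr p) * ?G' + (?G'' * ?d) * (s powr p * ?d))) (at s)"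
    unfolding dw_def[abs_def] by (intro DERIV_add DERIV_mult P P1 G G' L)
  also have "(p * ((p - 1) * A) * ?G + (?G' * ?d) * (p * s powr (p - 1)))
      + ((p * (s * A) * ?d + \<beta>\<^sup>2 / 2 * s powr p) * ?G' + (?G'' * ?d) * (s powr p * ?d))
     = A * (m * ?G + s\<^sup>2 * ((p * \<beta>\<^sup>2 + \<beta>\<^sup>2 / 2) * ?G' + \<beta>\<^sup>2 * ?r * ?G''))"
    unfolding A1 A0 m_def by (simp add: algebra_simps power2_eq_square)
  also have "p * \<beta>\<^sup>2 + \<beta>\<^sup>2 / 2 = \<beta> * (\<beta> + 1)"
    using b0 by (simp add: p_def field_simps power2_eq_square)
  also have "\<beta> * (\<beta> + 1) * ?G' + \<beta>\<^sup>2 * ?r * ?G'' = - ?G"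
    using bessel_ode[OF b0, of ?r] by linarith
  also have "A * (m * ?G + s\<^sup>2 * - ?G) = - q s * w s"
    unfolding w_def q_def A0 using s by (simp add: field_simps)
  finally show ?thesis .
qed

lemma continuous_on_w: "continuous_on {0..} w" and continuous_on_dw: "continuous_on {0..} dw"
proof -
  have c: "continuous_on UNIV (bessel_G \<beta>)" "continuous_on UNIV (bessel_G' \<beta>)"
    using bessel_G_deriv[OF b0] bessel_G'_deriv[OF b0] DERIV_isCont
    by (auto simp: continuous_on_eq_continuous_at intro: DERIV_isCont)
  have "continuous_on {0..} (\<lambda>s. bessel_G \<beta> ((\<beta> / 2)\<^sup>2 * s\<^sup>2))"
       "continuous_on {0..} (\<lambda>s. bessel_G' \<beta> ((\<beta> / 2)\<^sup>2 * s\<^sup>2))"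
    by (rule continuous_on_compose2[OF c(1)] continuous_on_compose2[OF c(2)];
        auto intro!: continuous_intros)+
  then show "continuous_on {0..} w" "continuous_on {0..} dw"
    unfolding w_def[abs_def] dw_def[abs_def] using p_gt_1
    by (auto intro!: continuous_intros continuous_on_powr_nonneg)
qed

lemma w_0 [simp]: "w 0 = 0" and dw_0 [simp]: "dw 0 = 0"
  by (simp_all add: w_def dw_def)

lemma w_eq_0_iff: "s > 0 \<Longrightarrow> w s = 0 \<longleftrightarrow> bessel_G \<beta> ((\<beta> / 2)\<^sup>2 * s\<^sup>2) = 0"
  by (simp add: w_def)

lemma dw_at_zero:
  assumes "s > 0" "w s = 0"
  shows "dw s = s powr p * (\<beta>\<^sup>2 / 2 * s) * bessel_G' \<beta> ((\<beta> / 2)\<^sup>2 * s\<^sup>2)"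
  using assms by (simp add: dw_def w_eq_0_iff)

lemma q_deriv:
  assumes "s > 0" shows "(q has_real_derivative 2 * m / s ^ 3) (at s)"
  unfolding q_def[abs_def] using assms
  by (auto intro!: derivative_eq_intros simp: field_simps power2_eq_square power3_eq_cube)

lemma q_mono: "0 < s \<Longrightarrow> s \<le> t \<Longrightarrow> q s \<le> q t"
  unfolding q_def using m_pos by (auto intro!: divide_left_mono mult_pos_pos power_mono)

lemma q_lt_1: "s > 0 \<Longrightarrow> q s < 1"
  unfolding q_def using m_pos by simp

text \<open>As long as \<open>q \<le> 0\<close>, the function \<open>w w'\<close> increases from 0, so \<open>w\<^sup>2\<close> increases too. The
  first zero therefore lies strictly inside the region where \<open>q > 0\<close>.\<close>

lemma no_early_zero:
  obtains s0 where "s0 > 0" "q s0 > 0" "\<And>s. 0 < s \<Longrightarrow> s \<le> s0 \<Longrightarrow> w s \<noteq> 0"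
proof -
  define S where "S = sqrt m"
  have S: "S > 0" "S\<^sup>2 = m" using m_pos by (auto simp: S_def)
  have nz0: "\<exists>t. 0 < t \<and> t < s \<and> w t \<noteq> 0" if "s > 0" for s
  proof -
    have "isCont (bessel_G \<beta>) 0" using bessel_G_deriv[OF b0] DERIV_isCont by blast
    then have "isCont (\<lambda>t. bessel_G \<beta> ((\<beta> / 2)\<^sup>2 * t\<^sup>2)) 0"
      by (intro isCont_o2[of 0 "\<lambda>t. (\<beta> / 2)\<^sup>2 * t\<^sup>2" "bessel_G \<beta>"]) auto
    then have "((\<lambda>t. bessel_G \<beta> ((\<beta> / 2)\<^sup>2 * t\<^sup>2)) \<longlongrightarrow> 1) (at 0)"
      by (simp add: isCont_def)
    then have "((\<lambda>t. bessel_G \<beta> ((\<beta> / 2)\<^sup>2 * t\<^sup>2)) \<longlongrightarrow> 1) (at_right 0)"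
      by (rule tendsto_within_subset) simp
    then have "eventually (\<lambda>t. bessel_G \<beta> ((\<beta> / 2)\<^sup>2 * t\<^sup>2) > 0) (at_right 0)"
      by (rule order_tendstoD) simp
    moreover have "eventually (\<lambda>t. 0 < t \<and> t < s) (at_right (0::real))"
      using that eventually_at_right_less eventually_at_right_real[of 0 s] by (auto elim: eventually_mono)
    ultimately have "eventually (\<lambda>t. 0 < t \<and> t < s \<and> w t \<noteq> 0) (at_right (0::real))"
      by eventually_elim (auto simp: w_def)
    then show ?thesis using eventually_happens trivial_limit_at_right_real by blast
  qed
  define Q where "Q = (\<lambda>s. w s * dw s)"
  have cw: "continuous_on {a..b} w" "continuous_on {a..b} dw" if "a \<ge> 0" for a b
    using that by (auto intro: continuous_on_subset[OF continuous_on_w] continuous_on_subset[OF continuous_on_dw])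
  have Qnn: "0 \<le> Q s" if s: "0 \<le> s" "s \<le> S" for s
  proof -
    have "Q 0 \<le> Q s"
    proof (rule DERIV_nonneg_imp_increasing_open[OF s(1)])
      fix t assume t: "0 < t" "t < s"
      have "(Q has_real_derivative dw t * dw t + - q t * w t * w t) (at t)"
        unfolding Q_def by (intro DERIV_mult w_deriv dw_deriv t)
      moreover have "q t \<le> 0"
      proof -
        have "t\<^sup>2 \<le> m" unfolding S(2)[symmetric] using t s by (intro power_mono) auto
        then show ?thesis using t by (simp add: q_def field_simps)
      qed
      then have "q t * (w t * w t) \<le> 0" by (simp add: mult_nonpos_nonneg)
      then have "0 \<le> dw t * dw t + - q t * w t * w t"
        using zero_le_square[of "dw t"] unfolding mult_minus_left mult.assoc by linarith
      ultimately show "\<exists>y. (Q has_real_derivative y) (at t) \<and> 0 \<le> y" by blast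
    qed (auto simp: Q_def intro!: continuous_intros cw)
    then show ?thesis by (simp add: Q_def)
  qed
  have nz: "w s \<noteq> 0" if s: "0 < s" "s \<le> S" for s
  proof -
    obtain t where t: "0 < t" "t < s" "w t \<noteq> 0" using nz0[OF s(1)] by blast
    have "w t * w t \<le> w s * w s"
    proof (rule DERIV_nonneg_imp_increasing_open[where f = "\<lambda>s. w s * w s"])
      fix r assume r: "t < r" "r < s"
      then have "((\<lambda>s. w s * w s) has_real_derivative 2 * Q r) (at r)" "0 \<le> 2 * Q r"
        using DERIV_mult[OF w_deriv w_deriv, of r] Qnn[of r] t s by (auto simp: Q_def mult_ac)
      then show "\<exists>y. ((\<lambda>s. w s * w s) has_real_derivative y) (at r) \<and> 0 \<le> y" by blast
    qed (use t in \<open>auto intro!: continuous_intros cw\<close>)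
    moreover have "0 < w t * w t" using t by (auto simp: zero_less_mult_iff linorder_neq_iff)
    ultimately show ?thesis by auto
  qed
  have "isCont w S" using w_deriv[OF S(1)] DERIV_isCont by blast
  then obtain e where e: "e > 0" "\<And>s. dist s S < e \<Longrightarrow> w s \<noteq> 0"
    using continuous_at_avoid[of S w 0] nz[of S] S by (auto simp: dist_commute)
  define s0 where "s0 = S + e / 2"
  have "w s \<noteq> 0" if "0 < s" "s \<le> s0" for s
    using nz[of s] e(2)[of s] that e(1) by (cases "s \<le> S") (auto simp: s0_def dist_real_def)
  moreover have "q s0 > 0"
  proof -
    have "m < s0\<^sup>2" unfolding S(2)[symmetric] s0_def using S e by (intro power_strict_mono) auto
    moreover from this have "0 < s0\<^sup>2" using m_pos by linarith
    ultimately show ?thesis by (simp add: q_def divide_less_eq_1)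
  qed
  moreover have "s0 > 0" using S e by (simp add: s0_def)
  ultimately show ?thesis using that by blast
qed

text \<open>Since \<open>q\<close> increases, the energy \<open>w'\<^sup>2 + q w\<^sup>2\<close> increases while its quotient by \<open>q\<close> decreases.
  From \<open>s0\<close> on, \<open>q\<close> lies between \<open>q s0 > 0\<close> and 1, so the two monotonicities bound the energy
  away from 0 and \<open>w'\<close> from above.\<close>

lemma energy_bounds:
  obtains s0 m1 m2 where "s0 > 0" "q s0 > 0" "0 < m1"
    "\<And>s. 0 < s \<Longrightarrow> s \<le> s0 \<Longrightarrow> w s \<noteq> 0"
    "\<And>s. s0 \<le> s \<Longrightarrow> m1 \<le> (dw s)\<^sup>2 + q s * (w s)\<^sup>2"
    "\<And>s. s0 \<le> s \<Longrightarrow> (dw s)\<^sup>2 \<le> m2"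
proof -
  obtain s0 where s0: "s0 > 0" "q s0 > 0" "\<And>s. 0 < s \<Longrightarrow> s \<le> s0 \<Longrightarrow> w s \<noteq> 0"
    using no_early_zero by blast
  define E1 where "E1 = (\<lambda>s. (dw s)\<^sup>2 + q s * (w s)\<^sup>2)"
  define E2 where "E2 = (\<lambda>s. (dw s)\<^sup>2 / q s + (w s)\<^sup>2)"
  have qp: "q s > 0" if "s0 \<le> s" for s using q_mono[OF s0(1) that] s0(2) by simp
  have "E1 s0 \<le> E1 s" if s: "s0 \<le> s" for s
  proof (rule DERIV_nonneg_imp_nondecreasing[OF s])
    fix t assume "s0 \<le> t" "t \<le> s"
    then have t: "t > 0" using s0 by simp
    have "(E1 has_real_derivative 2 * dw t * (- q t * w t) + (2 * m / t ^ 3 * (w t)\<^sup>2 + 2 * w t * dw t * q t)) (at t)"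
      unfolding E1_def
      apply (intro DERIV_add DERIV_mult q_deriv t)
      subgoal using DERIV_power[OF dw_deriv[OF t], of 2] by (simp add: mult_ac)
      subgoal using DERIV_power[OF w_deriv[OF t], of 2] by (simp add: mult_ac)
      done
    also have "2 * dw t * (- q t * w t) + (2 * m / t ^ 3 * (w t)\<^sup>2 + 2 * w t * dw t * q t) = 2 * m / t ^ 3 * (w t)\<^sup>2"
      by simp
    finally show "\<exists>y. (E1 has_real_derivative y) (at t) \<and> 0 \<le> y"
      using m_pos t by (intro exI conjI) auto
  qed
  note E1 = this
  have "E2 s \<le> E2 s0" if s: "s0 \<le> s" for s
  proof (rule DERIV_nonpos_imp_nonincreasing[OF s])
    fix t assume "s0 \<le> t" "t \<le> s"
    then have t: "t > 0" "q t > 0" using s0 qp by auto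
    have "(E2 has_real_derivative (2 * dw t * (- q t * w t) * q t - (dw t)\<^sup>2 * (2 * m / t ^ 3)) / (q t * q t) + 2 * w t * dw t) (at t)"
      unfolding E2_def
      apply (intro DERIV_add DERIV_divide q_deriv t)
      subgoal using DERIV_power[OF dw_deriv[OF t(1)], of 2] by (simp add: mult_ac)
      subgoal using t by simp
      subgoal using DERIV_power[OF w_deriv[OF t(1)], of 2] by (simp add: mult_ac)
      done
    also have "(2 * dw t * (- q t * w t) * q t - (dw t)\<^sup>2 * (2 * m / t ^ 3)) / (q t * q t) + 2 * w t * dw t
        = - ((dw t)\<^sup>2 * (2 * m / t ^ 3) / (q t * q t))"
      using t by (simp add: diff_divide_distrib)
    finally show "\<exists>y. (E2 has_real_derivative y) (at t) \<and> y \<le> 0"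
      using m_pos t by (intro exI conjI) auto
  qed
  note E2 = this
  have "(dw s)\<^sup>2 \<le> E2 s0" if s: "s0 \<le> s" for s
  proof -
    have "(dw s)\<^sup>2 / q s \<le> E2 s0"
      using E2[OF s] zero_le_power2[of "w s"] unfolding E2_def by linarith
    then have "(dw s)\<^sup>2 \<le> E2 s0 * q s" using qp[OF s] by (simp add: field_simps)
    also have "\<dots> \<le> E2 s0 * 1"
      using q_lt_1[of s] s s0 by (intro mult_left_mono) (auto simp: E2_def)
    finally show ?thesis by simp
  qed
  moreover have "E1 s0 > 0" using s0 by (simp add: E1_def add_nonneg_pos)
  ultimately show ?thesis using that[of s0 "E1 s0" "E2 s0"] s0 E1 by (auto simp: E1_def)
qed

lemma dw_at_zero_bounds:
  obtains m1 m2 where "0 < m1" "\<And>s. 0 < s \<Longrightarrow> w s = 0 \<Longrightarrow> m1 \<le> (dw s)\<^sup>2 \<and> (dw s)\<^sup>2 \<le> m2"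
proof -
  obtain s0 m1 m2 where h: "s0 > 0" "q s0 > 0" "0 < m1"
    "\<And>s. 0 < s \<Longrightarrow> s \<le> s0 \<Longrightarrow> w s \<noteq> 0"
    "\<And>s. s0 \<le> s \<Longrightarrow> m1 \<le> (dw s)\<^sup>2 + q s * (w s)\<^sup>2"
    "\<And>s. s0 \<le> s \<Longrightarrow> (dw s)\<^sup>2 \<le> m2" using energy_bounds by blast
  have "m1 \<le> (dw s)\<^sup>2 \<and> (dw s)\<^sup>2 \<le> m2" if "0 < s" "w s = 0" for s
    using h(4)[of s] h(5)[of s] h(6)[of s] that by force
  then show ?thesis using that h(3) by blast
qed

text \<open>Sturm comparison with \<open>sin\<close>, through Picone's identity: for \<open>v = sin (s - a + \<epsilon>)\<close>, which is
  positive on the whole interval, \<open>w w' - w\<^sup>2 v'/v\<close> has derivative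
  \<open>(w' - w v'/v)\<^sup>2 + (1 - q) w\<^sup>2\<close>. The left end may be the singular point 0, so the first zero obeys
  the same bound.\<close>

lemma zero_gap:
  assumes a: "a \<ge> 0" "w a = 0" and b: "w b = 0" and ab: "a < b"
  shows "b - a \<ge> pi"
proof (rule ccontr)
  assume "\<not> b - a \<ge> pi"
  define e where "e = (pi - (b - a)) / 2"
  have e: "e > 0" "b - a + e < pi" using \<open>\<not> b - a \<ge> pi\<close> by (auto simp: e_def field_simps)
  define F where "F = (\<lambda>s. w s * dw s - (w s)\<^sup>2 * (cos (s - a + e) / sin (s - a + e)))"
  have sp: "sin (s - a + e) > 0" if "a \<le> s" "s \<le> b" for s
    using that e by (intro sin_gt_zero) auto
  have cw: "continuous_on {a..b} w" "continuous_on {a..b} dw"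
    using a by (auto intro: continuous_on_subset[OF continuous_on_w] continuous_on_subset[OF continuous_on_dw])
  have cF: "continuous_on {a..b} F"
    unfolding F_def using sp by (intro continuous_intros cw) force
  have D: "\<exists>y. (F has_real_derivative y) (at s) \<and> (1 - q s) * (w s)\<^sup>2 \<le> y" if s: "a < s" "s < b" for s
  proof -
    have s0: "s > 0" using s a by simp
    let ?c = "cos (s - a + e)" and ?s = "sin (s - a + e)"
    have sn: "?s \<noteq> 0" using sp[of s] s by simp
    have cot: "((\<lambda>s. cos (s - a + e) / sin (s - a + e)) has_real_derivative
        (- ?s * ?s - ?c * ?c) / (?s * ?s)) (at s)"
      using sn by (auto intro!: derivative_eq_intros)
    have "(F has_real_derivative (dw s * dw s + - q s * w s * w s)
        - (2 * w s * dw s * (?c / ?s) + (- ?s * ?s - ?c * ?c) / (?s * ?s) * (w s)\<^sup>2)) (at s)"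
      unfolding F_def
      apply (intro DERIV_diff DERIV_mult w_deriv dw_deriv cot s0)
      subgoal using DERIV_power[OF w_deriv[OF s0], of 2] by (simp add: mult_ac)
      done
    also have "(- ?s * ?s - ?c * ?c) / (?s * ?s) = - 1 - (?c / ?s)\<^sup>2"
      using sn by (simp add: field_simps power2_eq_square)
    also have "(dw s * dw s + - q s * w s * w s)
        - (2 * w s * dw s * (?c / ?s) + (- 1 - (?c / ?s)\<^sup>2) * (w s)\<^sup>2)
        = (dw s - w s * (?c / ?s))\<^sup>2 + (1 - q s) * (w s)\<^sup>2"
      by (simp add: power2_diff power_mult_distrib algebra_simps) (simp add: power2_eq_square)
    finally show ?thesis by (intro exI conjI) auto
  qed
  have mono: "F x \<le> F y" if "a \<le> x" "x \<le> y" "y \<le> b" for x y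
  proof (rule DERIV_nonneg_imp_increasing_open[OF that(2)])
    fix s assume "x < s" "s < y"
    then show "\<exists>y. (F has_real_derivative y) (at s) \<and> 0 \<le> y"
      using D[of s] q_lt_1[of s] that a by (smt (verit) mult_nonneg_nonneg zero_le_power2)
  qed (use that in \<open>auto intro: continuous_on_subset[OF cF]\<close>)
  have "F a = 0" "F b = 0" using a b by (auto simp: F_def)
  then have F0: "F s = 0" if "a \<le> s" "s \<le> b" for s
    using mono[of a s] mono[of s b] that by auto
  have w0: "w s = 0" if s: "a < s" "s < b" for s
  proof -
    obtain y where y: "(F has_real_derivative y) (at s)" "(1 - q s) * (w s)\<^sup>2 \<le> y" using D s by blast
    have "((\<lambda>_. 0) has_real_derivative y) (at s)"
      using s F0 by (intro has_field_derivative_transform_within_open[OF y(1), of "{a<..<b}"]) auto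
    then have "y = 0" using DERIV_const DERIV_unique by blast
    then have "(1 - q s) * (w s)\<^sup>2 \<le> 0" using y by simp
    then show ?thesis using q_lt_1[of s] s a by (simp add: mult_le_0_iff)
  qed
  obtain s0 m1 m2 where h: "s0 > 0" "q s0 > 0" "0 < m1"
    "\<And>s. 0 < s \<Longrightarrow> s \<le> s0 \<Longrightarrow> w s \<noteq> 0"
    "\<And>s. s0 \<le> s \<Longrightarrow> m1 \<le> (dw s)\<^sup>2 + q s * (w s)\<^sup>2"
    "\<And>s. s0 \<le> s \<Longrightarrow> (dw s)\<^sup>2 \<le> m2" using energy_bounds by blast
  have "s0 < b" using h(4)[of b] b a ab by force
  define c where "c = (max a s0 + b) / 2"
  have c: "a < c" "c < b" "s0 < c" using \<open>s0 < b\<close> ab by (auto simp: c_def max_def field_simps)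
  then have "((\<lambda>_. 0) has_real_derivative dw c) (at c)"
    using w0 a by (intro has_field_derivative_transform_within_open[OF w_deriv, of c "{a<..<b}"]) auto
  then have "dw c = 0" using DERIV_const DERIV_unique by blast
  with h(5)[of c] w0[of c] c h(3) show False by simp
qed

text \<open>Sturm comparison in the other direction: if \<open>w\<close> had no zero, Picone's identity for
  \<open>v = sin (\<omega> (s - a))\<close> would make \<open>v v' - v\<^sup>2 w'/w\<close> strictly increasing, although \<open>v\<close> vanishes at
  both ends.\<close>

lemma zero_in_interval:
  assumes a: "a > 0" and om: "\<omega> > 0" and q: "\<And>s. a \<le> s \<Longrightarrow> s \<le> a + pi / \<omega> \<Longrightarrow> q s > \<omega>\<^sup>2"
  obtains z where "a \<le> z" "z \<le> a + pi / \<omega>" "w z = 0"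
proof -
  let ?b = "a + pi / \<omega>"
  have ab: "a < ?b" using om by simp
  have "\<exists>z. a \<le> z \<and> z \<le> ?b \<and> w z = 0"
  proof (rule ccontr)
    assume n: "\<not> ?thesis"
    define F where "F = (\<lambda>s. sin (\<omega> * (s - a)) * (\<omega> * cos (\<omega> * (s - a))) - (sin (\<omega> * (s - a)))\<^sup>2 * (dw s / w s))"
    let ?F' = "\<lambda>s. (\<omega> * cos (\<omega> * (s - a)) - sin (\<omega> * (s - a)) * (dw s / w s))\<^sup>2 + (sin (\<omega> * (s - a)))\<^sup>2 * (q s - \<omega>\<^sup>2)"
    have D: "(F has_real_derivative ?F' s) (at s)" if s: "a \<le> s" "s \<le> ?b" for s
    proof -
      have s0: "s > 0" "w s \<noteq> 0" using s a n by auto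
      let ?s = "sin (\<omega> * (s - a))" and ?c = "cos (\<omega> * (s - a))"
      have S: "((\<lambda>s. sin (\<omega> * (s - a))) has_real_derivative \<omega> * ?c) (at s)"
        and C: "((\<lambda>s. \<omega> * cos (\<omega> * (s - a))) has_real_derivative - (\<omega>\<^sup>2 * ?s)) (at s)"
        by (auto intro!: derivative_eq_intros simp: power2_eq_square)
      have "(F has_real_derivative (\<omega> * ?c * (\<omega> * ?c) + - (\<omega>\<^sup>2 * ?s) * ?s)
          - (2 * ?s * (\<omega> * ?c) * (dw s / w s) + (- q s * w s * w s - dw s * dw s) / (w s * w s) * ?s\<^sup>2)) (at s)"
        unfolding F_def
        apply (intro DERIV_diff DERIV_mult DERIV_divide S C w_deriv dw_deriv s0)
        subgoal using DERIV_power[OF S, of 2] by (simp add: mult_ac)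
        done
      also have "(- q s * w s * w s - dw s * dw s) / (w s * w s) = - q s - (dw s / w s)\<^sup>2"
        using s0 by (simp add: field_simps power2_eq_square)
      also have "(\<omega> * ?c * (\<omega> * ?c) + - (\<omega>\<^sup>2 * ?s) * ?s)
          - (2 * ?s * (\<omega> * ?c) * (dw s / w s) + (- q s - (dw s / w s)\<^sup>2) * ?s\<^sup>2) = ?F' s"
        by (simp add: power2_diff power_mult_distrib algebra_simps) (simp add: power2_eq_square)
      finally show ?thesis .
    qed
    obtain z where z: "a < z" "z < ?b" "F ?b - F a = (?b - a) * ?F' z"
      using MVT2[OF ab D] by blast
    have "F a = 0" "F ?b = 0" using om by (auto simp: F_def)
    then have F': "?F' z = 0" using z ab om by simp
    have "\<omega> * (z - a) < pi" using z om by (simp add: field_simps)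
    then have "sin (\<omega> * (z - a)) > 0" using z om by (intro sin_gt_zero) auto
    then have "0 < (sin (\<omega> * (z - a)))\<^sup>2 * (q z - \<omega>\<^sup>2)" using q[of z] z by simp
    with F' show False by (smt (verit) zero_le_power2)
  qed
  then show ?thesis using that by blast
qed

lemma zero_eventually:
  assumes e: "e > 0"
  obtains S where "S > 0" "\<And>a. a \<ge> S \<Longrightarrow> \<exists>z. a \<le> z \<and> z \<le> a + pi + e \<and> w z = 0"
proof -
  define \<omega> where "\<omega> = pi / (pi + e)"
  have om: "0 < \<omega>" "\<omega> < 1" using e add_pos_pos[OF pi_gt_zero e] by (auto simp: \<omega>_def)
  then have om2: "\<omega>\<^sup>2 < 1" by (simp add: power_less_one_iff)
  define S where "S = sqrt (m / (1 - \<omega>\<^sup>2)) + 1"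
  have S: "S > 0" using m_pos om2 by (simp add: S_def add_nonneg_pos)
  have q: "q s > \<omega>\<^sup>2" if s: "s \<ge> S" for s
  proof -
    have "m / (1 - \<omega>\<^sup>2) = (sqrt (m / (1 - \<omega>\<^sup>2)))\<^sup>2" using m_pos om2 by simp
    also have "\<dots> < s\<^sup>2" using s m_pos om2 by (intro power_strict_mono) (auto simp: S_def)
    finally show ?thesis using om2 s S by (simp add: q_def field_simps)
  qed
  have pe: "pi / \<omega> = pi + e" using e by (simp add: \<omega>_def add_eq_0_iff)
  have "\<exists>z. a \<le> z \<and> z \<le> a + pi + e \<and> w z = 0" if a: "a \<ge> S" for a
  proof -
    have "a > 0" using a S by simp
    then show ?thesis using zero_in_interval[of a \<omega>] om q a pe by (metis add.assoc order_trans)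
  qed
  then show ?thesis using that S by blast
qed

text \<open>The gap of at least \<open>\<pi>\<close> and the existence of a zero in every interval of length slightly
  larger than \<open>\<pi>\<close> leave no choice but gaps close to \<open>\<pi>\<close>.\<close>

lemma zero_progression:
  assumes e: "e > 0"
  obtains z :: "nat \<Rightarrow> real" where "\<And>n. z n > 0" "\<And>n. w (z n) = 0" "strict_mono z"
    "\<And>n. real n * pi \<le> z n - z 0 \<and> z n - z 0 \<le> real n * (pi + e)"
proof -
  obtain S where S: "S > 0" "\<And>a. a \<ge> S \<Longrightarrow> \<exists>z. a \<le> z \<and> z \<le> a + pi + e / 2 \<and> w z = 0"
    using zero_eventually[of "e / 2"] e by auto
  have "\<exists>z. \<forall>n. (z n \<ge> S \<and> w (z n) = 0) \<and> (pi \<le> z (Suc n) - z n \<and> z (Suc n) - z n \<le> pi + e)"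
  proof (rule dependent_nat_choice)
    show "\<exists>x. x \<ge> S \<and> w x = 0" using S(2)[of S] by auto
    fix x :: real and n :: nat assume x: "x \<ge> S \<and> w x = 0"
    obtain y where y: "x + e / 2 \<le> y" "y \<le> x + e / 2 + pi + e / 2" "w y = 0"
      using S(2)[of "x + e / 2"] x e by auto
    have "pi \<le> y - x" using zero_gap[of x y] x y S(1) e by auto
    with x y e show "\<exists>y. (y \<ge> S \<and> w y = 0) \<and> pi \<le> y - x \<and> y - x \<le> pi + e"
      by (intro exI[of _ y]) auto
  qed
  then obtain z where z: "\<And>n. z n \<ge> S" "\<And>n. w (z n) = 0"
    "\<And>n. pi \<le> z (Suc n) - z n" "\<And>n. z (Suc n) - z n \<le> pi + e" by blast
  have "real n * pi \<le> z n - z 0 \<and> z n - z 0 \<le> real n * (pi + e)" for n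
  proof (induction n)
    case (Suc n)
    then show ?case using z(3)[of n] z(4)[of n] by (simp add: algebra_simps)
  qed simp
  moreover have "z n > 0" for n using z(1)[of n] S(1) by simp
  moreover have "strict_mono z"
    unfolding strict_mono_Suc_iff using z(3) pi_gt_zero by (metis diff_gt_0_iff_gt less_le_trans)
  ultimately show ?thesis using that z(2) by blast
qed

end

section \<open>The unit interval, its weighted measure, and the Sobolev space\<close>

lemma space_interval_measure01 [simp]: "space interval_measure01 = {0<..<1}"
  by (simp add: interval_measure01_def space_restrict_space)

lemma sets_weighted_measure [measurable_cong, simp]: "sets (weighted_measure \<alpha>) = sets interval_measure01"
  by (simp add: weighted_measure_def)

lemma space_weighted_measure [simp]: "space (weighted_measure \<alpha>) = {0<..<1}"
  by (simp add: weighted_measure_def)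

lemma borel_measurable_weighted [simp]:
  "borel_measurable (weighted_measure \<alpha>) = borel_measurable interval_measure01"
  by (rule measurable_cong_sets) simp_all

lemma measurable_interval_measure01:
  "f \<in> borel_measurable borel \<Longrightarrow> f \<in> borel_measurable interval_measure01"
  unfolding interval_measure01_def by (intro measurable_restrict_space1) simp

lemma measurable_restrict_lborel_Ioo:
  fixes f :: "real \<Rightarrow> real"
  assumes "continuous_on {a<..<b} f"
  shows "f \<in> borel_measurable (restrict_space lborel {a<..<b})"
proof -
  have "f \<in> borel_measurable (restrict_space borel {a<..<b})"
    by (rule borel_measurable_continuous_on_restrict[OF assms])
  moreover have "sets (restrict_space borel {a<..<b}) = sets (restrict_space lborel {a<..<b})"
    by (simp add: sets_restrict_space)
  ultimately show ?thesis using measurable_cong_sets by blast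
qed

lemma measurable_continuous_interval_measure01:
  fixes f :: "real \<Rightarrow> real"
  assumes "continuous_on {0..1} f"
  shows "f \<in> borel_measurable interval_measure01"
  unfolding interval_measure01_def
  by (rule measurable_restrict_lborel_Ioo[OF continuous_on_subset[OF assms]]) auto

lemma finite_measure_restrict_lborel_Ioo: "finite_measure (restrict_space lborel {a<..<b::real})"
  by (rule finite_measureI, cases "a \<le> b")
    (auto simp: space_restrict_space emeasure_restrict_space)

lemma finite_measure_interval_measure01: "finite_measure interval_measure01"
  unfolding interval_measure01_def by (rule finite_measure_restrict_lborel_Ioo)

lemma integral_restrict_lborel_Ioo:
  fixes f :: "real \<Rightarrow> real"
  shows "(\<integral>x. f x \<partial>restrict_space lborel {a<..<b}) = (LINT x:{a<..<b}|lborel. f x)"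
  by (subst integral_restrict_space) (auto simp: set_lebesgue_integral_def)

lemma integrable_restrict_lborel_Ioo:
  fixes f :: "real \<Rightarrow> real"
  shows "integrable (restrict_space lborel {a<..<b}) f \<longleftrightarrow> set_integrable lborel {a<..<b} f"
  by (subst integrable_restrict_space) (auto simp: set_integrable_def)

lemma AE_restrict_lborel_Ioo:
  "(AE x in restrict_space lborel {a<..<b::real}. P x) \<longleftrightarrow> (AE x in lborel. a < x \<and> x < b \<longrightarrow> P x)"
  by (subst AE_restrict_space_iff) auto

lemma AE_weighted_measure: "(AE x in weighted_measure \<alpha>. P x) \<longleftrightarrow> (AE x in interval_measure01. P x)"
proof -
  have "(AE x in weighted_measure \<alpha>. P x)
      \<longleftrightarrow> (AE x in interval_measure01. 0 < ennreal (x powr - \<alpha>) \<longrightarrow> P x)"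
    unfolding weighted_measure_def by (intro AE_density measurable_compose[OF _ measurable_ennreal] measurable_interval_measure01) measurable
  also have "\<dots> \<longleftrightarrow> (AE x in interval_measure01. P x)"
    by (rule AE_cong) auto
  finally show ?thesis .
qed

lemma powr_measurable_interval_measure01 [measurable]:
  "(\<lambda>x::real. x powr a) \<in> borel_measurable interval_measure01"
  by (intro measurable_interval_measure01) measurable

lemma integrable_weighted_measure:
  assumes "f \<in> borel_measurable interval_measure01"
  shows "integrable (weighted_measure \<alpha>) f \<longleftrightarrow> integrable interval_measure01 (\<lambda>x. x powr - \<alpha> * f x)"
  unfolding weighted_measure_def using assms by (subst integrable_density) auto

lemma integral_weighted_measure:
  assumes "f \<in> borel_measurable interval_measure01"
  shows "(\<integral>x. f x \<partial>weighted_measure \<alpha>) = (\<integral>x. x powr - \<alpha> * f x \<partial>interval_measure01)"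
  unfolding weighted_measure_def using assms by (subst integral_density) auto

text \<open>A function of size \<open>\<surd>x\<close> near 0 lies in the weighted space because \<open>x\<^sup>1\<^sup>-\<^sup>\<alpha>\<close> is integrable for
  \<open>\<alpha> < 2\<close>. Both \<open>H\<^sup>1\<^sub>0\<close> functions and modes have this size.\<close>

lemma square_integrable_weighted_bound:
  assumes al: "\<alpha> < 2" and f: "f \<in> borel_measurable interval_measure01"
    and le: "\<And>x. 0 < x \<Longrightarrow> x < 1 \<Longrightarrow> (f x)\<^sup>2 \<le> C * x"
  shows "square_integrable (weighted_measure \<alpha>) f"
proof -
  have "integrable interval_measure01 (\<lambda>x. x powr - \<alpha> * (f x)\<^sup>2)"
  proof (rule Bochner_Integration.integrable_bound)
    show "integrable interval_measure01 (\<lambda>x. C * x powr (1 - \<alpha>))"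
      unfolding interval_measure01_def integrable_restrict_lborel_Ioo
      using set_integrable_powr_Ioo[of "1 - \<alpha>"] al by simp
    show "AE x in interval_measure01. norm (x powr - \<alpha> * (f x)\<^sup>2) \<le> norm (C * x powr (1 - \<alpha>))"
    proof (rule AE_I2)
      fix x :: real assume "x \<in> space interval_measure01"
      then have x: "0 < x" "x < 1" by auto
      have "x powr - \<alpha> * (f x)\<^sup>2 \<le> x powr - \<alpha> * (C * x)"
        using le[OF x] by (intro mult_left_mono) auto
      also have "\<dots> = C * x powr (1 - \<alpha>)"
        using powr_mult_base[of x "-\<alpha>"] x by (simp add: mult_ac)
      finally show "norm (x powr - \<alpha> * (f x)\<^sup>2) \<le> norm (C * x powr (1 - \<alpha>))" by simp
    qed
  qed (use f in measurable)
  then show ?thesis using f by (simp add: square_integrable_def integrable_weighted_measure)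
qed

lemma square_integrable_continuous_interval:
  fixes f :: "real \<Rightarrow> real"
  assumes "continuous_on {a..b} f"
  shows "square_integrable (restrict_space lborel {a<..<b}) f"
proof -
  have "set_integrable lborel {a<..<b} (\<lambda>x. (f x)\<^sup>2)"
    by (intro set_integrable_continuous_Ioo continuous_intros assms)
  moreover have "f \<in> borel_measurable (restrict_space lborel {a<..<b})"
    by (rule measurable_restrict_lborel_Ioo[OF continuous_on_subset[OF assms]]) auto
  ultimately show ?thesis
    by (simp add: square_integrable_def integrable_restrict_lborel_Ioo)
qed

lemma square_integrable_interval_measure01_integrable:
  assumes "square_integrable interval_measure01 f"
  shows "integrable interval_measure01 f"
proof -
  interpret finite_measure interval_measure01 by (rule finite_measure_interval_measure01)
  have "square_integrable interval_measure01 (\<lambda>x. 1)" by (simp add: square_integrable_def)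
  from square_integrable_mult_integrable[OF assms this] show ?thesis by simp
qed

lemma H10_deriv_integrable: "H10_deriv v dv \<Longrightarrow> integrable interval_measure01 dv"
  by (simp add: H10_deriv_def square_integrable_interval_measure01_integrable)

lemma integral_Ioo_sub_I01:
  fixes f :: "real \<Rightarrow> real"
  assumes "0 \<le> x" "x \<le> 1"
  shows "(LINT y:{0<..<x}|lborel. f y) = (\<integral>y. f y * indicator {..<x} y \<partial>interval_measure01)"
  unfolding interval_measure01_def integral_restrict_lborel_Ioo set_lebesgue_integral_def
  using assms by (intro Bochner_Integration.integral_cong) (auto simp: indicator_def)

lemma H10_deriv_eq:
  assumes "H10_deriv v dv" "0 \<le> x" "x \<le> 1"
  shows "v x = (\<integral>y. dv y * indicator {..<x} y \<partial>interval_measure01)"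
  using assms by (simp add: H10_deriv_def integral_Ioo_sub_I01)

lemma indicator_measurable_I01 [measurable]:
  "(indicator {..<x} :: real \<Rightarrow> real) \<in> borel_measurable interval_measure01"
  "(indicator {x..<y} :: real \<Rightarrow> real) \<in> borel_measurable interval_measure01"
  by (intro measurable_interval_measure01; measurable)+

lemma integrable_times_indicator_I01:
  fixes f :: "real \<Rightarrow> real"
  assumes "integrable interval_measure01 f"
  shows "integrable interval_measure01 (\<lambda>z. f z * indicator {..<t} z)"
proof (rule Bochner_Integration.integrable_bound[OF assms])
  show "(\<lambda>z. f z * indicator {..<t} z) \<in> borel_measurable interval_measure01"
    using assms by (intro borel_measurable_times indicator_measurable_I01) auto
qed (auto simp: indicator_def)

lemma H10_Holder:
  assumes v: "H10_deriv v dv" and xy: "0 \<le> y" "y \<le> x" "x \<le> 1"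
  shows "(v x - v y)\<^sup>2 \<le> (x - y) * l2_normsq interval_measure01 dv"
proof -
  interpret finite_measure interval_measure01 by (rule finite_measure_interval_measure01)
  let ?i = "indicator {y..<x} :: real \<Rightarrow> real"
  have dv: "square_integrable interval_measure01 dv" using v by (simp add: H10_deriv_def)
  have int: "integrable interval_measure01 (\<lambda>z. dv z * indicator {..<t} z)" for t
    by (rule integrable_times_indicator_I01[OF H10_deriv_integrable[OF v]])
  have i: "square_integrable interval_measure01 ?i"
    unfolding square_integrable_def
    by (intro conjI integrable_const_bound[of _ 1] indicator_measurable_I01 borel_measurable_power AE_I2)
      (auto simp: indicator_def)
  have "v x - v y = (\<integral>z. dv z * indicator {..<x} z - dv z * indicator {..<y} z \<partial>interval_measure01)"
    using xy by (simp add: H10_deriv_eq[OF v] int)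
  also have "\<dots> = l2_inner interval_measure01 dv ?i"
    unfolding l2_inner_def using xy
    by (intro Bochner_Integration.integral_cong) (auto simp: indicator_def)
  finally have CS: "(v x - v y)\<^sup>2 \<le> l2_normsq interval_measure01 dv * l2_normsq interval_measure01 ?i"
    using l2_Cauchy_Schwarz[OF dv i] by simp
  have "l2_normsq interval_measure01 ?i = (LINT z:{0<..<1}|lborel. indicator {y..<x} z)"
    unfolding l2_normsq_def interval_measure01_def integral_restrict_lborel_Ioo
    by (intro set_lebesgue_integral_cong) (auto simp: indicator_def)
  also have "\<dots> = measure lborel ({0<..<1} \<inter> {y..<x})"
    by (simp add: set_lebesgue_integral_def indicator_inter_arith[symmetric])
  also have "\<dots> \<le> measure lborel {y..<x}"
    by (rule measure_mono_fmeasurable) (use xy in \<open>auto simp: fmeasurable_def\<close>)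
  also have "\<dots> = x - y" using xy by simp
  finally have "l2_normsq interval_measure01 ?i \<le> x - y" .
  then have "l2_normsq interval_measure01 dv * l2_normsq interval_measure01 ?i
      \<le> l2_normsq interval_measure01 dv * (x - y)"
    by (intro mult_left_mono) auto
  with CS show ?thesis by (simp add: mult.commute)
qed

lemma H10_zero: "H10_deriv v dv \<Longrightarrow> v 0 = 0"
  by (simp add: H10_deriv_def set_lebesgue_integral_def)

lemma H10_one: "H10_deriv v dv \<Longrightarrow> v 1 = 0"
  by (simp add: H10_deriv_def)

lemma H10_continuous:
  assumes v: "H10_deriv v dv" shows "continuous_on {0..1} v"
proof (rule continuous_onI)
  fix x e :: real assume x: "x \<in> {0..1}" and e: "e > 0"
  define N where "N = l2_normsq interval_measure01 dv + 1"
  have N: "N > 0" by (simp add: N_def add_nonneg_pos)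
  have "(v a - v b)\<^sup>2 \<le> \<bar>a - b\<bar> * N" if "a \<in> {0..1}" "b \<in> {0..1}" for a b
  proof -
    have "(v (max a b) - v (min a b))\<^sup>2 \<le> (max a b - min a b) * l2_normsq interval_measure01 dv"
      using that by (intro H10_Holder[OF v]) auto
    also have "\<dots> \<le> (max a b - min a b) * N" by (intro mult_left_mono) (auto simp: N_def)
    also have "(v (max a b) - v (min a b))\<^sup>2 = (v a - v b)\<^sup>2"
      by (cases "a \<le> b") (auto simp: max_def min_def power2_commute)
    also have "max a b - min a b = \<bar>a - b\<bar>" by auto
    finally show ?thesis .
  qed
  note H = this
  have "dist (v x') (v x) \<le> e" if x': "x' \<in> {0..1}" "dist x' x < e\<^sup>2 / N" for x'
  proof -
    have "(v x' - v x)\<^sup>2 \<le> \<bar>x' - x\<bar> * N" by (rule H[OF x'(1) x])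
    also have "\<dots> \<le> e\<^sup>2" using x'(2) N by (simp add: dist_real_def field_simps)
    finally show ?thesis using e by (simp add: dist_real_def abs_le_square_iff[symmetric])
  qed
  then show "\<exists>d>0. \<forall>x'\<in>{0..1}. dist x' x < d \<longrightarrow> dist (v x') (v x) \<le> e"
    using e N by (intro exI[of _ "e\<^sup>2 / N"]) auto
qed

lemma H10_pointwise_bound:
  assumes v: "H10_deriv v dv" and x: "0 \<le> x" "x \<le> 1"
  shows "(v x)\<^sup>2 \<le> x * l2_normsq interval_measure01 dv"
  using H10_Holder[OF v, of 0 x] x H10_zero[OF v] by simp

lemma H10_square_integrable_weighted:
  assumes "\<alpha> < 2" "H10_deriv v dv"
  shows "square_integrable (weighted_measure \<alpha>) v"
  by (rule square_integrable_weighted_bound[OF assms(1), of _ "l2_normsq interval_measure01 dv"])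
    (use H10_pointwise_bound[OF assms(2)] in
      \<open>auto simp: mult.commute intro: measurable_continuous_interval_measure01 H10_continuous[OF assms(2)]\<close>)

lemma H10_sum:
  assumes "\<And>k. k \<in> K \<Longrightarrow> H10_deriv (v k) (dv k)"
  shows "H10_deriv (\<lambda>x. \<Sum>k\<in>K. c k * v k x) (\<lambda>x. \<Sum>k\<in>K. c k * dv k x)"
  unfolding H10_deriv_def
proof (intro conjI ballI)
  show "square_integrable interval_measure01 (\<lambda>x. \<Sum>k\<in>K. c k * dv k x)"
    using assms by (intro square_integrable_sum square_integrable_scale) (auto simp: H10_deriv_def)
  show "(\<Sum>k\<in>K. c k * v k 1) = 0" using H10_one[OF assms] by (intro sum.neutral) simp
  fix x :: real assume x: "x \<in> {0..1}"
  have int: "integrable interval_measure01 (\<lambda>z. c k * dv k z * indicator {..<x} z)" if "k \<in> K" for k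
    by (intro integrable_times_indicator_I01 integrable_mult_right H10_deriv_integrable[OF assms[OF that]])
  have "(LINT y:{0<..<x}|lborel. \<Sum>k\<in>K. c k * dv k y)
      = (\<integral>y. (\<Sum>k\<in>K. c k * dv k y * indicator {..<x} y) \<partial>interval_measure01)"
    using x by (simp add: integral_Ioo_sub_I01 sum_distrib_right)
  also have "\<dots> = (\<Sum>k\<in>K. \<integral>y. c k * dv k y * indicator {..<x} y \<partial>interval_measure01)"
    by (rule Bochner_Integration.integral_sum[OF int])
  also have "\<dots> = (\<Sum>k\<in>K. c k * v k x)"
    using x by (intro sum.cong refl) (simp add: mult.assoc H10_deriv_eq[OF assms])
  finally show "(\<Sum>k\<in>K. c k * v k x) = (LINT y:{0<..<x}|lborel. \<Sum>k\<in>K. c k * dv k y)" ..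
qed

section \<open>Integration by parts against an absolutely continuous function\<close>

text \<open>Fubini's theorem on the triangle \<open>x < y\<close>. It serves as the product rule for an
  absolutely continuous factor.\<close>

lemma integral_triangle_swap:
  fixes f g :: "real \<Rightarrow> real"
  assumes f: "integrable interval_measure01 f" and g: "integrable interval_measure01 g"
  shows "(\<integral>y. g y * (\<integral>x. f x * indicator {..<y} x \<partial>interval_measure01) \<partial>interval_measure01)
    = (\<integral>x. f x * ((\<integral>y. g y \<partial>interval_measure01) - (\<integral>y. g y * indicator {..<x} y \<partial>interval_measure01)) \<partial>interval_measure01)"
proof -
  let ?M = interval_measure01
  interpret finite_measure ?M by (rule finite_measure_interval_measure01)
  interpret P: pair_sigma_finite ?M ?M ..
  have fm[measurable]: "f \<in> borel_measurable ?M" "g \<in> borel_measurable ?M"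
    using f g by auto
  have id: "(\<lambda>x. x) \<in> borel_measurable ?M" by (intro measurable_interval_measure01) measurable
  have [measurable]: "fst \<in> borel_measurable (?M \<Otimes>\<^sub>M ?M)" "snd \<in> borel_measurable (?M \<Otimes>\<^sub>M ?M)"
    using measurable_compose[OF measurable_fst id] measurable_compose[OF measurable_snd id] by auto
  define h where "h = (\<lambda>(x, y). f x * g y * (if x < y then 1 else (0::real)))"
  have hm[measurable]: "h \<in> borel_measurable (?M \<Otimes>\<^sub>M ?M)"
    unfolding h_def case_prod_beta by measurable
  have h: "integrable (?M \<Otimes>\<^sub>M ?M) h"
  proof (rule Bochner_Integration.integrable_bound)
    show "integrable (?M \<Otimes>\<^sub>M ?M) (\<lambda>(x, y). f x * g y)"
    proof (rule P.Fubini_integrable)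
      show "integrable ?M (\<lambda>x. \<integral>y. norm (case (x, y) of (x, y) \<Rightarrow> f x * g y) \<partial>?M)"
        using f by (simp add: abs_mult)
      show "AE x in ?M. integrable ?M (\<lambda>y. case (x, y) of (x, y) \<Rightarrow> f x * g y)"
        using g by simp
    qed measurable
  qed (auto simp: h_def)
  have "(\<integral>y. (\<integral>x. h (x, y) \<partial>?M) \<partial>?M) = (\<integral>x. (\<integral>y. h (x, y) \<partial>?M) \<partial>?M)"
    using P.Fubini_integral[of "\<lambda>x y. h (x, y)"] h by simp
  moreover have "(\<integral>x. h (x, y) \<partial>?M) = g y * (\<integral>x. f x * indicator {..<y} x \<partial>?M)" for y
    unfolding integral_mult_right_zero[symmetric]
    by (intro Bochner_Integration.integral_cong) (auto simp: h_def indicator_def)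
  moreover have "(\<integral>y. h (x, y) \<partial>?M) = f x * ((\<integral>y. g y \<partial>?M) - (\<integral>y. g y * indicator {..<x} y \<partial>?M))" for x
  proof -
    have i: "integrable ?M (\<lambda>y. g y * indicator {..<x} y)"
      by (rule integrable_times_indicator_I01[OF g])
    have ne: "AE y in ?M. y \<noteq> x"
      unfolding interval_measure01_def AE_restrict_lborel_Ioo using AE_lborel_singleton[of x] by auto
    have "(\<integral>y. h (x, y) \<partial>?M) = (\<integral>y. f x * (g y - g y * indicator {..<x} y) \<partial>?M)"
    proof (rule integral_cong_AE)
      show "AE y in ?M. h (x, y) = f x * (g y - g y * indicator {..<x} y)"
        using ne by eventually_elim (auto simp: h_def indicator_def)
      show "(\<lambda>y. h (x, y)) \<in> borel_measurable ?M"
        unfolding h_def case_prod_conv using id by measurable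
    qed measurable
    then show ?thesis using g i by simp
  qed
  ultimately show ?thesis by simp
qed

context bessel_order
begin

lemma mode_continuous01: "continuous_on {0..1} (mode \<beta> l)"
  and dmode_continuous01: "continuous_on {0..1} (dmode \<beta> l)"
  by (rule continuous_on_subset[OF continuous_on_mode(1)[OF b0]]
      continuous_on_subset[OF continuous_on_mode(2)[OF b0]]; simp)+

lemma mode_weight_integrable:
  assumes l: "l \<ge> 0"
  shows "integrable interval_measure01 (\<lambda>x. x powr (\<beta> - 2) * mode \<beta> l x)"
proof (rule Bochner_Integration.integrable_bound)
  show "integrable interval_measure01 (\<lambda>x. x powr (\<beta> - 1))"
    unfolding interval_measure01_def integrable_restrict_lborel_Ioo
    using set_integrable_powr_Ioo[of "\<beta> - 1"] b0 by simp
  show "AE x in interval_measure01. norm (x powr (\<beta> - 2) * mode \<beta> l x) \<le> norm (x powr (\<beta> - 1))"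
  proof (rule AE_I2)
    fix x :: real assume "x \<in> space interval_measure01"
    then have x: "0 < x" by simp
    have "x powr (\<beta> - 2) * \<bar>mode \<beta> l x\<bar> \<le> x powr (\<beta> - 2) * x"
      using mode_bound[OF b0 b2 l, of x] x by (intro mult_left_mono) auto
    also have "\<dots> = x powr (\<beta> - 1)" using powr_mult_base[of x "\<beta> - 2"] x by (simp add: mult.commute)
    finally show "norm (x powr (\<beta> - 2) * mode \<beta> l x) \<le> norm (x powr (\<beta> - 1))"
      by (simp add: abs_mult)
  qed
qed (use measurable_continuous_interval_measure01[OF mode_continuous01[of l]] in measurable)

lemma dmode_eq_integral:
  assumes l: "l \<ge> 0" and y: "0 \<le> y" "y \<le> 1"
  shows "dmode \<beta> l y = 1 - (\<integral>x. l * (x powr (\<beta> - 2) * mode \<beta> l x) * indicator {..<y} x \<partial>interval_measure01)"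
proof -
  have "set_integrable lborel {0<..<1} (\<lambda>x. - l * x powr (\<beta> - 2) * mode \<beta> l x)"
    using integrable_mult_right[OF mode_weight_integrable[OF l], of "-l"]
    unfolding interval_measure01_def integrable_restrict_lborel_Ioo by (simp add: mult.assoc)
  then have int: "set_integrable lborel {0<..<y} (\<lambda>x. - l * x powr (\<beta> - 2) * mode \<beta> l x)"
    by (rule set_integrable_subset) (use y in auto)
  have "(LINT x:{0<..<y}|lborel. - l * x powr (\<beta> - 2) * mode \<beta> l x) = dmode \<beta> l y - dmode \<beta> l 0"
    by (rule set_integral_FTC[OF y(1) _ _ int])
      (use y in \<open>auto intro!: dmode_deriv[OF b0, simplified] continuous_on_subset[OF dmode_continuous01]\<close>)
  moreover have "(LINT x:{0<..<y}|lborel. - l * x powr (\<beta> - 2) * mode \<beta> l x)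
      = - (\<integral>x. l * (x powr (\<beta> - 2) * mode \<beta> l x) * indicator {..<y} x \<partial>interval_measure01)"
    unfolding integral_Ioo_sub_I01[OF y] by (simp add: mult.assoc)
  ultimately show ?thesis by simp
qed

text \<open>The weak form of the eigenvalue equation. The boundary terms \<open>y' v\<close> vanish at both ends
  because \<open>v\<close> does.\<close>

lemma mode_integration_by_parts:
  assumes l: "l \<ge> 0" and v: "H10_deriv v dv"
  shows "l2_inner interval_measure01 (dmode \<beta> l) dv = l * l2_inner (weighted_measure (2 - \<beta>)) (mode \<beta> l) v"
proof -
  let ?M = interval_measure01
  define k where "k = (\<lambda>x. l * (x powr (\<beta> - 2) * mode \<beta> l x))"
  have k: "integrable ?M k" unfolding k_def by (intro integrable_mult_right mode_weight_integrable l)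
  have dv: "integrable ?M dv" by (rule H10_deriv_integrable[OF v])
  have dvs: "square_integrable ?M dv" using v by (simp add: H10_deriv_def)
  have dms: "square_integrable ?M (dmode \<beta> l)"
    unfolding interval_measure01_def by (rule square_integrable_continuous_interval[OF dmode_continuous01])
  have tot: "(\<integral>y. dv y \<partial>?M) = 0"
  proof -
    have "v 1 = (\<integral>y. dv y * indicator {..<1} y \<partial>?M)" by (rule H10_deriv_eq[OF v]) auto
    also have "\<dots> = (\<integral>y. dv y \<partial>?M)" by (intro Bochner_Integration.integral_cong) auto
    finally show ?thesis using v by (simp add: H10_deriv_def)
  qed
  have "(\<integral>y. dv y * (\<integral>x. k x * indicator {..<y} x \<partial>?M) \<partial>?M)
      = (\<integral>x. k x * ((\<integral>y. dv y \<partial>?M) - (\<integral>y. dv y * indicator {..<x} y \<partial>?M)) \<partial>?M)"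
    by (rule integral_triangle_swap[OF k dv])
  also have "\<dots> = (\<integral>x. - (k x * v x) \<partial>?M)"
    by (intro Bochner_Integration.integral_cong refl) (simp add: tot H10_deriv_eq[OF v])
  finally have 1: "(\<integral>y. dv y * (\<integral>x. k x * indicator {..<y} x \<partial>?M) \<partial>?M) = - (\<integral>x. k x * v x \<partial>?M)"
    by simp
  have eq: "dv y * (\<integral>x. k x * indicator {..<y} x \<partial>?M) = dv y - dmode \<beta> l y * dv y"
    if "y \<in> space ?M" for y
  proof -
    have "(\<integral>x. k x * indicator {..<y} x \<partial>?M) = 1 - dmode \<beta> l y"
      using dmode_eq_integral[OF l, of y] that unfolding k_def by simp
    then show ?thesis by (simp only: right_diff_distrib) simp
  qed
  have "(\<integral>y. dv y * (\<integral>x. k x * indicator {..<y} x \<partial>?M) \<partial>?M) = (\<integral>y. dv y - dmode \<beta> l y * dv y \<partial>?M)"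
    by (rule Bochner_Integration.integral_cong[OF refl eq])
  also have "\<dots> = - l2_inner ?M (dmode \<beta> l) dv"
    using dv square_integrable_mult_integrable[OF dms dvs] by (simp add: tot l2_inner_def)
  finally have "l2_inner ?M (dmode \<beta> l) dv = (\<integral>x. k x * v x \<partial>?M)" using 1 by simp
  also have "\<dots> = l * (\<integral>x. x powr - (2 - \<beta>) * (mode \<beta> l x * v x) \<partial>?M)"
    by (simp add: k_def mult.assoc)
  also have "(\<integral>x. x powr - (2 - \<beta>) * (mode \<beta> l x * v x) \<partial>?M) = l2_inner (weighted_measure (2 - \<beta>)) (mode \<beta> l) v"
    unfolding l2_inner_def
    using measurable_continuous_interval_measure01[OF mode_continuous01[of l]]
      measurable_continuous_interval_measure01[OF H10_continuous[OF v]]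
    by (subst integral_weighted_measure) auto
  finally show ?thesis .
qed

lemma mode_H10:
  assumes "bessel_G \<beta> l = 0"
  shows "H10_deriv (mode \<beta> l) (dmode \<beta> l)"
  unfolding H10_deriv_def
proof (intro conjI ballI)
  show "square_integrable interval_measure01 (dmode \<beta> l)"
    unfolding interval_measure01_def by (rule square_integrable_continuous_interval[OF dmode_continuous01])
  show "mode \<beta> l 1 = 0" using assms by (simp add: mode_def)
  fix x :: real assume x: "x \<in> {0..1}"
  have "(LINT y:{0<..<x}|lborel. dmode \<beta> l y) = mode \<beta> l x - mode \<beta> l 0"
    using x by (intro set_integral_FTC set_integrable_continuous_Ioo mode_deriv b0)
      (auto intro: continuous_on_subset[OF mode_continuous01] continuous_on_subset[OF dmode_continuous01])
  then show "mode \<beta> l x = (LINT y:{0<..<x}|lborel. dmode \<beta> l y)" by simp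
qed

end

section \<open>The eigenfunctions\<close>

text \<open>Gronwall's argument: \<open>E = D\<^sup>2 + D'\<^sup>2\<close> satisfies \<open>\<bar>E'\<bar> \<le> (1 + M) E\<close>, so \<open>E\<close> times a suitable exponential is
  monotone on either side of the point where \<open>E\<close> vanishes.\<close>

lemma second_order_ode_unique:
  fixes D D' h :: "real \<Rightarrow> real"
  assumes D: "\<And>x. a < x \<Longrightarrow> x < b \<Longrightarrow> (D has_real_derivative D' x) (at x)"
    and D': "\<And>x. a < x \<Longrightarrow> x < b \<Longrightarrow> (D' has_real_derivative h x * D x) (at x)"
    and bd: "\<And>x. a < x \<Longrightarrow> x < b \<Longrightarrow> \<bar>h x\<bar> \<le> M"
    and x0: "a < x0" "x0 < b" "D x0 = 0" "D' x0 = 0"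
    and x: "a < x" "x < b"
  shows "D x = 0"
proof -
  define E where "E = (\<lambda>x. (D x)\<^sup>2 + (D' x)\<^sup>2)"
  define K where "K = 1 + M"
  have E': "(E has_real_derivative 2 * D z * D' z * (1 + h z)) (at z)"
    and bound: "\<bar>2 * D z * D' z * (1 + h z)\<bar> \<le> K * E z" if z: "a < z" "z < b" for z
  proof -
    have "(E has_real_derivative 2 * D z * D' z + 2 * D' z * (h z * D z)) (at z)"
      unfolding E_def
      apply (intro DERIV_add)
      subgoal using DERIV_power[OF D[OF z], of 2] by (simp add: mult_ac)
      subgoal using DERIV_power[OF D'[OF z], of 2] by (simp add: mult_ac)
      done
    then show "(E has_real_derivative 2 * D z * D' z * (1 + h z)) (at z)" by (simp add: algebra_simps)
    have "\<bar>2 * D z * D' z\<bar> \<le> E z"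
      using sum_squares_bound[of "\<bar>D z\<bar>" "\<bar>D' z\<bar>"] by (simp add: E_def abs_mult)
    moreover have "\<bar>1 + h z\<bar> \<le> K" using bd[OF z] by (simp add: K_def)
    ultimately have "\<bar>2 * D z * D' z\<bar> * \<bar>1 + h z\<bar> \<le> E z * K"
      by (intro mult_mono) auto
    then show "\<bar>2 * D z * D' z * (1 + h z)\<bar> \<le> K * E z" by (simp add: abs_mult mult.commute)
  qed
  have Ex0: "E x0 = 0" using x0 by (simp add: E_def)
  have "E x \<le> 0"
  proof (cases "x0 \<le> x")
    case True
    have "exp (- K * x) * E x \<le> exp (- K * x0) * E x0"
    proof (rule DERIV_nonpos_imp_nonincreasing[OF True, where f = "\<lambda>z. exp (- K * z) * E z"])
      fix z assume "x0 \<le> z" "z \<le> x"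
      then have z: "a < z" "z < b" using x x0 by auto
      have "((\<lambda>z. exp (- K * z) * E z) has_real_derivative
          (exp (- K * z) * (- K)) * E z + 2 * D z * D' z * (1 + h z) * exp (- K * z)) (at z)"
        by (intro DERIV_mult E' z) (auto intro!: derivative_eq_intros)
      also have "(exp (- K * z) * (- K)) * E z + 2 * D z * D' z * (1 + h z) * exp (- K * z)
          = - (exp (- K * z) * (K * E z - 2 * D z * D' z * (1 + h z)))"
        by (simp add: algebra_simps)
      finally show "\<exists>y. ((\<lambda>z. exp (- K * z) * E z) has_real_derivative y) (at z) \<and> y \<le> 0"
        using bound[OF z] by (intro exI conjI) (auto intro!: mult_nonneg_nonneg)
    qed
    then show ?thesis by (simp add: Ex0 mult_le_0_iff not_le[symmetric])
  next
    case False
    then have le: "x \<le> x0" by simp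
    have "exp (K * x) * E x \<le> exp (K * x0) * E x0"
    proof (rule DERIV_nonneg_imp_nondecreasing[OF le, where f = "\<lambda>z. exp (K * z) * E z"])
      fix z assume "x \<le> z" "z \<le> x0"
      then have z: "a < z" "z < b" using x x0 by auto
      have "((\<lambda>z. exp (K * z) * E z) has_real_derivative
          (exp (K * z) * K) * E z + 2 * D z * D' z * (1 + h z) * exp (K * z)) (at z)"
        by (intro DERIV_mult E' z) (auto intro!: derivative_eq_intros)
      also have "(exp (K * z) * K) * E z + 2 * D z * D' z * (1 + h z) * exp (K * z)
          = exp (K * z) * (K * E z + 2 * D z * D' z * (1 + h z))"
        by (simp add: algebra_simps)
      finally show "\<exists>y. ((\<lambda>z. exp (K * z) * E z) has_real_derivative y) (at z) \<and> 0 \<le> y"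
        using bound[OF z] by (intro exI conjI) (auto intro!: mult_nonneg_nonneg)
    qed
    then show ?thesis by (simp add: Ex0 mult_le_0_iff not_le[symmetric])
  qed
  then show ?thesis by (simp add: E_def) (metis add_nonneg_eq_0_iff order_antisym sum_power2_ge_zero zero_le_power2 power_eq_0_iff)
qed

lemma continuous_on_eq_right_end:
  fixes f g :: "real \<Rightarrow> real"
  assumes "a < b" "continuous_on {a..b} f" "continuous_on {a..b} g"
    and eq: "\<And>x. a < x \<Longrightarrow> x < b \<Longrightarrow> f x = g x"
  shows "f b = g b"
proof -
  have "(f \<longlongrightarrow> f b) (at_left b)" "(g \<longlongrightarrow> g b) (at_left b)"
    using assms(1-3) continuous_on_Icc_at_leftD by blast+
  moreover have "eventually (\<lambda>x. f x = g x) (at_left b)"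
    using eventually_at_left_real[OF assms(1)] by eventually_elim (auto intro: eq)
  ultimately show ?thesis
    by (metis tendsto_cong tendsto_unique trivial_limit_at_left_real)
qed

context bessel_order
begin

lemma mode_nonzero:
  obtains x0 where "0 < x0" "x0 < 1" "mode \<beta> l x0 \<noteq> 0"
proof -
  have "((\<lambda>x. bessel_G \<beta> (l * x powr \<beta>)) \<longlongrightarrow> 1) (at_right 0)"
  proof -
    have "((\<lambda>x. bessel_G \<beta> (l * x powr \<beta>)) \<longlongrightarrow> bessel_G \<beta> (l * 0 powr \<beta>)) (at 0 within {0..})"
      by (rule bspec[OF continuous_on_bessel_arg(1)[OF b0, of l, unfolded continuous_on]]) simp
    then have "((\<lambda>x. bessel_G \<beta> (l * x powr \<beta>)) \<longlongrightarrow> bessel_G \<beta> (l * 0 powr \<beta>)) (at_right 0)"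
      by (rule tendsto_within_subset) auto
    then show ?thesis by simp
  qed
  then have "eventually (\<lambda>x. bessel_G \<beta> (l * x powr \<beta>) > 0) (at_right 0)"
    by (rule order_tendstoD) simp
  moreover have "eventually (\<lambda>x. x \<in> {0<..<1}) (at_right (0::real))"
    by (rule eventually_at_right_real) simp
  ultimately have "eventually (\<lambda>x. 0 < x \<and> x < 1 \<and> mode \<beta> l x \<noteq> 0) (at_right 0)"
    by eventually_elim (auto simp: mode_def)
  then show ?thesis using that eventually_happens trivial_limit_at_right_real by blast
qed

text \<open>The Wronskian with the mode is constant. If it were not 0, the derivative of the other solution
  would behave like \<open>1/x\<close>, so this solution would grow logarithmically instead of tending to 0.\<close>

lemma eigenfunction_eq_mode:
  assumes l: "l > 0" and c: "continuous_on {0..1} \<phi>" and \<phi>0: "\<phi> 0 = 0"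
    and d: "\<And>x. 0 < x \<Longrightarrow> x < 1 \<Longrightarrow> (\<phi> has_real_derivative d x) (at x)"
    and d2: "\<And>x. 0 < x \<Longrightarrow> x < 1 \<Longrightarrow> (d has_real_derivative d2 x) (at x)"
    and eq: "\<And>x. 0 < x \<Longrightarrow> x < 1 \<Longrightarrow> - (x powr (2 - \<beta>)) * d2 x = l * \<phi> x"
  obtains a where "\<And>x. 0 \<le> x \<Longrightarrow> x \<le> 1 \<Longrightarrow> \<phi> x = a * mode \<beta> l x"
proof -
  let ?y = "mode \<beta> l" and ?y' = "dmode \<beta> l"
  have d2': "(d has_real_derivative - l * x powr (\<beta> - 2) * \<phi> x) (at x)" if x: "0 < x" "x < 1" for x
  proof -
    have "x powr (\<beta> - 2) * x powr (2 - \<beta>) = 1" using x by (simp add: powr_add[symmetric])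
    then have "d2 x = - (x powr (\<beta> - 2) * (- (x powr (2 - \<beta>)) * d2 x))" by (simp add: mult.assoc[symmetric])
    then have "d2 x = - l * x powr (\<beta> - 2) * \<phi> x" unfolding eq[OF x] by simp
    then show ?thesis using d2[OF x] by simp
  qed
  define Wr where "Wr = (\<lambda>x. \<phi> x * ?y' x - d x * ?y x)"
  have W': "(Wr has_real_derivative 0) (at x)" if x: "0 < x" "x < 1" for x
  proof -
    have "(Wr has_real_derivative (d x * ?y' x + (- l * x powr (\<beta> - 2) * ?y x) * \<phi> x)
        - ((- l * x powr (\<beta> - 2) * \<phi> x) * ?y x + ?y' x * d x)) (at x)"
      unfolding Wr_def by (intro DERIV_diff DERIV_mult d d2' mode_deriv dmode_deriv b0 x)
    then show ?thesis by (simp add: algebra_simps)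
  qed
  have Wc: "Wr x = Wr (1/2)" if x: "0 < x" "x < 1" for x
    by (rule DERIV_isconst3[of 0 1]) (use x W' in auto)
  define W where "W = Wr (1/2)"
  have "W = 0"
  proof (rule ccontr)
    assume "W \<noteq> 0"
    then have Wp: "\<bar>W\<bar> / 16 > 0" by simp
    obtain \<delta> where \<delta>: "\<delta> > 0" "\<And>x. x \<in> {0..1} \<Longrightarrow> dist x 0 < \<delta> \<Longrightarrow> dist (\<phi> x) (\<phi> 0) < \<bar>W\<bar> / 16"
      using c Wp unfolding continuous_on_iff by (metis atLeastAtMost_iff order.refl zero_le_one)
    (* On (x/2, x) the mean value theorem for phi gives |W| <= |W|/16 + |W|/4. *)
    define x where "x = min (\<delta> / 2) (1 / 2)"
    have x: "0 < x" "x < 1" "x < \<delta>" using \<delta>(1) by (auto simp: x_def)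
    have small: "\<bar>\<phi> z\<bar> < \<bar>W\<bar> / 16" if "0 < z" "z \<le> x" for z
      using \<delta>(2)[of z] that x \<phi>0 by (auto simp: dist_real_def)
    obtain z where z: "x / 2 < z" "z < x" "\<phi> x - \<phi> (x / 2) = (x - x / 2) * d z"
      using MVT2[of "x / 2" x \<phi> d] x d by auto
    have z0: "0 < z" "z < 1" using z x by auto
    have "W = \<phi> z * ?y' z - d z * ?y z" using Wc[OF z0] by (simp add: W_def Wr_def)
    then have "\<bar>W\<bar> \<le> \<bar>\<phi> z\<bar> * \<bar>?y' z\<bar> + \<bar>d z\<bar> * \<bar>?y z\<bar>"
      by (metis abs_mult abs_triangle_ineq4)
    also have "\<dots> \<le> \<bar>W\<bar> / 16 * 1 + \<bar>d z\<bar> * z"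
      using small[of z] z z0 l dmode_bound[OF b0 b2, of l z] mode_bound[OF b0 b2, of l z]
      by (intro add_mono mult_mono) auto
    also have "\<bar>d z\<bar> * z \<le> \<bar>d z\<bar> * x" using z by (intro mult_left_mono) auto
    also have "\<bar>d z\<bar> * x = 2 * \<bar>\<phi> x - \<phi> (x / 2)\<bar>" unfolding z(3) using x by (simp add: abs_mult)
    also have "\<dots> \<le> 2 * (\<bar>W\<bar> / 16 + \<bar>W\<bar> / 16)"
    proof -
      have "\<bar>\<phi> x\<bar> < \<bar>W\<bar> / 16" "\<bar>\<phi> (x / 2)\<bar> < \<bar>W\<bar> / 16"
        using x small[of x] small[of "x / 2"] by simp_all
      then have "\<bar>\<phi> x - \<phi> (x / 2)\<bar> \<le> \<bar>W\<bar> / 16 + \<bar>W\<bar> / 16"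
        by (intro order_trans[OF abs_triangle_ineq4] add_mono less_imp_le)
      then show ?thesis by (rule mult_left_mono) simp
    qed
    finally show False using Wp by simp
  qed
  then have W0: "\<phi> x * ?y' x = d x * ?y x" if "0 < x" "x < 1" for x
    using Wc[OF that] by (simp add: W_def Wr_def)
  obtain x0 where x0: "0 < x0" "x0 < 1" "?y x0 \<noteq> 0" using mode_nonzero by blast
  define a where "a = \<phi> x0 / ?y x0"
  have inner: "\<phi> x = a * ?y x" if x: "0 < x" "x < 1" for x
  proof -
    define lo hi where "lo = min x x0 / 2" and "hi = (1 + max x x0) / 2"
    have lohi: "0 < lo" "hi < 1" "lo < x" "x < hi" "lo < x0" "x0 < hi"
      using x x0 by (auto simp: lo_def hi_def min_def max_def)
    have "\<phi> x - a * ?y x = 0"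
    proof (rule second_order_ode_unique[of lo hi "\<lambda>x. \<phi> x - a * ?y x" "\<lambda>x. d x - a * ?y' x" "\<lambda>x. - l * x powr (\<beta> - 2)" "l * lo powr (\<beta> - 2)" x0])
      fix z assume z: "lo < z" "z < hi"
      then have z': "0 < z" "z < 1" using lohi by auto
      show "((\<lambda>x. \<phi> x - a * ?y x) has_real_derivative d z - a * ?y' z) (at z)"
        by (intro DERIV_diff DERIV_cmult d mode_deriv b0 z')
      have "((\<lambda>x. d x - a * ?y' x) has_real_derivative
          - l * z powr (\<beta> - 2) * \<phi> z - a * (- l * z powr (\<beta> - 2) * ?y z)) (at z)"
        by (intro DERIV_diff DERIV_cmult d2' dmode_deriv b0 z')
      then show "((\<lambda>x. d x - a * ?y' x) has_real_derivative
          - l * z powr (\<beta> - 2) * (\<phi> z - a * ?y z)) (at z)" by (simp add: algebra_simps)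
      have "z powr (\<beta> - 2) \<le> lo powr (\<beta> - 2)"
        using lohi z b2 by (intro powr_mono2') auto
      then show "\<bar>- l * z powr (\<beta> - 2)\<bar> \<le> l * lo powr (\<beta> - 2)"
        using l by (simp add: abs_mult)
    next
      show "\<phi> x0 - a * ?y x0 = 0" using x0 by (simp add: a_def)
      show "d x0 - a * ?y' x0 = 0" using W0[of x0] x0 by (simp add: a_def field_simps)
    qed (use lohi in auto)
    then show ?thesis by simp
  qed
  have "\<phi> 1 = a * ?y 1"
    by (rule continuous_on_eq_right_end[of 0 1]) (auto intro!: c continuous_intros mode_continuous01 inner)
  then have "\<phi> x = a * ?y x" if "0 \<le> x" "x \<le> 1" for x
    using inner[of x] \<phi>0 that by (cases "x = 0"; cases "x = 1") auto
  then show ?thesis using that by blast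
qed

end

lemma H10_cong:
  assumes "H10_deriv v dv" "\<And>x. 0 \<le> x \<Longrightarrow> x \<le> 1 \<Longrightarrow> v x = v' x"
  shows "H10_deriv v' dv"
  using assms by (auto simp: H10_deriv_def)

lemma H10_scale:
  assumes "H10_deriv v dv" shows "H10_deriv (\<lambda>x. c * v x) (\<lambda>x. c * dv x)"
  using H10_sum[of "{()}" "\<lambda>_. v" "\<lambda>_. dv" "\<lambda>_. c"] assms by simp

locale wave_basis = bessel_order +
  fixes \<Phi> :: "nat \<Rightarrow> real \<Rightarrow> real" and lam :: "nat \<Rightarrow> real"
  assumes basis: "dirichlet_eigenbasis (2 - \<beta>) \<Phi> lam"
begin

abbreviation "W \<equiv> weighted_measure (2 - \<beta>)"
abbreviation "I \<equiv> interval_measure01"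

lemma orthonormal: "orthonormal_basis W \<Phi>" and lam_pos: "lam k > 0"
  using basis by (auto simp: dirichlet_eigenbasis_def)

lemma \<Phi>_square_integrable: "square_integrable W (\<Phi> k)"
  and \<Phi>_inner: "l2_inner W (\<Phi> j) (\<Phi> k) = (if j = k then 1 else 0)"
  using orthonormal by (auto simp: orthonormal_basis_def)

text \<open>The boundary slope \<open>\<Phi>\<^sub>k'(0)\<close>: a mode has slope 1 at 0.\<close>

definition slope :: "nat \<Rightarrow> real" where
  "slope k = (SOME a. \<forall>x. 0 \<le> x \<longrightarrow> x \<le> 1 \<longrightarrow> \<Phi> k x = a * mode \<beta> (lam k) x)"

definition d\<Phi> :: "nat \<Rightarrow> real \<Rightarrow> real" where
  "d\<Phi> k x = slope k * dmode \<beta> (lam k) x"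

definition freq :: "nat \<Rightarrow> real" where "freq k = sqrt (lam k)"

lemma freq_pos: "freq k > 0" and freq_sq: "(freq k)\<^sup>2 = lam k"
  using lam_pos[of k] by (auto simp: freq_def)

lemma \<Phi>_eq: "0 \<le> x \<Longrightarrow> x \<le> 1 \<Longrightarrow> \<Phi> k x = slope k * mode \<beta> (lam k) x"
proof -
  obtain d d2 where d: "\<And>x. x \<in> {0<..<1} \<Longrightarrow> (\<Phi> k has_real_derivative d x) (at x)"
    "\<And>x. x \<in> {0<..<1} \<Longrightarrow> (d has_real_derivative d2 x) (at x)"
    "\<And>x. x \<in> {0<..<1} \<Longrightarrow> - (x powr (2 - \<beta>)) * d2 x = lam k * \<Phi> k x"
    and c: "continuous_on {0..1} (\<Phi> k)" "\<Phi> k 0 = 0"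
    using basis unfolding dirichlet_eigenbasis_def by metis
  obtain a where "\<And>x. 0 \<le> x \<Longrightarrow> x \<le> 1 \<Longrightarrow> \<Phi> k x = a * mode \<beta> (lam k) x"
    by (rule eigenfunction_eq_mode[OF lam_pos[of k] c, of d d2]) (use d in auto)
  then have "\<exists>a. \<forall>x. 0 \<le> x \<longrightarrow> x \<le> 1 \<longrightarrow> \<Phi> k x = a * mode \<beta> (lam k) x" by blast
  then show "0 \<le> x \<Longrightarrow> x \<le> 1 \<Longrightarrow> \<Phi> k x = slope k * mode \<beta> (lam k) x"
    unfolding slope_def by (rule someI2_ex) auto
qed

lemma slope_nonzero: "slope k \<noteq> 0"
proof
  assume "slope k = 0"
  then have "l2_inner W (\<Phi> k) (\<Phi> k) = l2_inner W (\<lambda>x. 0) (\<lambda>x. 0)"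
    unfolding l2_inner_def by (intro Bochner_Integration.integral_cong) (auto simp: \<Phi>_eq)
  then show False using \<Phi>_inner[of k k] by (simp add: l2_inner_def)
qed

lemma bessel_G_lam: "bessel_G \<beta> (lam k) = 0"
proof -
  have "\<Phi> k 1 = 0" using basis by (simp add: dirichlet_eigenbasis_def)
  then show ?thesis using \<Phi>_eq[of 1 k] slope_nonzero by (simp add: mode_def)
qed

lemma \<Phi>_H10: "H10_deriv (\<Phi> k) (d\<Phi> k)"
  using H10_scale[OF mode_H10[OF bessel_G_lam]] unfolding d\<Phi>_def[abs_def]
  by (rule H10_cong) (simp add: \<Phi>_eq)

lemma d\<Phi>_continuous: "continuous_on {0..} (d\<Phi> k)"
  unfolding d\<Phi>_def by (intro continuous_intros continuous_on_mode b0)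

lemma d\<Phi>_0 [simp]: "d\<Phi> k 0 = slope k" by (simp add: d\<Phi>_def)

lemma d\<Phi>_bound: "x \<ge> 0 \<Longrightarrow> \<bar>d\<Phi> k x\<bar> \<le> \<bar>slope k\<bar>"
  using dmode_bound[OF b0 b2, of "lam k" x] lam_pos[of k]
  by (simp add: d\<Phi>_def abs_mult mult_left_le)

lemma \<Phi>_bound: "0 \<le> x \<Longrightarrow> x \<le> 1 \<Longrightarrow> \<bar>\<Phi> k x\<bar> \<le> \<bar>slope k\<bar> * x"
  using mode_bound[OF b0 b2, of "lam k" x] lam_pos[of k]
  by (simp add: \<Phi>_eq abs_mult mult_left_mono)

lemma W_inner_cong:
  assumes "\<And>x. 0 < x \<Longrightarrow> x < 1 \<Longrightarrow> f x = f' x"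
  shows "l2_inner W f g = l2_inner W f' g"
  unfolding l2_inner_def using assms by (intro Bochner_Integration.integral_cong) auto

lemma \<Phi>_integration_by_parts:
  assumes "H10_deriv v dv"
  shows "l2_inner I (d\<Phi> k) dv = lam k * l2_inner W (\<Phi> k) v"
proof -
  have "l2_inner I (d\<Phi> k) dv = slope k * (lam k * l2_inner W (mode \<beta> (lam k)) v)"
    unfolding d\<Phi>_def[abs_def] l2_inner_scale_left
    using mode_integration_by_parts[OF _ assms, of "lam k"] lam_pos[of k] by simp
  also have "\<dots> = lam k * l2_inner W (\<lambda>x. slope k * mode \<beta> (lam k) x) v"
    unfolding l2_inner_scale_left by simp
  also have "l2_inner W (\<lambda>x. slope k * mode \<beta> (lam k) x) v = l2_inner W (\<Phi> k) v"
    by (rule W_inner_cong) (simp add: \<Phi>_eq)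
  finally show ?thesis .
qed

lemma d\<Phi>_square_integrable: "square_integrable I (d\<Phi> k)"
  using \<Phi>_H10[of k] by (simp add: H10_deriv_def)

lemma d\<Phi>_inner: "l2_inner I (d\<Phi> j) (d\<Phi> k) = (if j = k then lam k else 0)"
  using \<Phi>_integration_by_parts[OF \<Phi>_H10[of k], of j] by (simp add: \<Phi>_inner)

lemma mode_W_square_integrable: "square_integrable W (mode \<beta> l)" if "l \<ge> 0"
proof (rule square_integrable_weighted_bound[of _ _ 1])
  fix x :: real assume x: "0 < x" "x < 1"
  have "(mode \<beta> l x)\<^sup>2 \<le> x\<^sup>2"
    using mode_bound[OF b0 b2 that, of x] x by (simp add: abs_le_square_iff[symmetric])
  also have "\<dots> \<le> 1 * x" using x by (simp add: power2_eq_square mult_left_le)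
  finally show "(mode \<beta> l x)\<^sup>2 \<le> 1 * x" .
qed (use b0 in \<open>auto intro: measurable_continuous_interval_measure01 mode_continuous01\<close>)

lemma mode_W_normsq:
  assumes "l > 0" "bessel_G \<beta> l = 0"
  shows "l2_normsq W (mode \<beta> l) = (dmode \<beta> l 1)\<^sup>2 / (l * \<beta>)"
proof -
  have "l2_normsq W (mode \<beta> l) = (\<integral>x. x powr - (2 - \<beta>) * (mode \<beta> l x)\<^sup>2 \<partial>I)"
    unfolding l2_normsq_def
    using measurable_continuous_interval_measure01[OF mode_continuous01[of l]]
    by (subst integral_weighted_measure) auto
  also have "\<dots> = (LINT x:{0<..<1}|lborel. x powr (\<beta> - 2) * (mode \<beta> l x)\<^sup>2)"
    unfolding interval_measure01_def integral_restrict_lborel_Ioo by simp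
  finally show ?thesis using weighted_norm_mode[OF b0 b2 assms] by simp
qed

text \<open>In the variable \<open>s = 2 \<surd>l / \<beta>\<close> the normalisation of an eigenfunction and the slope of
  \<open>w\<close> at its zero are the same datum.\<close>

lemma slope_sq:
  "(slope k)\<^sup>2 = \<beta> * (2 / \<beta>) powr (2 * p) * lam k powr p / (dw (2 * freq k / \<beta>))\<^sup>2"
proof -
  define s where "s = 2 * freq k / \<beta>"
  have s: "s > 0" using freq_pos[of k] b0 by (simp add: s_def)
  have s2: "(\<beta> / 2)\<^sup>2 * s\<^sup>2 = lam k"
    using b0 freq_sq[of k] by (simp add: s_def power_divide power_mult_distrib)
  define G' where "G' = bessel_G' \<beta> (lam k)"
  have "w s = 0" using w_eq_0_iff[OF s] s2 bessel_G_lam by simp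
  then have dws: "dw s = s powr p * (\<beta>\<^sup>2 / 2 * s) * G'"
    using dw_at_zero[OF s] s2 by (simp add: G'_def)
  have dm: "dmode \<beta> (lam k) 1 = \<beta> * lam k * G'" by (simp add: dmode_def bessel_G_lam G'_def)
  have "1 = l2_normsq W (\<Phi> k)" by (simp add: l2_normsq_eq_inner \<Phi>_inner)
  also have "\<dots> = l2_normsq W (\<lambda>x. slope k * mode \<beta> (lam k) x)"
    unfolding l2_normsq_def by (intro Bochner_Integration.integral_cong) (auto simp: \<Phi>_eq)
  also have "\<dots> = (slope k)\<^sup>2 * ((\<beta> * lam k * G')\<^sup>2 / (lam k * \<beta>))"
    unfolding l2_normsq_scale mode_W_normsq[OF lam_pos bessel_G_lam] dm ..
  also have "(\<beta> * lam k * G')\<^sup>2 / (lam k * \<beta>) = \<beta> * lam k * G'\<^sup>2"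
    using lam_pos[of k] b0 by (simp add: power2_eq_square)
  finally have 1: "1 = (slope k)\<^sup>2 * (\<beta> * lam k * G'\<^sup>2)" .
  have sp: "(s powr p)\<^sup>2 = (2 / \<beta>) powr (2 * p) * lam k powr p"
  proof -
    have "(s powr p)\<^sup>2 = (s powr p) powr 2" using s by simp
    also have "\<dots> = s powr (2 * p)" by (simp add: powr_powr mult.commute)
    also have "\<dots> = (2 / \<beta>) powr (2 * p) * freq k powr (2 * p)"
      unfolding s_def using freq_pos[of k] b0 powr_mult[of "2 / \<beta>" "freq k" "2 * p"] by simp
    also have "freq k powr (2 * p) = (freq k powr 2) powr p" by (simp add: powr_powr)
    also have "freq k powr 2 = lam k" using freq_pos[of k] freq_sq[of k] by simp
    finally show ?thesis .
  qed
  have "(dw s)\<^sup>2 = (s powr p)\<^sup>2 * (\<beta>\<^sup>2 * ((\<beta> / 2)\<^sup>2 * s\<^sup>2) * G'\<^sup>2)"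
    unfolding dws by (simp add: power2_eq_square)
  also have "\<dots> = (s powr p)\<^sup>2 * \<beta> * (\<beta> * lam k * G'\<^sup>2)"
    unfolding s2 by (simp add: power2_eq_square)
  finally have "(slope k)\<^sup>2 * (dw s)\<^sup>2 = (s powr p)\<^sup>2 * \<beta> * 1" using 1 by simp
  moreover have "dw s \<noteq> 0" using 1 s b0 by (auto simp: dws)
  ultimately show ?thesis unfolding s_def[symmetric] sp by (simp add: field_simps)
qed

lemma scaled_zero: "w (2 * freq k / \<beta>) = 0"
proof -
  have s: "2 * freq k / \<beta> > 0" using freq_pos[of k] b0 by simp
  have "(\<beta> / 2)\<^sup>2 * (2 * freq k / \<beta>)\<^sup>2 = lam k"
    using b0 freq_sq[of k] by (simp add: power_divide power_mult_distrib)
  then show ?thesis using w_eq_0_iff[OF s] bessel_G_lam by simp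
qed

lemma slope_bounds:
  obtains K1 K2 where "0 < K1" "0 < K2"
    "\<And>k. K1 * lam k powr p \<le> (slope k)\<^sup>2" "\<And>k. (slope k)\<^sup>2 \<le> K2 * lam k powr p"
proof -
  obtain m1 m2 where m: "0 < m1" "\<And>s. 0 < s \<Longrightarrow> w s = 0 \<Longrightarrow> m1 \<le> (dw s)\<^sup>2 \<and> (dw s)\<^sup>2 \<le> m2"
    using dw_at_zero_bounds by blast
  define B where "B = \<beta> * (2 / \<beta>) powr (2 * p)"
  have B: "B > 0" using b0 by (simp add: B_def)
  have mk: "m1 \<le> (dw (2 * freq k / \<beta>))\<^sup>2" "(dw (2 * freq k / \<beta>))\<^sup>2 \<le> m2" for k
    using m(2)[of "2 * freq k / \<beta>"] scaled_zero[of k] freq_pos[of k] b0 by auto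
  have "m2 > 0" using mk[of 0] m(1) by linarith
  have "B / m2 * lam k powr p \<le> (slope k)\<^sup>2" "(slope k)\<^sup>2 \<le> B / m1 * lam k powr p" for k
    unfolding slope_sq B_def[symmetric] using mk[of k] m(1) B \<open>m2 > 0\<close>
    by (auto intro!: divide_left_mono mult_pos_pos simp: less_le_trans)
  then show ?thesis using that[of "B / m2" "B / m1"] B m(1) \<open>m2 > 0\<close> by simp
qed

lemma lam_inj: "lam j = lam k \<Longrightarrow> j = k"
proof (rule ccontr)
  assume eq: "lam j = lam k" and ne: "j \<noteq> k"
  have "l2_inner W (\<Phi> j) (\<Phi> k) = l2_inner W (\<lambda>x. slope j / slope k * \<Phi> k x) (\<Phi> k)"
    using slope_nonzero[of k] by (intro W_inner_cong) (simp add: \<Phi>_eq eq)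
  also have "\<dots> = slope j / slope k" by (simp only: l2_inner_scale_left) (simp add: \<Phi>_inner)
  finally show False using slope_nonzero ne by (simp add: \<Phi>_inner)
qed

text \<open>Completeness of the basis: a zero of \<open>w\<close> that is not listed would give a nonzero function
  orthogonal to every eigenfunction.\<close>

lemma zeros_are_eigenvalues:
  assumes s: "s > 0" "w s = 0"
  obtains k where "freq k = \<beta> / 2 * s"
proof -
  define l where "l = (\<beta> / 2)\<^sup>2 * s\<^sup>2"
  have l: "l > 0" "bessel_G \<beta> l = 0" using s b0 w_eq_0_iff by (auto simp: l_def)
  let ?y = "mode \<beta> l"
  have y: "square_integrable W ?y" using mode_W_square_integrable l by simp
  have "\<exists>k. lam k = l"
  proof (rule ccontr)
    assume n: "\<nexists>k. lam k = l"
    have 0: "l2_inner W ?y (\<Phi> k) = 0" for k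
    proof -
      have "l * l2_inner W ?y (\<Phi> k) = l2_inner I (dmode \<beta> l) (d\<Phi> k)"
        using mode_integration_by_parts[OF _ \<Phi>_H10[of k], of l] l by simp
      also have "\<dots> = lam k * l2_inner W ?y (\<Phi> k)"
        using \<Phi>_integration_by_parts[OF mode_H10[OF l(2)], of k] by (simp add: l2_inner_commute)
      finally show ?thesis using n by (metis mult_cancel_right)
    qed
    have "(\<lambda>n. l2_normsq W (\<lambda>x. ?y x - (\<Sum>k<n. l2_inner W ?y (\<Phi> k) * \<Phi> k x))) \<longlonglongrightarrow> 0"
      using orthonormal y by (simp add: orthonormal_basis_def)
    then have "l2_normsq W ?y = 0" by (simp add: 0 LIMSEQ_const_iff)
    then have d0: "dmode \<beta> l 1 = 0" using mode_W_normsq[OF l] l b0 by simp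
    then have "bessel_G' \<beta> l = 0" using l b0 by (simp add: dmode_def)
    then have "dw s = 0" using dw_at_zero[OF s] by (simp add: l_def)
    moreover obtain m1 m2 where "0 < m1" "\<And>s. 0 < s \<Longrightarrow> w s = 0 \<Longrightarrow> m1 \<le> (dw s)\<^sup>2 \<and> (dw s)\<^sup>2 \<le> m2"
      using dw_at_zero_bounds by blast
    ultimately show False using s by fastforce
  qed
  then obtain k where "lam k = l" by blast
  then have "freq k = \<beta> / 2 * s"
    using s b0 by (simp add: freq_def l_def real_sqrt_mult)
  then show ?thesis using that by blast
qed

lemma freq_gap:
  assumes "j \<noteq> k" shows "\<bar>freq j - freq k\<bar> \<ge> \<beta> / 2 * pi"
proof -
  have *: "freq b - freq a \<ge> \<beta> / 2 * pi" if "freq a < freq b" for a b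
  proof -
    have "2 * freq b / \<beta> - 2 * freq a / \<beta> \<ge> pi"
      using that b0 freq_pos[of a] by (intro zero_gap scaled_zero) (auto simp: divide_strict_right_mono)
    then show ?thesis using b0 by (simp add: field_simps)
  qed
  have "freq j \<noteq> freq k" using assms lam_inj freq_sq by metis
  then show ?thesis using *[of j k] *[of k j] by linarith
qed

lemma freq_ge: "freq k \<ge> \<beta> / 2 * pi"
  using zero_gap[of 0 "2 * freq k / \<beta>"] scaled_zero[of k] freq_pos[of k] b0 by (simp add: field_simps)

end

section \<open>Ingham's inequality\<close>

text \<open>Since \<open>2/(4d\<^sup>2 - 1) = 1/(2d - 1) - 1/(2d + 1)\<close> and the intervals \<open>[2d - 1, 2d + 1]\<close> of a
  separated set do not overlap, the sum is dominated by a telescoping one.\<close>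

lemma sum_separated_bound:
  fixes S :: "real set"
  assumes "finite S"
  shows "(\<forall>d\<in>S. d \<ge> 1) \<Longrightarrow> (\<forall>d\<in>S. \<forall>e\<in>S. d \<noteq> e \<longrightarrow> \<bar>d - e\<bar> \<ge> 1) \<Longrightarrow>
    X \<ge> 0 \<Longrightarrow> (\<forall>d\<in>S. d \<le> X) \<Longrightarrow> (\<Sum>d\<in>S. 1 / (4 * d\<^sup>2 - 1)) \<le> (1 - 1 / (2 * X + 1)) / 2"
  using assms
proof (induction S arbitrary: X rule: finite_linorder_max_induct)
  case empty
  then show ?case by simp
next
  case (insert b A)
  have b: "b \<ge> 1" "b \<le> X" using insert.prems by auto
  have "b \<notin> A" using insert.hyps by auto
  have le: "\<forall>d\<in>A. d \<le> b - 1"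
  proof
    fix d assume d: "d \<in> A"
    then have "d < b" using insert.hyps by auto
    moreover have "\<bar>d - b\<bar> \<ge> 1" using insert.prems(2) d \<open>d < b\<close> by auto
    ultimately show "d \<le> b - 1" by linarith
  qed
  have IH: "(\<Sum>d\<in>A. 1 / (4 * d\<^sup>2 - 1)) \<le> (1 - 1 / (2 * (b - 1) + 1)) / 2"
    using insert.prems b le by (intro insert.IH) auto
  have "1 / (4 * b\<^sup>2 - 1) = (1 / (2 * b - 1) - 1 / (2 * b + 1)) / 2"
  proof -
    have "4 * b\<^sup>2 - 1 = (2 * b - 1) * (2 * b + 1)" by (simp add: algebra_simps power2_eq_square)
    then show ?thesis using b diff_frac_eq[of "2 * b - 1" "2 * b + 1" 1 1] by simp
  qed
  then have "(\<Sum>d\<in>insert b A. 1 / (4 * d\<^sup>2 - 1)) \<le> (1 - 1 / (2 * b + 1)) / 2"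
    using IH \<open>b \<notin> A\<close> insert.hyps(1) by (simp add: algebra_simps)
  also have "\<dots> \<le> (1 - 1 / (2 * X + 1)) / 2"
    using b by (intro divide_right_mono diff_left_mono divide_left_mono) auto
  finally show ?case .
qed

lemma sum_separated_le_half:
  fixes d :: "'i \<Rightarrow> real"
  assumes J: "finite J" and g: "\<gamma> > 0" and ge: "\<And>i. i \<in> J \<Longrightarrow> d i \<ge> \<gamma>"
    and sep: "\<And>i j. i \<in> J \<Longrightarrow> j \<in> J \<Longrightarrow> i \<noteq> j \<Longrightarrow> \<bar>d i - d j\<bar> \<ge> \<gamma>"
  shows "(\<Sum>i\<in>J. 1 / (4 * (d i / \<gamma>)\<^sup>2 - 1)) \<le> 1 / 2"
proof -
  have inj: "inj_on (\<lambda>i. d i / \<gamma>) J"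
  proof (rule inj_onI)
    fix i j assume "i \<in> J" "j \<in> J" "d i / \<gamma> = d j / \<gamma>"
    then show "i = j" using sep[of i j] g by (cases "i = j") auto
  qed
  have dist: "\<bar>d i / \<gamma> - d j / \<gamma>\<bar> \<ge> 1" if "i \<in> J" "j \<in> J" "i \<noteq> j" for i j
    using sep[OF that] g by (simp add: diff_divide_distrib[symmetric] abs_divide)
  define X where "X = (\<Sum>i\<in>J. \<bar>d i / \<gamma>\<bar>)"
  have X: "X \<ge> 0" unfolding X_def by (intro sum_nonneg) auto
  have X': "d i / \<gamma> \<le> X" if "i \<in> J" for i
    unfolding X_def
    by (rule order_trans[OF abs_ge_self member_le_sum[of i J "\<lambda>i. \<bar>d i / \<gamma>\<bar>"]]) (use that J in auto)
  have "(\<Sum>i\<in>J. 1 / (4 * (d i / \<gamma>)\<^sup>2 - 1)) = (\<Sum>x\<in>(\<lambda>i. d i / \<gamma>) ` J. 1 / (4 * x\<^sup>2 - 1))"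
    by (simp add: sum.reindex[OF inj])
  also have "\<dots> \<le> (1 - 1 / (2 * X + 1)) / 2"
    using J X X' ge g dist by (intro sum_separated_bound) (auto simp: field_simps)
  also have "\<dots> \<le> 1 / 2" using X by simp
  finally show ?thesis .
qed

text \<open>The cosine transform of the weight \<open>cos (a t)\<close> on \<open>[-R, R]\<close>, where \<open>a R = \<pi>/2\<close>. That the weight
  vanishes at the ends gives the quadratic decay on which the argument rests.\<close>

definition cos_kernel :: "real \<Rightarrow> real \<Rightarrow> real \<Rightarrow> real" where
  "cos_kernel a R d = cos (d * R) * (2 * a / (a\<^sup>2 - d\<^sup>2))"

lemma deriv_sin_cos_scaled:
  fixes c :: real
  assumes "c \<noteq> 0"
  shows "((\<lambda>t. sin (c * t) / (2 * c)) has_real_derivative cos (c * t) / 2) (at t)"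
    and "((\<lambda>t. cos (c * t) / (2 * c)) has_real_derivative - sin (c * t) / 2) (at t)"
  using assms by (auto intro!: derivative_eq_intros simp: field_simps)

lemma cos_kernel_integral:
  assumes a: "a > 0" "a * R = pi / 2" and d: "\<bar>d\<bar> \<noteq> a"
  shows "((\<lambda>t. cos (a * t) * cos (d * t)) has_integral cos_kernel a R d) {-R..R}"
proof -
  have R: "R > 0" using a pi_gt_zero by (metis zero_less_mult_pos half_gt_zero)
  have ne: "a - d \<noteq> 0" "a + d \<noteq> 0" using d a(1) by auto
  define F where "F = (\<lambda>t. sin ((a - d) * t) / (2 * (a - d)) + sin ((a + d) * t) / (2 * (a + d)))"
  have "((\<lambda>t. cos (a * t) * cos (d * t)) has_integral F R - F (- R)) {-R..R}"
  proof (rule fundamental_theorem_of_calculus)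
    fix t assume "t \<in> {-R..R}"
    have "(F has_real_derivative cos ((a - d) * t) / 2 + cos ((a + d) * t) / 2) (at t)"
      unfolding F_def by (intro DERIV_add deriv_sin_cos_scaled ne)
    also have "cos ((a - d) * t) / 2 + cos ((a + d) * t) / 2 = cos (a * t) * cos (d * t)"
      by (simp add: left_diff_distrib distrib_right cos_diff cos_add field_simps)
    finally show "(F has_vector_derivative cos (a * t) * cos (d * t)) (at t within {-R..R})"
      using has_real_derivative_iff_has_vector_derivative has_vector_derivative_at_within by blast
  qed (use R in simp)
  also have "F R - F (- R) = (sin ((a - d) * R) / (2 * (a - d)) - (- sin ((a - d) * R)) / (2 * (a - d)))
      + (sin ((a + d) * R) / (2 * (a + d)) - (- sin ((a + d) * R)) / (2 * (a + d)))"
    by (simp add: F_def)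
  also have "\<dots> = sin ((a - d) * R) / (a - d) + sin ((a + d) * R) / (a + d)"
  proof -
    have "x / (2 * c) - (- x) / (2 * c) = x / c" for x c :: real by (cases "c = 0") (auto simp: field_simps)
    then show ?thesis by (simp only:)
  qed
  also have "\<dots> = sin (pi / 2 - d * R) / (a - d) + sin (pi / 2 + d * R) / (a + d)"
    by (simp only: left_diff_distrib distrib_right a(2))
  also have "\<dots> = cos (d * R) * (1 / (a - d) + 1 / (a + d))"
    by (simp add: sin_diff sin_add algebra_simps)
  also have "1 / (a - d) + 1 / (a + d) = 2 * a / (a\<^sup>2 - d\<^sup>2)"
  proof -
    have "a\<^sup>2 - d\<^sup>2 = (a - d) * (a + d)" by (simp add: power2_eq_square algebra_simps)
    then show ?thesis using add_frac_eq[OF ne, of 1 1] by simp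
  qed
  finally have "((\<lambda>t. cos (a * t) * cos (d * t)) has_integral cos (d * R) * (2 * a / (a\<^sup>2 - d\<^sup>2))) {-R..R}" .
  then show ?thesis unfolding cos_kernel_def .
qed

lemma cos_sin_integral_0:
  assumes a: "a > 0" "a * R = pi / 2" and d: "\<bar>d\<bar> \<noteq> a"
  shows "((\<lambda>t. cos (a * t) * sin (d * t)) has_integral 0) {-R..R}"
proof -
  have R: "R > 0" using a pi_gt_zero by (metis zero_less_mult_pos half_gt_zero)
  have ne: "a - d \<noteq> 0" "a + d \<noteq> 0" using d a(1) by auto
  define F where "F = (\<lambda>t. cos ((a - d) * t) / (2 * (a - d)) - cos ((a + d) * t) / (2 * (a + d)))"
  have "((\<lambda>t. cos (a * t) * sin (d * t)) has_integral F R - F (- R)) {-R..R}"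
  proof (rule fundamental_theorem_of_calculus)
    fix t assume "t \<in> {-R..R}"
    have "(F has_real_derivative - sin ((a - d) * t) / 2 - - sin ((a + d) * t) / 2) (at t)"
      unfolding F_def by (intro DERIV_diff deriv_sin_cos_scaled ne)
    also have "- sin ((a - d) * t) / 2 - - sin ((a + d) * t) / 2 = cos (a * t) * sin (d * t)"
      by (simp add: left_diff_distrib distrib_right sin_diff sin_add field_simps)
    finally show "(F has_vector_derivative cos (a * t) * sin (d * t)) (at t within {-R..R})"
      using has_real_derivative_iff_has_vector_derivative has_vector_derivative_at_within by blast
  qed (use R in simp)
  also have "F R - F (- R) = 0" by (simp add: F_def)
  finally show ?thesis .
qed

lemma cos_kernel_bound:
  assumes a: "a > 0" "2 * a < \<gamma>" and d: "\<bar>d\<bar> \<ge> \<gamma>"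
  shows "\<bar>cos_kernel a R d\<bar> \<le> (8 * a / \<gamma>\<^sup>2) * (1 / (4 * (\<bar>d\<bar> / \<gamma>)\<^sup>2 - 1))"
proof -
  have g: "\<gamma> > 0" using a by linarith
  have d2: "\<gamma>\<^sup>2 \<le> d\<^sup>2" using d g by (metis abs_le_square_iff abs_of_pos)
  have a2: "4 * a\<^sup>2 < \<gamma>\<^sup>2" using power_strict_mono[OF a(2), of 2] a(1) by (simp add: power_mult_distrib)
  have p1: "0 < d\<^sup>2 - \<gamma>\<^sup>2 / 4" using d2 g zero_less_power[OF g, of 2] by linarith
  have p2: "d\<^sup>2 - \<gamma>\<^sup>2 / 4 \<le> d\<^sup>2 - a\<^sup>2" using a2 by simp
  have "\<bar>cos_kernel a R d\<bar> \<le> 1 * (2 * a / (d\<^sup>2 - a\<^sup>2))"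
    unfolding cos_kernel_def abs_mult
    using p1 p2 a(1) by (intro mult_mono) (auto simp: abs_divide)
  also have "\<dots> \<le> 2 * a / (d\<^sup>2 - \<gamma>\<^sup>2 / 4)"
    using p1 p2 a(1) by (auto intro!: divide_left_mono mult_pos_pos)
  also have "d\<^sup>2 - \<gamma>\<^sup>2 / 4 = \<gamma>\<^sup>2 / 4 * (4 * (\<bar>d\<bar> / \<gamma>)\<^sup>2 - 1)"
    using g by (simp add: power_divide field_simps)
  also have "2 * a / (\<gamma>\<^sup>2 / 4 * (4 * (\<bar>d\<bar> / \<gamma>)\<^sup>2 - 1)) = (8 * a / \<gamma>\<^sup>2) * (1 / (4 * (\<bar>d\<bar> / \<gamma>)\<^sup>2 - 1))"
    by (simp add: field_simps)
  finally show ?thesis .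
qed

definition trig_sum :: "nat set \<Rightarrow> (nat \<Rightarrow> real) \<Rightarrow> (nat \<Rightarrow> real) \<Rightarrow> (nat \<Rightarrow> real) \<Rightarrow> real \<Rightarrow> real" where
  "trig_sum F \<mu> A B t = (\<Sum>k\<in>F. A k * cos (\<mu> k * t) + B k * sin (\<mu> k * t))"

definition trig_energy :: "nat set \<Rightarrow> (nat \<Rightarrow> real) \<Rightarrow> (nat \<Rightarrow> real) \<Rightarrow> real" where
  "trig_energy F A B = (\<Sum>k\<in>F. (A k)\<^sup>2 + (B k)\<^sup>2)"

lemma continuous_on_trig_sum: "continuous_on X (trig_sum F \<mu> A B)"
  unfolding trig_sum_def[abs_def] by (intro continuous_intros)

lemma abs_bilinear_le:
  fixes a b c d :: real
  shows "\<bar>a * b + c * d\<bar> \<le> ((a\<^sup>2 + c\<^sup>2) + (b\<^sup>2 + d\<^sup>2)) / 2"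
    and "\<bar>a * b - c * d\<bar> \<le> ((a\<^sup>2 + c\<^sup>2) + (b\<^sup>2 + d\<^sup>2)) / 2"
proof -
  have "\<bar>x * y\<bar> \<le> (x\<^sup>2 + y\<^sup>2) / 2" for x y :: real
    using sum_squares_bound[of "\<bar>x\<bar>" "\<bar>y\<bar>"] by (simp add: abs_mult)
  from this[of a b] this[of c d]
  have *: "\<bar>a * b\<bar> + \<bar>c * d\<bar> \<le> ((a\<^sup>2 + c\<^sup>2) + (b\<^sup>2 + d\<^sup>2)) / 2" by argo
  show "\<bar>a * b + c * d\<bar> \<le> ((a\<^sup>2 + c\<^sup>2) + (b\<^sup>2 + d\<^sup>2)) / 2"
    by (rule order_trans[OF abs_triangle_ineq *])
  show "\<bar>a * b - c * d\<bar> \<le> ((a\<^sup>2 + c\<^sup>2) + (b\<^sup>2 + d\<^sup>2)) / 2"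
    by (rule order_trans[OF abs_triangle_ineq4 *])
qed

lemma trig_product_expand:
  fixes A B C D c s c' s' :: real
  shows "(A * c + B * s) * (C * c' + D * s') = ((A * C + B * D) / 2) * (c * c' + s * s')
      + ((A * C - B * D) / 2) * (c * c' - s * s') + ((A * D + B * C) / 2) * (s * c' + c * s')
      + ((B * C - A * D) / 2) * (s * c' - c * s')"
  by (simp add: field_simps)

text \<open>The diagonal terms contribute \<open>1/a\<close> times the energy. By the gap condition the distances from
  one frequency to all the others and to all the negatives are at least \<open>\<gamma>, 2\<gamma>, \<dots>\<close> on either
  side, so the remaining terms contribute at most \<open>4a/\<gamma>\<^sup>2\<close> times the energy, which is less
  precisely when \<open>2a < \<gamma>\<close>.\<close>

lemma ingham_weighted:
  fixes \<mu> A B :: "nat \<Rightarrow> real"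
  assumes F: "finite F" and a: "a > 0" "a * R = pi / 2" "2 * a < \<gamma>"
    and gap: "\<And>j k. j \<noteq> k \<Longrightarrow> \<bar>\<mu> j - \<mu> k\<bar> \<ge> \<gamma>" and ge: "\<And>k. \<mu> k \<ge> \<gamma>"
  shows "\<bar>integral {-R..R} (\<lambda>t. cos (a * t) * (trig_sum F \<mu> A B t)\<^sup>2)
      - (1 / a) * trig_energy F A B\<bar> \<le> (4 * a / \<gamma>\<^sup>2) * trig_energy F A B"
proof -
  let ?K = "cos_kernel a R"
  define r where "r k = (A k)\<^sup>2 + (B k)\<^sup>2" for k
  have g: "\<gamma> > 0" using a by linarith
  define h where "h x = (8 * a / \<gamma>\<^sup>2) * (1 / (4 * (\<bar>x\<bar> / \<gamma>)\<^sup>2 - 1))" for x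
  have ok: "\<bar>\<mu> j - \<mu> k\<bar> \<noteq> a" "\<bar>\<mu> j + \<mu> k\<bar> \<noteq> a" for j k
    using gap[of j k] ge[of j] ge[of k] a g by (cases "j = k"; auto)+
  define T where "T j k = ((A j * A k + B j * B k) * ?K (\<mu> j - \<mu> k) + (A j * A k - B j * B k) * ?K (\<mu> j + \<mu> k)) / 2" for j k
  have "((\<lambda>t. cos (a * t) * ((A j * cos (\<mu> j * t) + B j * sin (\<mu> j * t)) * (A k * cos (\<mu> k * t) + B k * sin (\<mu> k * t))))
      has_integral T j k) {-R..R}" for j k
  proof -
    have "((\<lambda>t. ((A j * A k + B j * B k) / 2) * (cos (a * t) * cos ((\<mu> j - \<mu> k) * t))
        + ((A j * A k - B j * B k) / 2) * (cos (a * t) * cos ((\<mu> j + \<mu> k) * t))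
        + ((A j * B k + B j * A k) / 2) * (cos (a * t) * sin ((\<mu> j + \<mu> k) * t))
        + ((B j * A k - A j * B k) / 2) * (cos (a * t) * sin ((\<mu> j - \<mu> k) * t)))
      has_integral ((A j * A k + B j * B k) / 2) * ?K (\<mu> j - \<mu> k) + ((A j * A k - B j * B k) / 2) * ?K (\<mu> j + \<mu> k)
        + ((A j * B k + B j * A k) / 2) * 0 + ((B j * A k - A j * B k) / 2) * 0) {-R..R}"
      by (intro has_integral_add has_integral_mult_right cos_kernel_integral cos_sin_integral_0 a ok)
    moreover have "((A j * A k + B j * B k) / 2) * ?K (\<mu> j - \<mu> k) + ((A j * A k - B j * B k) / 2) * ?K (\<mu> j + \<mu> k)
        + ((A j * B k + B j * A k) / 2) * 0 + ((B j * A k - A j * B k) / 2) * 0 = T j k"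
      by (simp add: T_def field_simps)
    moreover have "((A j * A k + B j * B k) / 2) * (cos (a * t) * cos ((\<mu> j - \<mu> k) * t))
        + ((A j * A k - B j * B k) / 2) * (cos (a * t) * cos ((\<mu> j + \<mu> k) * t))
        + ((A j * B k + B j * A k) / 2) * (cos (a * t) * sin ((\<mu> j + \<mu> k) * t))
        + ((B j * A k - A j * B k) / 2) * (cos (a * t) * sin ((\<mu> j - \<mu> k) * t))
      = cos (a * t) * ((A j * cos (\<mu> j * t) + B j * sin (\<mu> j * t)) * (A k * cos (\<mu> k * t) + B k * sin (\<mu> k * t)))" for t
    proof -
      let ?x = "\<mu> j * t" and ?y = "\<mu> k * t"
      have e: "(\<mu> j - \<mu> k) * t = ?x - ?y" "(\<mu> j + \<mu> k) * t = ?x + ?y" by (simp_all add: algebra_simps)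
      show ?thesis
        unfolding trig_product_expand e cos_diff cos_add sin_diff sin_add by (simp only: distrib_left mult.left_commute)
    qed
    ultimately show ?thesis by simp
  qed
  then have "((\<lambda>t. \<Sum>j\<in>F. \<Sum>k\<in>F. cos (a * t) * ((A j * cos (\<mu> j * t) + B j * sin (\<mu> j * t)) * (A k * cos (\<mu> k * t) + B k * sin (\<mu> k * t))))
      has_integral (\<Sum>j\<in>F. \<Sum>k\<in>F. T j k)) {-R..R}"
    by (intro has_integral_sum F)
  moreover have "(\<Sum>j\<in>F. \<Sum>k\<in>F. cos (a * t) * ((A j * cos (\<mu> j * t) + B j * sin (\<mu> j * t)) * (A k * cos (\<mu> k * t) + B k * sin (\<mu> k * t))))
      = cos (a * t) * (trig_sum F \<mu> A B t)\<^sup>2" for t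
    unfolding trig_sum_def power2_eq_square sum_product by (simp add: sum_distrib_left)
  ultimately have J: "integral {-R..R} (\<lambda>t. cos (a * t) * (trig_sum F \<mu> A B t)\<^sup>2) = (\<Sum>j\<in>F. \<Sum>k\<in>F. T j k)"
    by (simp add: integral_unique)
  define N where "N j k = (if j = k then 0 else h (\<mu> j - \<mu> k)) + h (\<mu> j + \<mu> k)" for j k
  have K0: "?K 0 = 2 / a" using a(1) by (simp add: cos_kernel_def power2_eq_square)
  have Kb: "\<bar>?K x\<bar> \<le> h x" if "\<bar>x\<bar> \<ge> \<gamma>" for x
    unfolding h_def by (rule cos_kernel_bound[OF a(1) a(3) that])
  have sum_ge: "\<bar>\<mu> j + \<mu> k\<bar> \<ge> \<gamma>" for j k using ge[of j] ge[of k] g by simp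
  have T: "\<bar>T j k - (if j = k then r k / a else 0)\<bar> \<le> (r j + r k) / 4 * N j k" for j k
  proof -
    have b: "\<bar>A j * A k + B j * B k\<bar> \<le> (r j + r k) / 2" "\<bar>A j * A k - B j * B k\<bar> \<le> (r j + r k) / 2"
      unfolding r_def using abs_bilinear_le[of "A j" "A k" "B j" "B k"] by auto
    have rn: "0 \<le> (r j + r k) / 2" by (simp add: r_def)
    have 2: "\<bar>(A j * A k - B j * B k) * ?K (\<mu> j + \<mu> k)\<bar> \<le> (r j + r k) / 2 * h (\<mu> j + \<mu> k)"
      unfolding abs_mult by (intro mult_mono b Kb sum_ge rn) auto
    show ?thesis
    proof (cases "j = k")
      case True
      then have "T j k - r k / a = (A j * A k - B j * B k) * ?K (\<mu> j + \<mu> k) / 2"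
        using a(1) by (simp add: T_def K0 r_def power2_eq_square add_divide_distrib)
      then have "\<bar>T j k - r k / a\<bar> = \<bar>(A j * A k - B j * B k) * ?K (\<mu> j + \<mu> k)\<bar> / 2"
        by (simp only: abs_divide abs_numeral)
      then show ?thesis using 2 True by (simp add: N_def field_simps)
    next
      case False
      have 1: "\<bar>(A j * A k + B j * B k) * ?K (\<mu> j - \<mu> k)\<bar> \<le> (r j + r k) / 2 * h (\<mu> j - \<mu> k)"
        unfolding abs_mult by (intro mult_mono b Kb gap rn False) auto
      have "\<bar>T j k\<bar> \<le> (\<bar>(A j * A k + B j * B k) * ?K (\<mu> j - \<mu> k)\<bar> + \<bar>(A j * A k - B j * B k) * ?K (\<mu> j + \<mu> k)\<bar>) / 2"
        unfolding T_def by simp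
      also have "\<dots> \<le> ((r j + r k) / 2 * h (\<mu> j - \<mu> k) + (r j + r k) / 2 * h (\<mu> j + \<mu> k)) / 2"
        using 1 2 by simp
      finally show ?thesis using False by (simp add: N_def algebra_simps)
    qed
  qed
  have Nsym: "N j k = N k j" for j k
    by (simp add: N_def h_def abs_minus_commute add.commute)
  have Nsum: "(\<Sum>k\<in>F. N j k) \<le> 8 * a / \<gamma>\<^sup>2" for j
  proof -
    define F1 where "F1 = {k\<in>F. \<mu> k > \<mu> j}"
    define F2 where "F2 = {k\<in>F. \<mu> k < \<mu> j}"
    have ne: "\<mu> k \<noteq> \<mu> j" if "k \<noteq> j" for k using gap[OF that] g by auto
    have F12: "finite F1" "finite F2" "F1 \<inter> F2 = {}" using F by (auto simp: F1_def F2_def)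
    have "(\<Sum>k\<in>F. if j = k then 0 else h (\<mu> j - \<mu> k)) = (\<Sum>k\<in>F1 \<union> F2. h (\<mu> j - \<mu> k))"
    proof (rule sum.mono_neutral_cong_right[OF F])
      show "F1 \<union> F2 \<subseteq> F" by (auto simp: F1_def F2_def)
      show "\<forall>i\<in>F - (F1 \<union> F2). (if j = i then 0 else h (\<mu> j - \<mu> i)) = 0"
      proof
        fix i assume "i \<in> F - (F1 \<union> F2)"
        then have "\<mu> i = \<mu> j" by (auto simp: F1_def F2_def)
        then have "i = j" using ne by blast
        then show "(if j = i then 0 else h (\<mu> j - \<mu> i)) = 0" by simp
      qed
    qed (auto simp: F1_def F2_def)
    also have "\<dots> = (\<Sum>k\<in>F1. h (\<mu> k - \<mu> j)) + (\<Sum>k\<in>F2. h (\<mu> j - \<mu> k))"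
      using F12 by (subst sum.union_disjoint) (auto simp: h_def abs_minus_commute)
    finally have "(\<Sum>k\<in>F. N j k) = (\<Sum>k\<in>F1. h (\<mu> k - \<mu> j)) + ((\<Sum>k\<in>F2. h (\<mu> j - \<mu> k)) + (\<Sum>k\<in>F. h (\<mu> j + \<mu> k)))"
      by (simp add: N_def sum.distrib)
    moreover have "(\<Sum>k\<in>F1. h (\<mu> k - \<mu> j)) \<le> (8 * a / \<gamma>\<^sup>2) * (1 / 2)"
    proof -
      have "(\<Sum>k\<in>F1. 1 / (4 * ((\<mu> k - \<mu> j) / \<gamma>)\<^sup>2 - 1)) \<le> 1 / 2"
      proof (rule sum_separated_le_half[OF F12(1) g])
        fix i assume "i \<in> F1" then show "\<gamma> \<le> \<mu> i - \<mu> j" using gap[of i j] by (auto simp: F1_def)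
      qed (use gap in auto)
      then show ?thesis
        unfolding h_def sum_distrib_left[symmetric] using a(1) g by (intro mult_left_mono) (auto simp: power_divide)
    qed
    moreover have "(\<Sum>k\<in>F2. h (\<mu> j - \<mu> k)) + (\<Sum>k\<in>F. h (\<mu> j + \<mu> k)) \<le> (8 * a / \<gamma>\<^sup>2) * (1 / 2)"
    proof -
      define d where "d = case_sum (\<lambda>k. \<mu> j - \<mu> k) (\<lambda>k. \<mu> j + \<mu> k)"
      have "(\<Sum>i\<in>F2 <+> F. 1 / (4 * (d i / \<gamma>)\<^sup>2 - 1)) \<le> 1 / 2"
      proof (rule sum_separated_le_half)
        show "finite (F2 <+> F)" using F F12 by simp
        fix i assume i: "i \<in> F2 <+> F"
        then show "\<gamma> \<le> d i"
          using gap ge g by (auto simp: d_def F2_def) (smt (verit), smt (verit))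
        fix i' assume i': "i' \<in> F2 <+> F" "i \<noteq> i'"
        have *: "\<gamma> \<le> \<bar>(\<mu> j - \<mu> k) - (\<mu> j + \<mu> k')\<bar>" for k k'
          using ge[of k] ge[of k'] g by simp
        show "\<gamma> \<le> \<bar>d i - d i'\<bar>"
          using i i' * by (cases i; cases i') (auto simp: d_def abs_minus_commute intro!: gap)
      qed (rule g)
      then have "(\<Sum>k\<in>F2. 1 / (4 * ((\<mu> j - \<mu> k) / \<gamma>)\<^sup>2 - 1)) + (\<Sum>k\<in>F. 1 / (4 * ((\<mu> j + \<mu> k) / \<gamma>)\<^sup>2 - 1)) \<le> 1 / 2"
        using F F12 by (simp add: sum.Plus d_def)
      then have "(8 * a / \<gamma>\<^sup>2) * ((\<Sum>k\<in>F2. 1 / (4 * ((\<mu> j - \<mu> k) / \<gamma>)\<^sup>2 - 1)) + (\<Sum>k\<in>F. 1 / (4 * ((\<mu> j + \<mu> k) / \<gamma>)\<^sup>2 - 1)))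
          \<le> (8 * a / \<gamma>\<^sup>2) * (1 / 2)"
        using a(1) by (intro mult_left_mono) auto
      then show ?thesis
        by (simp only: h_def sum_distrib_left distrib_left power_divide power2_abs)
    qed
    ultimately show ?thesis by simp
  qed
  have "\<bar>(\<Sum>j\<in>F. \<Sum>k\<in>F. T j k) - (1 / a) * (\<Sum>k\<in>F. r k)\<bar>
      = \<bar>\<Sum>j\<in>F. \<Sum>k\<in>F. (T j k - (if j = k then r k / a else 0))\<bar>"
    using F by (simp add: sum_subtractf sum_divide_distrib sum.delta')
  also have "\<dots> \<le> (\<Sum>j\<in>F. \<Sum>k\<in>F. (r j + r k) / 4 * N j k)"
    by (rule order_trans[OF sum_abs]) (intro sum_mono order_trans[OF sum_abs] T)
  also have "\<dots> = (\<Sum>j\<in>F. \<Sum>k\<in>F. r j / 4 * N j k) + (\<Sum>j\<in>F. \<Sum>k\<in>F. r k / 4 * N j k)"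
    by (simp add: sum.distrib[symmetric] add_divide_distrib distrib_right)
  also have "(\<Sum>j\<in>F. \<Sum>k\<in>F. r k / 4 * N j k) = (\<Sum>j\<in>F. \<Sum>k\<in>F. r j / 4 * N j k)"
    by (subst sum.swap) (simp add: Nsym)
  also have "(\<Sum>j\<in>F. \<Sum>k\<in>F. r j / 4 * N j k) + (\<Sum>j\<in>F. \<Sum>k\<in>F. r j / 4 * N j k)
      = (\<Sum>j\<in>F. r j / 2 * (\<Sum>k\<in>F. N j k))"
    by (simp add: sum.distrib[symmetric] sum_distrib_left sum_divide_distrib)
  also have "\<dots> \<le> (\<Sum>j\<in>F. r j / 2 * (8 * a / \<gamma>\<^sup>2))"
    by (intro sum_mono mult_left_mono Nsum) (simp add: r_def)
  also have "\<dots> = (4 * a / \<gamma>\<^sup>2) * (\<Sum>k\<in>F. r k)"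
    unfolding sum_distrib_left by (intro sum.cong refl) simp
  finally show ?thesis unfolding J r_def trig_energy_def .
qed

lemma abs_diff_le_imp:
  fixes x y z :: real
  assumes "\<bar>x - y\<bar> \<le> z" shows "y - z \<le> x" "x \<le> y + z"
  using assms by linarith+

text \<open>For the lower bound the weight on \<open>[-R, R]\<close> is at most 1. For the upper bound the weight of the
  doubled interval is used, which is at least \<open>1/2\<close> on \<open>[-R, R]\<close>.\<close>

lemma ingham_symmetric:
  fixes \<mu> :: "nat \<Rightarrow> real"
  assumes R: "R * \<gamma> > pi" and g: "\<gamma> > 0"
    and gap: "\<And>j k. j \<noteq> k \<Longrightarrow> \<bar>\<mu> j - \<mu> k\<bar> \<ge> \<gamma>" and ge: "\<And>k. \<mu> k \<ge> \<gamma>"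
  obtains c C where "c > 0" "C > 0"
    "\<And>F A B. finite F \<Longrightarrow> c * trig_energy F A B \<le> integral {-R..R} (\<lambda>t. (trig_sum F \<mu> A B t)\<^sup>2)"
    "\<And>F A B. finite F \<Longrightarrow> integral {-R..R} (\<lambda>t. (trig_sum F \<mu> A B t)\<^sup>2) \<le> C * trig_energy F A B"
proof -
  have R0: "R > 0" using R g pi_gt_zero by (metis less_trans zero_less_mult_pos2)
  define a where "a = pi / (2 * R)"
  define b where "b = a / 2"
  have a: "a > 0" "a * R = pi / 2" "2 * a < \<gamma>" using R0 R by (auto simp: a_def field_simps)
  have b: "b > 0" "b * (2 * R) = pi / 2" "2 * b < \<gamma>" using a by (auto simp: b_def)
  define c where "c = 1 / a - 4 * a / \<gamma>\<^sup>2"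
  define C where "C = 2 * (1 / b + 4 * b / \<gamma>\<^sup>2)"
  have "4 * a\<^sup>2 < \<gamma>\<^sup>2" using power_strict_mono[OF a(3), of 2] a(1) by (simp add: power_mult_distrib)
  then have c: "c > 0" using a g by (simp add: c_def field_simps power2_eq_square)
  have C: "C > 0" using b g by (simp add: C_def add_pos_nonneg)
  have int: "(\<lambda>t. (trig_sum F \<mu> A B t)\<^sup>2) integrable_on {x..y}"
    "(\<lambda>t. cos (z * t) * (trig_sum F \<mu> A B t)\<^sup>2) integrable_on {x..y}"
    "(\<lambda>t. 2 * (cos (z * t) * (trig_sum F \<mu> A B t)\<^sup>2)) integrable_on {x..y}" for F A B x y z
    by (intro integrable_continuous_interval continuous_intros continuous_on_trig_sum)+
  have "c * trig_energy F A B \<le> integral {-R..R} (\<lambda>t. (trig_sum F \<mu> A B t)\<^sup>2)" if F: "finite F" for F A B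
  proof -
    let ?r = "trig_energy F A B"
    have "c * ?r = (1 / a) * ?r - (4 * a / \<gamma>\<^sup>2) * ?r" by (simp add: c_def left_diff_distrib)
    also have "\<dots> \<le> integral {-R..R} (\<lambda>t. cos (a * t) * (trig_sum F \<mu> A B t)\<^sup>2)"
      by (rule abs_diff_le_imp(1)[OF ingham_weighted]) (use F a gap ge in auto)
    also have "\<dots> \<le> integral {-R..R} (\<lambda>t. (trig_sum F \<mu> A B t)\<^sup>2)"
    proof (intro integral_le int)
      fix t
      have "cos (a * t) * (trig_sum F \<mu> A B t)\<^sup>2 \<le> 1 * (trig_sum F \<mu> A B t)\<^sup>2"
        by (intro mult_right_mono) auto
      then show "cos (a * t) * (trig_sum F \<mu> A B t)\<^sup>2 \<le> (trig_sum F \<mu> A B t)\<^sup>2" by simp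
    qed
    finally show ?thesis .
  qed
  moreover have "integral {-R..R} (\<lambda>t. (trig_sum F \<mu> A B t)\<^sup>2) \<le> C * trig_energy F A B" if F: "finite F" for F A B
  proof -
    let ?r = "trig_energy F A B"
    have cosb: "cos (b * t) \<ge> 1 / 2" if "t \<in> {-R..R}" for t
    proof -
      have "\<bar>b * t\<bar> \<le> pi / 3"
      proof -
        have "\<bar>b * t\<bar> \<le> b * R" using that b(1) by (simp add: abs_mult abs_le_iff)
        also have "\<dots> = pi / 4" using b(2) by simp
        finally show ?thesis using pi_gt_zero by linarith
      qed
      then have "cos (pi / 3) \<le> cos \<bar>b * t\<bar>"
        using pi_gt_zero by (intro cos_monotone_0_pi_le) auto
      then show ?thesis by (simp add: cos_60)
    qed
    have nn: "0 \<le> cos (b * t)" if "t \<in> {-(2*R)..2*R}" for t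
    proof -
      have "\<bar>b * t\<bar> \<le> b * (2 * R)" using that b(1) by (simp add: abs_mult abs_le_iff)
      also have "\<dots> = pi / 2" by (rule b(2))
      finally show ?thesis by (intro cos_ge_zero) auto
    qed
    have "integral {-R..R} (\<lambda>t. (trig_sum F \<mu> A B t)\<^sup>2) \<le> integral {-R..R} (\<lambda>t. 2 * (cos (b * t) * (trig_sum F \<mu> A B t)\<^sup>2))"
    proof (intro integral_le int)
      fix t assume "t \<in> {-R..R}"
      then have "1 * (trig_sum F \<mu> A B t)\<^sup>2 \<le> (2 * cos (b * t)) * (trig_sum F \<mu> A B t)\<^sup>2"
        using cosb[of t] by (intro mult_right_mono) auto
      then show "(trig_sum F \<mu> A B t)\<^sup>2 \<le> 2 * (cos (b * t) * (trig_sum F \<mu> A B t)\<^sup>2)" by simp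
    qed
    also have "\<dots> = 2 * integral {-R..R} (\<lambda>t. cos (b * t) * (trig_sum F \<mu> A B t)\<^sup>2)" by simp
    also have "\<dots> \<le> 2 * integral {-(2*R)..2*R} (\<lambda>t. cos (b * t) * (trig_sum F \<mu> A B t)\<^sup>2)"
      using R0 nn by (intro mult_left_mono integral_subset_le int) auto
    also have "\<dots> \<le> 2 * ((1 / b) * ?r + (4 * b / \<gamma>\<^sup>2) * ?r)"
      by (intro mult_left_mono abs_diff_le_imp(2)[OF ingham_weighted]) (use F b gap ge in auto)
    also have "\<dots> = C * ?r" by (simp add: C_def algebra_simps)
    finally show ?thesis .
  qed
  ultimately show ?thesis using that c C by blast
qed

text \<open>Moving the interval to \<open>(0, T)\<close> rotates each pair of amplitudes and preserves the energy.\<close>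

theorem ingham:
  fixes \<mu> :: "nat \<Rightarrow> real"
  assumes T: "T * \<gamma> > 2 * pi" and g: "\<gamma> > 0"
    and gap: "\<And>j k. j \<noteq> k \<Longrightarrow> \<bar>\<mu> j - \<mu> k\<bar> \<ge> \<gamma>" and ge: "\<And>k. \<mu> k \<ge> \<gamma>"
  obtains c C where "c > 0" "C > 0"
    "\<And>F A B. finite F \<Longrightarrow> c * trig_energy F A B
        \<le> l2_normsq (restrict_space lborel {0<..<T}) (trig_sum F \<mu> A B)"
    "\<And>F A B. finite F \<Longrightarrow> l2_normsq (restrict_space lborel {0<..<T}) (trig_sum F \<mu> A B)
        \<le> C * trig_energy F A B"
proof -
  define R where "R = T / 2"
  have R: "R * \<gamma> > pi" using T by (simp add: R_def)
  obtain c C where cC: "c > 0" "C > 0"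
    "\<And>F A B. finite F \<Longrightarrow> c * trig_energy F A B \<le> integral {-R..R} (\<lambda>t. (trig_sum F \<mu> A B t)\<^sup>2)"
    "\<And>F A B. finite F \<Longrightarrow> integral {-R..R} (\<lambda>t. (trig_sum F \<mu> A B t)\<^sup>2) \<le> C * trig_energy F A B"
    by (rule ingham_symmetric[where \<mu> = \<mu>, OF R g], erule gap, rule ge, rule that)
  have eq: "l2_normsq (restrict_space lborel {0<..<T}) (trig_sum F \<mu> A B)
      = integral {-R..R} (\<lambda>t. (trig_sum F \<mu> (\<lambda>k. A k * cos (\<mu> k * R) + B k * sin (\<mu> k * R))
          (\<lambda>k. B k * cos (\<mu> k * R) - A k * sin (\<mu> k * R)) t)\<^sup>2)" for F and A B :: "nat \<Rightarrow> real"
  proof -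
    have "l2_normsq (restrict_space lborel {0<..<T}) (trig_sum F \<mu> A B)
        = integral {0..T} (\<lambda>t. (trig_sum F \<mu> A B t)\<^sup>2)"
      unfolding l2_normsq_def integral_restrict_lborel_Ioo
      by (subst set_borel_integral_eq_integral(2))
        (auto intro!: set_integrable_continuous_Ioo continuous_intros continuous_on_trig_sum simp: integral_open_interval_real)
    also have "\<dots> = integral {0 - R..T - R} (\<lambda>t. (trig_sum F \<mu> A B (t + R))\<^sup>2)"
      by (rule integral_shift_real_ivl[symmetric])
    also have "{0 - R..T - R} = {-R..R}" by (simp add: R_def)
    also have "(\<lambda>t. (trig_sum F \<mu> A B (t + R))\<^sup>2) = (\<lambda>t. (trig_sum F \<mu> (\<lambda>k. A k * cos (\<mu> k * R) + B k * sin (\<mu> k * R))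
          (\<lambda>k. B k * cos (\<mu> k * R) - A k * sin (\<mu> k * R)) t)\<^sup>2)"
    proof
      fix t
      have "trig_sum F \<mu> A B (t + R) = trig_sum F \<mu> (\<lambda>k. A k * cos (\<mu> k * R) + B k * sin (\<mu> k * R))
          (\<lambda>k. B k * cos (\<mu> k * R) - A k * sin (\<mu> k * R)) t"
        unfolding trig_sum_def
        by (intro sum.cong refl) (simp add: distrib_left cos_add sin_add algebra_simps)
      then show "(trig_sum F \<mu> A B (t + R))\<^sup>2 = (trig_sum F \<mu> (\<lambda>k. A k * cos (\<mu> k * R) + B k * sin (\<mu> k * R))
          (\<lambda>k. B k * cos (\<mu> k * R) - A k * sin (\<mu> k * R)) t)\<^sup>2" by simp
    qed
    finally show ?thesis .
  qed
  have rot: "(A k * cos x + B k * sin x)\<^sup>2 + (B k * cos x - A k * sin x)\<^sup>2 = (A k)\<^sup>2 + (B k)\<^sup>2" for A B :: "nat \<Rightarrow> real" and k :: nat and x :: real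
  proof -
    have "(A k * cos x + B k * sin x)\<^sup>2 + (B k * cos x - A k * sin x)\<^sup>2
        = ((A k)\<^sup>2 + (B k)\<^sup>2) * ((cos x)\<^sup>2 + (sin x)\<^sup>2)"
      by algebra
    then show ?thesis by simp
  qed
  show ?thesis
  proof (rule that[OF cC(1,2)])
    fix F :: "nat set" and A B :: "nat \<Rightarrow> real" assume F: "finite F"
    show "c * trig_energy F A B \<le> l2_normsq (restrict_space lborel {0<..<T}) (trig_sum F \<mu> A B)"
      using cC(3)[OF F, of "\<lambda>k. A k * cos (\<mu> k * R) + B k * sin (\<mu> k * R)" "\<lambda>k. B k * cos (\<mu> k * R) - A k * sin (\<mu> k * R)"]
      unfolding eq trig_energy_def rot .
    show "l2_normsq (restrict_space lborel {0<..<T}) (trig_sum F \<mu> A B) \<le> C * trig_energy F A B"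
      using cC(4)[OF F, of "\<lambda>k. A k * cos (\<mu> k * R) + B k * sin (\<mu> k * R)" "\<lambda>k. B k * cos (\<mu> k * R) - A k * sin (\<mu> k * R)"]
      unfolding eq trig_energy_def rot .
  qed
qed

section \<open>Solutions as eigenfunction series\<close>

lemma continuous_eq_if_AE_eq:
  fixes f g :: "real \<Rightarrow> real"
  assumes c: "continuous_on {0..1} f" "continuous_on {0..1} g"
    and AE: "AE x in interval_measure01. f x = g x" and x: "0 \<le> x" "x \<le> 1"
  shows "f x = g x"
proof -
  let ?d = "\<lambda>x. (f x - g x)\<^sup>2"
  have cd: "continuous_on {0..1} ?d" by (intro continuous_intros c)
  have "(\<integral>x. ?d x \<partial>interval_measure01) = 0"
    using AE by (intro integral_eq_zero_AE) auto
  then have "(LINT x:{0<..<1}|lborel. ?d x) = 0"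
    by (simp add: interval_measure01_def integral_restrict_lborel_Ioo)
  then have "integral {0<..<1} ?d = 0"
    using set_borel_integral_eq_integral(2)[OF set_integrable_continuous_Ioo[OF cd]] by simp
  then have "integral {0..1} ?d = 0" by (simp add: integral_open_interval_real)
  then have "\<forall>x\<in>{0..1}. ?d x = 0"
    using integral_eq_0_iff[OF cd] by auto
  then show ?thesis using x by auto
qed

text \<open>The amplitudes \<open>a cos - (b/\<mu>) sin\<close> and \<open>a sin + (b/\<mu>) cos\<close> in the rotating frame are conserved.\<close>

lemma harmonic_oscillator:
  fixes a b :: "real \<Rightarrow> real"
  assumes T: "T > 0" and \<mu>: "\<mu> > 0"
    and a: "\<And>t. t \<in> {0..T} \<Longrightarrow> (a has_real_derivative b t) (at t within {0..T})"
    and b: "\<And>t. t \<in> {0..T} \<Longrightarrow> (b has_real_derivative - \<mu>\<^sup>2 * a t) (at t within {0..T})"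
    and t: "t \<in> {0..T}"
  shows "a t = a 0 * cos (\<mu> * t) + b 0 / \<mu> * sin (\<mu> * t)"
proof -
  have c: "((\<lambda>t. cos (\<mu> * t)) has_real_derivative - \<mu> * sin (\<mu> * t)) (at t within {0..T})"
    and s: "((\<lambda>t. sin (\<mu> * t)) has_real_derivative \<mu> * cos (\<mu> * t)) (at t within {0..T})" for t
    by (auto intro!: derivative_eq_intros)
  define P where "P = (\<lambda>t. a t * cos (\<mu> * t) - b t / \<mu> * sin (\<mu> * t))"
  define Q where "Q = (\<lambda>t. a t * sin (\<mu> * t) + b t / \<mu> * cos (\<mu> * t))"
  have "(P has_real_derivative 0) (at t within {0..T})" "(Q has_real_derivative 0) (at t within {0..T})"
    if t: "t \<in> {0..T}" for t
  proof -
    have "(P has_real_derivative (b t * cos (\<mu> * t) + - \<mu> * sin (\<mu> * t) * a t)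
        - ((- \<mu>\<^sup>2 * a t) / \<mu> * sin (\<mu> * t) + \<mu> * cos (\<mu> * t) * (b t / \<mu>))) (at t within {0..T})"
      unfolding P_def by (intro DERIV_diff DERIV_mult DERIV_cdivide a b c s t)
    then show "(P has_real_derivative 0) (at t within {0..T})"
      using \<mu> by (simp add: power2_eq_square)
    have "(Q has_real_derivative (b t * sin (\<mu> * t) + \<mu> * cos (\<mu> * t) * a t)
        + ((- \<mu>\<^sup>2 * a t) / \<mu> * cos (\<mu> * t) + - \<mu> * sin (\<mu> * t) * (b t / \<mu>))) (at t within {0..T})"
      unfolding Q_def by (intro DERIV_add DERIV_mult DERIV_cdivide a b c s t)
    then show "(Q has_real_derivative 0) (at t within {0..T})"
      using \<mu> by (simp add: power2_eq_square)
  qed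
  then obtain cp cq where "\<forall>x\<in>{0..T}. P x = cp" "\<forall>x\<in>{0..T}. Q x = cq"
    by (metis has_field_derivative_zero_constant[of "{0..T}"] convex_real_interval(5))
  then have PQ: "P t = P 0" "Q t = Q 0" using t T by auto
  have "P t * cos (\<mu> * t) + Q t * sin (\<mu> * t) = a t * ((cos (\<mu> * t))\<^sup>2 + (sin (\<mu> * t))\<^sup>2)"
    unfolding P_def Q_def by algebra
  then have "a t = P t * cos (\<mu> * t) + Q t * sin (\<mu> * t)" by simp
  then show ?thesis unfolding PQ by (simp add: P_def Q_def)
qed

context wave_basis
begin

definition coeffA :: "(real \<Rightarrow> real) \<Rightarrow> nat \<Rightarrow> real" where
  "coeffA u0 k = l2_inner W u0 (\<Phi> k)"

definition coeffB :: "(real \<Rightarrow> real) \<Rightarrow> nat \<Rightarrow> real" where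
  "coeffB u1 k = l2_inner W u1 (\<Phi> k) / freq k"

definition osc :: "(nat \<Rightarrow> real) \<Rightarrow> (nat \<Rightarrow> real) \<Rightarrow> nat \<Rightarrow> real \<Rightarrow> real" where
  "osc A B k t = A k * cos (freq k * t) + B k * sin (freq k * t)"

lemma osc_sq_le: "(osc A B k t)\<^sup>2 \<le> (A k)\<^sup>2 + (B k)\<^sup>2"
proof -
  let ?c = "cos (freq k * t)" and ?s = "sin (freq k * t)"
  have "(osc A B k t)\<^sup>2 + (A k * ?s - B k * ?c)\<^sup>2 = ((A k)\<^sup>2 + (B k)\<^sup>2) * (?c\<^sup>2 + ?s\<^sup>2)"
    unfolding osc_def by algebra
  then have "(A k)\<^sup>2 + (B k)\<^sup>2 = (osc A B k t)\<^sup>2 + (A k * ?s - B k * ?c)\<^sup>2" by simp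
  then show ?thesis by (simp only: le_add_same_cancel1 zero_le_power2)
qed

lemma trig_sum_osc: "trig_sum F freq (\<lambda>k. c k * A k) (\<lambda>k. c k * B k) t = (\<Sum>k\<in>F. osc A B k t * c k)"
  unfolding trig_sum_def osc_def by (intro sum.cong refl) (simp add: algebra_simps)

text \<open>Testing the weak equation with an eigenfunction decouples it: the coefficients of \<open>u\<close> and of its
  time derivative solve a harmonic oscillator.\<close>

lemma solution_coefficients:
  assumes T: "T > 0" and u0: "square_integrable W u0" and u1: "square_integrable W u1"
    and sol: "wave_solution (2 - \<beta>) T u0 u1 u" and t: "t \<in> {0..T}"
  shows "l2_inner W (\<lambda>x. u x t) (\<Phi> k) = osc (coeffA u0) (coeffB u1) k t"
proof -
  obtain ux ut where H: "\<And>t. t \<in> {0..T} \<Longrightarrow> H10_deriv (\<lambda>x. u x t) (\<lambda>x. ux x t)"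
    and ut: "\<And>t. t \<in> {0..T} \<Longrightarrow> square_integrable W (\<lambda>x. ut x t)"
    and du: "\<And>t. t \<in> {0..T} \<Longrightarrow> ((\<lambda>s. l2_normsq W (\<lambda>x. (u x s - u x t) / (s - t) - ut x t)) \<longlongrightarrow> 0) (at t within {0..T})"
    and dut: "\<And>t w dw. t \<in> {0..T} \<Longrightarrow> H10_deriv w dw \<Longrightarrow>
      ((\<lambda>s. l2_inner W (\<lambda>x. ut x s) w) has_real_derivative - l2_inner I (\<lambda>x. ux x t) dw) (at t within {0..T})"
    and i0: "AE x in W. u x 0 = u0 x" and i1: "AE x in W. ut x 0 = u1 x"
    using sol unfolding wave_solution_def by blast
  have us: "square_integrable W (\<lambda>x. u x t)" if "t \<in> {0..T}" for t
    by (rule H10_square_integrable_weighted[OF _ H[OF that]]) (use b0 in simp)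
  define a where "a t = l2_inner W (\<lambda>x. u x t) (\<Phi> k)" for t
  define b where "b t = l2_inner W (\<lambda>x. ut x t) (\<Phi> k)" for t
  have a': "(a has_real_derivative b t) (at t within {0..T})" if t: "t \<in> {0..T}" for t
  proof -
    let ?q = "\<lambda>s x. (u x s - u x t) / (s - t) - ut x t"
    have "((\<lambda>s. (a s - a t) / (s - t) - b t) \<longlongrightarrow> 0) (at t within {0..T})"
    proof (rule tendsto_rabs_zero_cancel, rule tendsto_sandwich)
      show "eventually (\<lambda>s. 0 \<le> \<bar>(a s - a t) / (s - t) - b t\<bar>) (at t within {0..T})" by simp
      show "eventually (\<lambda>s. \<bar>(a s - a t) / (s - t) - b t\<bar> \<le> sqrt (l2_normsq W (?q s))) (at t within {0..T})"
        unfolding eventually_at_filter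
      proof (rule always_eventually, intro allI impI)
        fix s assume s: "s \<in> {0..T}" "s \<noteq> t"
        have q: "?q s = (\<lambda>x. (1 / (s - t)) * (u x s - u x t) - ut x t)" by (simp add: fun_eq_iff)
        have qs: "square_integrable W (?q s)"
          unfolding q by (intro square_integrable_diff square_integrable_scale us ut s t)
        have "l2_inner W (?q s) (\<Phi> k) = (1 / (s - t)) * (a s - a t) - b t"
          unfolding q a_def b_def
          by (subst l2_inner_diff_left | subst l2_inner_scale_left
              | (intro square_integrable_diff square_integrable_scale us ut s t \<Phi>_square_integrable) | simp)+
        then have "\<bar>(a s - a t) / (s - t) - b t\<bar> \<le> sqrt (l2_normsq W (?q s)) * sqrt (l2_normsq W (\<Phi> k))"
          using l2_abs_inner_le[OF qs \<Phi>_square_integrable[of k]] by simp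
        then show "\<bar>(a s - a t) / (s - t) - b t\<bar> \<le> sqrt (l2_normsq W (?q s))"
          by (simp add: l2_normsq_eq_inner[of _ "\<Phi> k"] \<Phi>_inner)
      qed
      show "((\<lambda>s. 0) \<longlongrightarrow> (0::real)) (at t within {0..T})" by simp
      show "((\<lambda>s. sqrt (l2_normsq W (?q s))) \<longlongrightarrow> 0) (at t within {0..T})"
        using tendsto_real_sqrt[OF du[OF t]] by simp
    qed
    then show ?thesis unfolding has_field_derivative_iff by (simp add: LIM_zero_iff)
  qed
  have b': "(b has_real_derivative - (freq k)\<^sup>2 * a t) (at t within {0..T})" if t: "t \<in> {0..T}" for t
  proof -
    have "l2_inner I (\<lambda>x. ux x t) (d\<Phi> k) = lam k * a t"
      using \<Phi>_integration_by_parts[OF H[OF t], of k] by (simp add: a_def l2_inner_commute)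
    then show ?thesis using dut[OF t \<Phi>_H10[of k]] by (simp add: b_def[abs_def] freq_sq)
  qed
  have 0: "0 \<in> {0..T}" using T by simp
  have "a 0 = coeffA u0 k"
    unfolding a_def coeffA_def l2_inner_def
    using i0 us[OF 0] u0 \<Phi>_square_integrable[of k]
    by (intro integral_cong_AE) (auto simp: square_integrable_def)
  moreover have "b 0 / freq k = coeffB u1 k"
  proof -
    have "b 0 = l2_inner W u1 (\<Phi> k)"
      unfolding b_def l2_inner_def
      using i1 ut[OF 0] u1 \<Phi>_square_integrable[of k]
      by (intro integral_cong_AE) (auto simp: square_integrable_def)
    then show ?thesis by (simp add: coeffB_def)
  qed
  ultimately show ?thesis
    using harmonic_oscillator[OF T freq_pos[of k] a' b' t] by (simp add: a_def osc_def)
qed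

text \<open>Gradients of eigenfunctions are orthogonal, so partial sums of the expansion of a function
  with square summable gradient coefficients converge uniformly; completeness in the weighted
  \<open>L\<^sup>2\<close> space identifies their limit.\<close>

lemma H10_eigenfunction_series:
  assumes v: "H10_deriv v dv"
    and sm: "summable (\<lambda>k. (l2_inner W v (\<Phi> k))\<^sup>2 * lam k)" and x: "0 \<le> x" "x \<le> 1"
  shows "(\<lambda>n. \<Sum>k<n. l2_inner W v (\<Phi> k) * \<Phi> k x) \<longlonglongrightarrow> v x"
proof -
  define c where "c k = l2_inner W v (\<Phi> k)" for k
  define S where "S n x = (\<Sum>k<n. c k * \<Phi> k x)" for n x
  have bd: "(S m x - S n x)\<^sup>2 \<le> (\<Sum>k\<in>{n..<m}. (c k)\<^sup>2 * lam k)" if "n \<le> m" "0 \<le> x" "x \<le> 1" for n m x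
  proof -
    have "S m x - S n x = (\<Sum>k\<in>{n..<m}. c k * \<Phi> k x)"
    proof -
      have "{..<m} - {..<n} = {n..<m}" by auto
      then show ?thesis unfolding S_def using that(1) sum_diff[of "{..<m}" "{..<n}" "\<lambda>k. c k * \<Phi> k x"] by simp
    qed
    also have "(\<dots>)\<^sup>2 \<le> x * l2_normsq I (\<lambda>x. \<Sum>k\<in>{n..<m}. c k * d\<Phi> k x)"
      by (rule H10_pointwise_bound[OF H10_sum[OF \<Phi>_H10] that(2,3)])
    also have "l2_normsq I (\<lambda>x. \<Sum>k\<in>{n..<m}. c k * d\<Phi> k x) = (\<Sum>k\<in>{n..<m}. (c k)\<^sup>2 * lam k)"
      by (rule l2_normsq_orthogonal_sum) (auto simp: d\<Phi>_square_integrable d\<Phi>_inner)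
    also have "x * \<dots> \<le> 1 * \<dots>"
      using that lam_pos by (intro mult_right_mono sum_nonneg mult_nonneg_nonneg) (auto simp: less_imp_le)
    finally show ?thesis by simp
  qed
  have "uniformly_Cauchy_on {0..1} S"
    unfolding uniformly_Cauchy_on_def
  proof (intro allI impI)
    fix e :: real assume e: "e > 0"
    obtain N where N: "\<And>m n. m \<ge> N \<Longrightarrow> norm (\<Sum>k\<in>{m..<n}. (c k)\<^sup>2 * lam k) < e\<^sup>2"
      using sm e unfolding c_def[symmetric] summable_Cauchy by (meson zero_less_power)
    have "dist (S m x) (S n x) < e" if "n \<ge> N" "n \<le> m" "x \<in> {0..1}" for m n x
    proof -
      have "(S m x - S n x)\<^sup>2 < e\<^sup>2"
        using bd[of n m x] N[of n m] that by (auto simp: abs_less_iff)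
      then show ?thesis using e power_less_imp_less_base[of "\<bar>S m x - S n x\<bar>" 2 e]
        by (simp add: dist_real_def)
    qed
    then show "\<exists>N. \<forall>x\<in>{0..1}. \<forall>m\<ge>N. \<forall>n\<ge>N. dist (S m x) (S n x) < e"
      by (intro exI[of _ N]) (metis dist_commute nle_le)
  qed
  then obtain L where L: "uniform_limit {0..1} S L sequentially"
    using uniformly_convergent_eq_Cauchy[of "{0..1}" S] uniformly_convergent_on_def by blast
  have cS: "continuous_on {0..1} (S n)" for n
    unfolding S_def by (intro continuous_intros H10_continuous[OF \<Phi>_H10])
  have cL: "continuous_on {0..1} L"
    by (rule uniform_limit_theorem[OF _ L]) (auto intro: always_eventually cS)
  have lim: "(\<lambda>n. S n x) \<longlonglongrightarrow> L x" if "x \<in> {0..1}" for x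
    by (rule tendsto_uniform_limitI[OF L that])
  have vs: "square_integrable W v"
    by (rule H10_square_integrable_weighted[OF _ v]) (use b0 in simp)
  have Ss: "square_integrable W (S n)" for n
    unfolding S_def by (intro square_integrable_sum square_integrable_scale \<Phi>_square_integrable)
  have conv: "(\<lambda>n. l2_normsq W (\<lambda>x. S n x - v x)) \<longlonglongrightarrow> 0"
  proof -
    have "(\<lambda>n. l2_normsq W (\<lambda>x. v x - S n x)) \<longlonglongrightarrow> 0"
      using orthonormal vs by (simp add: orthonormal_basis_def S_def c_def)
    then show ?thesis by (simp add: l2_normsq_def power2_commute)
  qed
  have Lm: "L \<in> borel_measurable W"
    using measurable_continuous_interval_measure01[OF cL] by simp
  have AElim: "AE x in W. (\<lambda>n. S n x) \<longlonglongrightarrow> L x" by (rule AE_I2) (simp add: lim)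
  have le: "l2_normsq W (\<lambda>x. L x - v x) \<le> e" if "e > 0" for e
  proof (rule l2_AE_limit(2)[OF Ss Lm AElim vs])
    show "eventually (\<lambda>i. l2_normsq W (\<lambda>x. S i x - v x) \<le> e) sequentially"
      using order_tendstoD(2)[OF conv that] by eventually_elim simp
  qed
  have "square_integrable W L"
    by (rule l2_AE_limit(1)[OF Ss Lm AElim vs, of 1])
      (use order_tendstoD(2)[OF conv zero_less_one] in \<open>auto elim: eventually_mono\<close>)
  then have d: "square_integrable W (\<lambda>x. L x - v x)" by (intro square_integrable_diff vs)
  have "l2_normsq W (\<lambda>x. L x - v x) = 0"
    using field_le_epsilon[of "l2_normsq W (\<lambda>x. L x - v x)" 0] le l2_normsq_nonneg by (simp add: order_antisym)
  then have "AE x in W. (L x - v x)\<^sup>2 = 0"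
    using d unfolding l2_normsq_def square_integrable_def
    by (subst (asm) integral_nonneg_eq_0_iff_AE) auto
  then have "AE x in I. L x = v x" by (simp add: AE_weighted_measure)
  then have "L x = v x"
    by (rule continuous_eq_if_AE_eq[OF cL H10_continuous[OF v]]) fact+
  then show ?thesis using lim[of x] x by (simp add: S_def c_def)
qed

lemma energy_summable:
  assumes u0: "u0 \<in> Hs_space (2 - \<beta>) \<Phi> lam p" and u1: "u1 \<in> Hs_space (2 - \<beta>) \<Phi> lam (p - 1)"
  shows "summable (\<lambda>k. ((coeffA u0 k)\<^sup>2 + (coeffB u1 k)\<^sup>2) * lam k powr p)"
    and "wave_energy (2 - \<beta>) \<Phi> lam (p - 1 / 2) u0 u1
      = (\<Sum>k. ((coeffA u0 k)\<^sup>2 + (coeffB u1 k)\<^sup>2) * lam k powr p)"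
proof -
  have B: "(coeffB u1 k)\<^sup>2 * lam k powr p = (l2_inner W u1 (\<Phi> k))\<^sup>2 * lam k powr (p - 1)" for k
    using lam_pos[of k] powr_mult_base[of "lam k" "p - 1"]
    by (simp add: coeffB_def power_divide freq_sq field_simps)
  have s: "summable (\<lambda>k. (coeffA u0 k)\<^sup>2 * lam k powr p)" "summable (\<lambda>k. (coeffB u1 k)\<^sup>2 * lam k powr p)"
    using u0 u1 unfolding B by (auto simp: Hs_space_def coeffA_def)
  show "summable (\<lambda>k. ((coeffA u0 k)\<^sup>2 + (coeffB u1 k)\<^sup>2) * lam k powr p)"
    using summable_add[OF s] by (simp add: distrib_right)
  show "wave_energy (2 - \<beta>) \<Phi> lam (p - 1 / 2) u0 u1
      = (\<Sum>k. ((coeffA u0 k)\<^sup>2 + (coeffB u1 k)\<^sup>2) * lam k powr p)"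
    using suminf_add[OF s] B by (simp add: wave_energy_def Hs_normsq_def coeffA_def distrib_right)
qed

text \<open>The exponent \<open>p = \<nu> + 1/2\<close> exceeds 1, so data with finite energy of index \<open>\<nu>\<close> have square
  summable gradient coefficients.\<close>

lemma lam_powr_ge:
  obtains K where "K > 0" "\<And>k. lam k \<le> K * lam k powr p"
proof -
  define l0 where "l0 = (\<beta> / 2 * pi)\<^sup>2"
  have l0: "l0 > 0" using b0 by (simp add: l0_def)
  have "lam k \<le> (1 / l0 powr (p - 1)) * lam k powr p" for k
  proof -
    have "l0 \<le> lam k"
    proof -
      have "(\<beta> / 2 * pi)\<^sup>2 \<le> (freq k)\<^sup>2" by (rule power_mono[OF freq_ge]) (use b0 in simp)
      then show ?thesis by (simp only: l0_def freq_sq)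
    qed
    then have "l0 powr (p - 1) \<le> lam k powr (p - 1)"
      using l0 p_gt_1 by (intro powr_mono2) auto
    then have "lam k * l0 powr (p - 1) \<le> lam k * lam k powr (p - 1)"
      using lam_pos[of k] by (intro mult_left_mono) auto
    also have "\<dots> = lam k powr p" using powr_mult_base[of "lam k" "p - 1"] lam_pos[of k] by simp
    finally show ?thesis using l0 by (simp add: field_simps)
  qed
  then show ?thesis using that[of "1 / l0 powr (p - 1)"] l0 by simp
qed

lemma summable_lam:
  assumes "summable (\<lambda>k. ((A k)\<^sup>2 + (B k)\<^sup>2) * lam k powr p)"
  shows "summable (\<lambda>k. ((A k)\<^sup>2 + (B k)\<^sup>2) * lam k)"
proof -
  obtain K where K: "K > 0" "\<And>k. lam k \<le> K * lam k powr p" using lam_powr_ge by blast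
  show ?thesis
  proof (rule summable_comparison_test'[OF summable_mult[OF assms, of K]])
    fix k
    have "((A k)\<^sup>2 + (B k)\<^sup>2) * lam k \<le> ((A k)\<^sup>2 + (B k)\<^sup>2) * (K * lam k powr p)"
      by (intro mult_left_mono K) auto
    then show "norm (((A k)\<^sup>2 + (B k)\<^sup>2) * lam k) \<le> K * (((A k)\<^sup>2 + (B k)\<^sup>2) * lam k powr p)"
      using lam_pos[of k] by (simp add: mult_ac)
  qed
qed

lemma solution_series:
  assumes T: "T > 0" and u0: "u0 \<in> Hs_space (2 - \<beta>) \<Phi> lam p" and u1: "u1 \<in> Hs_space (2 - \<beta>) \<Phi> lam (p - 1)"
    and sol: "wave_solution (2 - \<beta>) T u0 u1 u" and t: "t \<in> {0..T}" and x: "0 \<le> x" "x \<le> 1"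
  shows "(\<lambda>n. \<Sum>k<n. osc (coeffA u0) (coeffB u1) k t * \<Phi> k x) \<longlonglongrightarrow> u x t"
proof -
  have sq: "square_integrable W u0" "square_integrable W u1" using u0 u1 by (auto simp: Hs_space_def)
  have c: "l2_inner W (\<lambda>x. u x t) (\<Phi> k) = osc (coeffA u0) (coeffB u1) k t" for k
    by (rule solution_coefficients[OF T sq sol t])
  obtain ux where v: "H10_deriv (\<lambda>x. u x t) (\<lambda>x. ux x t)"
    using sol t unfolding wave_solution_def by blast
  have sm: "summable (\<lambda>k. (osc (coeffA u0) (coeffB u1) k t)\<^sup>2 * lam k)"
  proof (rule summable_comparison_test'[OF summable_lam[OF energy_summable(1)[OF u0 u1]]])
    fix k
    show "norm ((osc (coeffA u0) (coeffB u1) k t)\<^sup>2 * lam k) \<le> ((coeffA u0 k)\<^sup>2 + (coeffB u1 k)\<^sup>2) * lam k"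
      using lam_pos[of k] osc_sq_le by (simp add: mult_right_mono)
  qed
  show ?thesis using H10_eigenfunction_series[OF v _ x] sm by (simp add: c)
qed

end

section \<open>The trace at the degenerate end\<close>

definition series_tail :: "(nat \<Rightarrow> real) \<Rightarrow> nat \<Rightarrow> real" where
  "series_tail f n = suminf f - sum f {..<n}"

lemma series_tail_bound:
  assumes "summable f" "\<And>k. f k \<ge> 0" "n \<le> m"
  shows "sum f {n..<m} \<le> series_tail f n"
proof -
  have "{..<m} - {..<n} = {n..<m}" by auto
  then have "sum f {n..<m} = sum f {..<m} - sum f {..<n}"
    using assms(3) sum_diff[of "{..<m}" "{..<n}" f] by simp
  then show ?thesis using sum_le_suminf[OF assms(1), of "{..<m}"] assms(2) by (simp add: series_tail_def)
qed

lemma series_tail_tendsto: "summable f \<Longrightarrow> series_tail f \<longlonglongrightarrow> 0"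
  unfolding series_tail_def[abs_def]
  using tendsto_diff[OF tendsto_const summable_LIMSEQ, of f "suminf f"] by simp

lemma series_tail_nonneg: "summable f \<Longrightarrow> (\<And>k. f k \<ge> 0) \<Longrightarrow> series_tail f n \<ge> 0"
  using series_tail_bound[of f n n] by simp

lemma l2_normsq_I_truncated:
  assumes f: "square_integrable interval_measure01 f" and h: "0 \<le> h" "h \<le> 1"
  shows "(\<integral>y. f y * indicator {..<h} y \<partial>interval_measure01)\<^sup>2
    \<le> h * (\<integral>y. (f y)\<^sup>2 * indicator {..<h} y \<partial>interval_measure01)"
    and "integrable interval_measure01 (\<lambda>y. (f y)\<^sup>2 * indicator {..<h} y)"
proof -
  let ?M = interval_measure01 and ?i = "indicator {..<h} :: real \<Rightarrow> real"
  interpret finite_measure ?M by (rule finite_measure_interval_measure01)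
  have i2: "(?i y)\<^sup>2 = ?i y" for y by (simp add: indicator_def)
  have fm: "f \<in> borel_measurable ?M" using f by (simp add: square_integrable_def)
  show int: "integrable ?M (\<lambda>y. (f y)\<^sup>2 * ?i y)"
    by (rule integrable_times_indicator_I01) (use f in \<open>simp add: square_integrable_def\<close>)
  have fi: "square_integrable ?M (\<lambda>y. f y * ?i y)"
    unfolding square_integrable_def power_mult_distrib i2
    by (intro conjI int borel_measurable_times fm indicator_measurable_I01)
  have i: "square_integrable ?M ?i"
    unfolding square_integrable_def i2
    using integrable_times_indicator_I01[of "\<lambda>_. 1" h] by (simp add: indicator_measurable_I01)
  have "l2_normsq ?M ?i = (\<integral>y. 1 * ?i y \<partial>?M)" by (simp add: l2_normsq_def i2)
  also have "\<dots> = (LINT y:{0<..<h}|lborel. 1)" using h by (simp only: integral_Ioo_sub_I01)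
  also have "\<dots> = h" using h by (simp add: set_lebesgue_integral_def)
  finally have "l2_normsq ?M ?i = h" .
  moreover have "l2_inner ?M (\<lambda>y. f y * ?i y) ?i = (\<integral>y. f y * ?i y \<partial>?M)"
    unfolding l2_inner_def by (intro Bochner_Integration.integral_cong) (auto simp: indicator_def)
  moreover have "l2_normsq ?M (\<lambda>y. f y * ?i y) = (\<integral>y. (f y)\<^sup>2 * ?i y \<partial>?M)"
    by (simp add: l2_normsq_def power_mult_distrib i2)
  ultimately show "(\<integral>y. f y * ?i y \<partial>?M)\<^sup>2 \<le> h * (\<integral>y. (f y)\<^sup>2 * ?i y \<partial>?M)"
    using l2_Cauchy_Schwarz[OF fi i] by (simp add: mult.commute)
qed

text \<open>Averaging over \<open>0 < x < h\<close> turns the essential limit of \<open>\<partial>\<^sub>x u(x, \<cdot>)\<close> into a limit of the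
  difference quotients \<open>u(h, \<cdot>)/h\<close>, which are the same for every choice of the weak derivative.\<close>

lemma trace_difference_quotient:
  assumes tr: "dx_trace_at_0 T u g" and e: "\<epsilon> > 0"
  obtains \<delta> where "\<delta> > 0" "\<And>h. 0 < h \<Longrightarrow> h < \<delta> \<Longrightarrow> h \<le> 1 \<Longrightarrow>
    (\<integral>\<^sup>+t. ennreal ((u h t / h - g t)\<^sup>2) \<partial>restrict_space lborel {0<..<T}) \<le> ennreal \<epsilon>"
proof -
  let ?I = interval_measure01 and ?M = "restrict_space lborel {0<..<T}"
  interpret I: finite_measure ?I by (rule finite_measure_interval_measure01)
  interpret M: finite_measure ?M by (rule finite_measure_restrict_lborel_Ioo)
  interpret P: pair_sigma_finite ?I ?M ..
  obtain ux where g: "square_integrable ?M g"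
    and uxm: "(\<lambda>(x, t). ux x t) \<in> borel_measurable (borel \<Otimes>\<^sub>M borel)"
    and H: "AE t in ?M. H10_deriv (\<lambda>x. u x t) (\<lambda>x. ux x t)"
    and lim: "\<And>\<epsilon>. \<epsilon> > 0 \<Longrightarrow> \<exists>\<delta>>0. AE x in lborel. 0 < x \<and> x < \<delta> \<longrightarrow>
           (\<integral>\<^sup>+t. ennreal ((ux x t - g t)\<^sup>2) \<partial>?M) \<le> ennreal \<epsilon>"
    using tr unfolding dx_trace_at_0_def AE_restrict_lborel_Ioo by blast
  obtain \<delta> where d: "\<delta> > 0" "AE x in lborel. 0 < x \<and> x < \<delta> \<longrightarrow>
           (\<integral>\<^sup>+t. ennreal ((ux x t - g t)\<^sup>2) \<partial>?M) \<le> ennreal \<epsilon>" using lim[OF e] by blast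
  have gm[measurable]: "g \<in> borel_measurable ?M" using g by (simp add: square_integrable_def)
  have idI: "(\<lambda>x. x) \<in> measurable ?I borel" by (intro measurable_interval_measure01) measurable
  have idM: "(\<lambda>x. x) \<in> measurable ?M borel" by (intro measurable_restrict_space1) measurable
  have fs: "fst \<in> measurable (?I \<Otimes>\<^sub>M ?M) borel" "snd \<in> measurable (?I \<Otimes>\<^sub>M ?M) borel"
    using measurable_compose[OF measurable_fst idI] measurable_compose[OF measurable_snd idM] by auto
  have [measurable]: "(\<lambda>z. ux (fst z) (snd z)) \<in> borel_measurable (?I \<Otimes>\<^sub>M ?M)"
    using measurable_compose[OF measurable_Pair[OF fs] uxm] by simp
  have [measurable]: "(\<lambda>z. g (snd z)) \<in> borel_measurable (?I \<Otimes>\<^sub>M ?M)"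
    by (rule measurable_compose[OF measurable_snd gm])
  have "(\<integral>\<^sup>+t. ennreal ((u h t / h - g t)\<^sup>2) \<partial>?M) \<le> ennreal \<epsilon>" if h: "0 < h" "h < \<delta>" "h \<le> 1" for h
  proof -
    let ?i = "indicator {..<h} :: real \<Rightarrow> real"
    have [measurable]: "(\<lambda>z. ?i (fst z)) \<in> borel_measurable (?I \<Otimes>\<^sub>M ?M)"
      by (rule measurable_compose[OF measurable_fst indicator_measurable_I01(1)])
    have "AE t in ?M. ennreal ((u h t / h - g t)\<^sup>2) \<le> (\<integral>\<^sup>+y. ennreal (1 / h * ((ux y t - g t)\<^sup>2 * ?i y)) \<partial>?I)"
      using H
    proof eventually_elim
      fix t assume v: "H10_deriv (\<lambda>x. u x t) (\<lambda>x. ux x t)"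
      have c: "square_integrable ?I (\<lambda>y. g t)" by (simp add: square_integrable_def)
      have f: "square_integrable ?I (\<lambda>y. ux y t - g t)"
        using v by (intro square_integrable_diff c) (simp add: H10_deriv_def)
      have one: "(\<integral>y. ?i y \<partial>?I) = h"
      proof -
        have "(\<integral>y. 1 * ?i y \<partial>?I) = (LINT y:{0<..<h}|lborel. 1)" using h by (simp only: integral_Ioo_sub_I01)
        then show ?thesis using h by (simp add: set_lebesgue_integral_def)
      qed
      have "(\<integral>y. (ux y t - g t) * ?i y \<partial>?I) = (\<integral>y. ux y t * ?i y - g t * ?i y \<partial>?I)"
        by (simp add: left_diff_distrib)
      also have "\<dots> = (\<integral>y. ux y t * ?i y \<partial>?I) - (\<integral>y. g t * ?i y \<partial>?I)"
        by (intro Bochner_Integration.integral_diff integrable_times_indicator_I01 H10_deriv_integrable[OF v]) simp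
      also have "(\<integral>y. ux y t * ?i y \<partial>?I) = u h t" using H10_deriv_eq[OF v, of h] h by simp
      also have "(\<integral>y. g t * ?i y \<partial>?I) = g t * h" by (simp only: integral_mult_right_zero one)
      finally have "(u h t - g t * h)\<^sup>2 \<le> h * (\<integral>y. (ux y t - g t)\<^sup>2 * ?i y \<partial>?I)"
        using l2_normsq_I_truncated(1)[OF f, of h] h by simp
      then have "(u h t - g t * h)\<^sup>2 / h\<^sup>2 \<le> h * (\<integral>y. (ux y t - g t)\<^sup>2 * ?i y \<partial>?I) / h\<^sup>2"
        by (intro divide_right_mono) auto
      also have "(u h t - g t * h)\<^sup>2 / h\<^sup>2 = (u h t / h - g t)\<^sup>2"
        using h by (simp add: power_divide[symmetric] diff_divide_distrib)
      also have "h * (\<integral>y. (ux y t - g t)\<^sup>2 * ?i y \<partial>?I) / h\<^sup>2 = (\<integral>y. 1 / h * ((ux y t - g t)\<^sup>2 * ?i y) \<partial>?I)"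
        using h by (simp add: power2_eq_square)
      finally have "ennreal ((u h t / h - g t)\<^sup>2) \<le> ennreal (\<integral>y. 1 / h * ((ux y t - g t)\<^sup>2 * ?i y) \<partial>?I)"
        by (rule ennreal_leI)
      also have "\<dots> = (\<integral>\<^sup>+y. ennreal (1 / h * ((ux y t - g t)\<^sup>2 * ?i y)) \<partial>?I)"
        using h by (intro nn_integral_eq_integral[symmetric] integrable_mult_right l2_normsq_I_truncated(2) f) auto
      finally show "ennreal ((u h t / h - g t)\<^sup>2) \<le> (\<integral>\<^sup>+y. ennreal (1 / h * ((ux y t - g t)\<^sup>2 * ?i y)) \<partial>?I)" .
    qed
    then have "(\<integral>\<^sup>+t. ennreal ((u h t / h - g t)\<^sup>2) \<partial>?M)
        \<le> (\<integral>\<^sup>+t. (\<integral>\<^sup>+y. ennreal (1 / h * ((ux y t - g t)\<^sup>2 * ?i y)) \<partial>?I) \<partial>?M)"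
      by (rule nn_integral_mono_AE)
    also have "\<dots> = (\<integral>\<^sup>+y. (\<integral>\<^sup>+t. ennreal (1 / h * ((ux y t - g t)\<^sup>2 * ?i y)) \<partial>?M) \<partial>?I)"
      by (rule P.Fubini') (simp add: case_prod_beta')
    also have "\<dots> \<le> (\<integral>\<^sup>+y. ennreal (\<epsilon> / h * ?i y) \<partial>?I)"
    proof (rule nn_integral_mono_AE)
      have "AE y in ?I. 0 < y \<and> y < \<delta> \<longrightarrow> (\<integral>\<^sup>+t. ennreal ((ux y t - g t)\<^sup>2) \<partial>?M) \<le> ennreal \<epsilon>"
        unfolding interval_measure01_def AE_restrict_lborel_Ioo using d(2) by eventually_elim auto
      moreover have "AE y in ?I. 0 < y \<and> y < 1" by (rule AE_I2) simp
      ultimately show "AE y in ?I. (\<integral>\<^sup>+t. ennreal (1 / h * ((ux y t - g t)\<^sup>2 * ?i y)) \<partial>?M) \<le> ennreal (\<epsilon> / h * ?i y)"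
      proof eventually_elim
        case (elim y)
        show ?case
        proof (cases "y < h")
          case True
          have "(\<integral>\<^sup>+t. ennreal (1 / h * ((ux y t - g t)\<^sup>2 * ?i y)) \<partial>?M)
              = (\<integral>\<^sup>+t. ennreal (1 / h) * ennreal ((ux y t - g t)\<^sup>2) \<partial>?M)"
            using True h by (intro nn_integral_cong) (simp add: ennreal_mult[symmetric])
          also have "\<dots> = ennreal (1 / h) * (\<integral>\<^sup>+t. ennreal ((ux y t - g t)\<^sup>2) \<partial>?M)"
          proof (rule nn_integral_cmult)
            have "(\<lambda>t. ux y t) \<in> borel_measurable ?M"
            proof -
              have "(\<lambda>t. (y, t)) \<in> measurable ?M (borel \<Otimes>\<^sub>M borel)"
                by (intro measurable_Pair measurable_const idM) simp
              from measurable_compose[OF this uxm] show ?thesis by simp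
            qed
            then show "(\<lambda>t. ennreal ((ux y t - g t)\<^sup>2)) \<in> borel_measurable ?M" by measurable
          qed
          also have "\<dots> \<le> ennreal (1 / h) * ennreal \<epsilon>"
            using elim True h by (intro mult_left_mono) auto
          also have "\<dots> = ennreal (\<epsilon> / h * ?i y)"
            using True h e by (simp add: ennreal_mult[symmetric])
          finally show ?thesis .
        qed simp
      qed
    qed
    also have "\<dots> = ennreal (\<integral>y. \<epsilon> / h * ?i y \<partial>?I)"
      using h e by (intro nn_integral_eq_integral integrable_times_indicator_I01) auto
    also have "(\<integral>y. \<epsilon> / h * ?i y \<partial>?I) = (LINT y:{0<..<h}|lborel. \<epsilon> / h)"
      using h by (simp only: integral_Ioo_sub_I01)
    also have "\<dots> = \<epsilon>" using h by (simp add: set_lebesgue_integral_def)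
    finally show ?thesis .
  qed
  then show ?thesis using that d(1) by blast
qed

context wave_basis
begin

abbreviation "J T \<equiv> restrict_space lborel {0<..<T::real}"

lemma osc_continuous: "continuous_on X (osc A B k)"
  unfolding osc_def[abs_def] by (intro continuous_intros)

lemma osc_sum_square_integrable: "square_integrable (J T) (\<lambda>t. \<Sum>k\<in>F. osc A B k t * d k)"
  by (intro square_integrable_continuous_interval continuous_intros osc_continuous)

lemma ingham_osc:
  assumes T: "T > 4 / \<beta>"
  obtains c C where "c > 0" "C > 0"
    "\<And>F A B d. finite F \<Longrightarrow> c * (\<Sum>k\<in>F. ((A k)\<^sup>2 + (B k)\<^sup>2) * (d k)\<^sup>2)
        \<le> l2_normsq (J T) (\<lambda>t. \<Sum>k\<in>F. osc A B k t * d k)"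
    "\<And>F A B d. finite F \<Longrightarrow> l2_normsq (J T) (\<lambda>t. \<Sum>k\<in>F. osc A B k t * d k)
        \<le> C * (\<Sum>k\<in>F. ((A k)\<^sup>2 + (B k)\<^sup>2) * (d k)\<^sup>2)"
proof -
  have g: "\<beta> / 2 * pi > 0" using b0 by simp
  have "T * (\<beta> / 2) > 2" using T b0 by (simp add: field_simps)
  then have T': "T * (\<beta> / 2 * pi) > 2 * pi" using mult_strict_right_mono[of 2 "T * (\<beta> / 2)" pi] by (simp add: mult.assoc)
  obtain c C where cC: "c > 0" "C > 0"
    "\<And>F A B. finite F \<Longrightarrow> c * trig_energy F A B \<le> l2_normsq (J T) (trig_sum F freq A B)"
    "\<And>F A B. finite F \<Longrightarrow> l2_normsq (J T) (trig_sum F freq A B) \<le> C * trig_energy F A B"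
    by (rule ingham[where \<mu> = freq, OF T' g], erule freq_gap, rule freq_ge, rule that)
  have e: "trig_energy F (\<lambda>k. d k * A k) (\<lambda>k. d k * B k) = (\<Sum>k\<in>F. ((A k)\<^sup>2 + (B k)\<^sup>2) * (d k)\<^sup>2)" for F A B d
    unfolding trig_energy_def by (intro sum.cong refl) (simp add: power_mult_distrib algebra_simps)
  have s: "trig_sum F freq (\<lambda>k. d k * A k) (\<lambda>k. d k * B k) = (\<lambda>t. \<Sum>k\<in>F. osc A B k t * d k)" for F A B d
    by (rule ext) (rule trig_sum_osc)
  show ?thesis
  proof (rule that[OF cC(1,2)])
    fix F :: "nat set" and A B d :: "nat \<Rightarrow> real" assume F: "finite F"
    show "c * (\<Sum>k\<in>F. ((A k)\<^sup>2 + (B k)\<^sup>2) * (d k)\<^sup>2) \<le> l2_normsq (J T) (\<lambda>t. \<Sum>k\<in>F. osc A B k t * d k)"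
      using cC(3)[OF F, of "\<lambda>k. d k * A k" "\<lambda>k. d k * B k"] unfolding e s .
    show "l2_normsq (J T) (\<lambda>t. \<Sum>k\<in>F. osc A B k t * d k) \<le> C * (\<Sum>k\<in>F. ((A k)\<^sup>2 + (B k)\<^sup>2) * (d k)\<^sup>2)"
      using cC(4)[OF F, of "\<lambda>k. d k * A k" "\<lambda>k. d k * B k"] unfolding e s .
  qed
qed

lemma \<Phi>_div_tendsto: "((\<lambda>h. \<Phi> k h / h) \<longlongrightarrow> slope k) (at_right 0)"
proof -
  have "((\<lambda>x. bessel_G \<beta> (lam k * x powr \<beta>)) \<longlongrightarrow> bessel_G \<beta> (lam k * 0 powr \<beta>)) (at 0 within {0..})"
    by (rule bspec[OF continuous_on_bessel_arg(1)[OF b0, of "lam k", unfolded continuous_on]]) simp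
  then have "((\<lambda>x. bessel_G \<beta> (lam k * x powr \<beta>)) \<longlongrightarrow> 1) (at_right 0)"
    using tendsto_within_subset[of _ _ 0 "{0..}" "{0<..}"] by fastforce
  then have "((\<lambda>x. slope k * bessel_G \<beta> (lam k * x powr \<beta>)) \<longlongrightarrow> slope k * 1) (at_right 0)"
    by (rule tendsto_mult_left)
  moreover have "eventually (\<lambda>x. slope k * bessel_G \<beta> (lam k * x powr \<beta>) = \<Phi> k x / x) (at_right 0)"
  proof -
    have "eventually (\<lambda>x. x \<in> {0<..<1}) (at_right (0::real))"
      by (rule eventually_at_right_real) simp
    then show ?thesis by eventually_elim (simp add: \<Phi>_eq mode_def)
  qed
  ultimately show ?thesis by (simp add: tendsto_cong)
qed

lemma slope_summable:
  assumes sm: "summable (\<lambda>k. ((A k)\<^sup>2 + (B k)\<^sup>2) * lam k powr p)"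
  shows "summable (\<lambda>k. ((A k)\<^sup>2 + (B k)\<^sup>2) * (slope k)\<^sup>2)"
proof -
  obtain K1 K2 where K: "0 < K1" "0 < K2"
    "\<And>k. K1 * lam k powr p \<le> (slope k)\<^sup>2" "\<And>k. (slope k)\<^sup>2 \<le> K2 * lam k powr p"
    by (rule slope_bounds, rule that)
  show ?thesis
  proof (rule summable_comparison_test'[OF summable_mult[OF sm, of K2]])
    fix k
    have "((A k)\<^sup>2 + (B k)\<^sup>2) * (slope k)\<^sup>2 \<le> ((A k)\<^sup>2 + (B k)\<^sup>2) * (K2 * lam k powr p)"
      by (intro mult_left_mono K) auto
    then show "norm (((A k)\<^sup>2 + (B k)\<^sup>2) * (slope k)\<^sup>2) \<le> K2 * (((A k)\<^sup>2 + (B k)\<^sup>2) * lam k powr p)"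
      by (simp add: mult_ac)
  qed
qed

lemma osc_tail:
  fixes A B d :: "nat \<Rightarrow> real" and n m :: nat
  assumes C: "C > 0"
    and ing: "\<And>F A B d. finite F \<Longrightarrow> l2_normsq (J T) (\<lambda>t. \<Sum>k\<in>F. osc A B k t * d k)
        \<le> C * (\<Sum>k\<in>F. ((A k)\<^sup>2 + (B k)\<^sup>2) * (d k)\<^sup>2)"
    and sm: "summable (\<lambda>k. ((A k)\<^sup>2 + (B k)\<^sup>2) * (slope k)\<^sup>2)"
    and d: "\<And>k. \<bar>d k\<bar> \<le> \<bar>slope k\<bar>" and nm: "n \<le> m"
  shows "l2_normsq (J T) (\<lambda>t. (\<Sum>k<m. osc A B k t * d k) - (\<Sum>k<n. osc A B k t * d k))
    \<le> C * series_tail (\<lambda>k. ((A k)\<^sup>2 + (B k)\<^sup>2) * (slope k)\<^sup>2) n"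
proof -
  have "{..<m} - {..<n} = {n..<m}" by auto
  then have "(\<Sum>k<m. osc A B k t * d k) - (\<Sum>k<n. osc A B k t * d k) = (\<Sum>k\<in>{n..<m}. osc A B k t * d k)" for t
    using nm sum_diff[of "{..<m}" "{..<n}" "\<lambda>k. osc A B k t * d k"] by simp
  then have "l2_normsq (J T) (\<lambda>t. (\<Sum>k<m. osc A B k t * d k) - (\<Sum>k<n. osc A B k t * d k))
      \<le> C * (\<Sum>k\<in>{n..<m}. ((A k)\<^sup>2 + (B k)\<^sup>2) * (d k)\<^sup>2)"
    using ing[of "{n..<m}" A B d] by simp
  also have "\<dots> \<le> C * (\<Sum>k\<in>{n..<m}. ((A k)\<^sup>2 + (B k)\<^sup>2) * (slope k)\<^sup>2)"
    using d C by (intro mult_left_mono sum_mono) (auto simp: abs_le_square_iff)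
  also have "\<dots> \<le> C * series_tail (\<lambda>k. ((A k)\<^sup>2 + (B k)\<^sup>2) * (slope k)\<^sup>2) n"
    using C nm by (intro mult_left_mono series_tail_bound sm) auto
  finally show ?thesis .
qed

text \<open>Whatever trace a solution has, it is the sum of the boundary slopes of its modes. Ingham's
  upper bound controls the tails of the series for \<open>u(h, \<cdot>)/h\<close> uniformly in \<open>h\<close>, since
  \<open>\<bar>\<Phi>\<^sub>k(h)\<bar> \<le> \<bar>\<Phi>\<^sub>k'(0)\<bar> h\<close>.\<close>

lemma trace_series:
  assumes T: "T > 0" and C: "C > 0"
    and ing: "\<And>F A B d. finite F \<Longrightarrow> l2_normsq (J T) (\<lambda>t. \<Sum>k\<in>F. osc A B k t * d k)
        \<le> C * (\<Sum>k\<in>F. ((A k)\<^sup>2 + (B k)\<^sup>2) * (d k)\<^sup>2)"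
    and sm: "summable (\<lambda>k. ((A k)\<^sup>2 + (B k)\<^sup>2) * (slope k)\<^sup>2)"
    and ser: "\<And>t x. t \<in> {0..T} \<Longrightarrow> 0 \<le> x \<Longrightarrow> x \<le> 1 \<Longrightarrow> (\<lambda>n. \<Sum>k<n. osc A B k t * \<Phi> k x) \<longlonglongrightarrow> u x t"
    and tr: "dx_trace_at_0 T u g"
  shows "l2_normsq (J T) (\<lambda>t. g t - (\<Sum>k<n. osc A B k t * slope k))
    \<le> C * series_tail (\<lambda>k. ((A k)\<^sup>2 + (B k)\<^sup>2) * (slope k)\<^sup>2) n"
proof -
  define f where "f k = ((A k)\<^sup>2 + (B k)\<^sup>2) * (slope k)\<^sup>2" for k
  have f0: "f k \<ge> 0" for k by (simp add: f_def)
  have smf: "summable f" using sm by (simp add: f_def[abs_def])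
  define q where "q = C * series_tail f n"
  have q: "q \<ge> 0" using series_tail_nonneg[OF smf f0] C by (simp add: q_def)
  define G where "G t = (\<Sum>k<n. osc A B k t * slope k)" for t
  have Gs: "square_integrable (J T) G" unfolding G_def[abs_def] by (rule osc_sum_square_integrable)
  have gs: "square_integrable (J T) g" using tr by (simp add: dx_trace_at_0_def)
  define F where "F h m t = (\<Sum>k<m. osc A B k t * (\<Phi> k h / h))" for h m t
  have Fs: "square_integrable (J T) (F h m)" for h m unfolding F_def[abs_def] by (rule osc_sum_square_integrable)
  have uh: "square_integrable (J T) (\<lambda>t. u h t / h)"
    "l2_normsq (J T) (\<lambda>t. u h t / h - F h n t) \<le> q" if h: "0 < h" "h \<le> 1" for h
  proof -
    have lim: "(\<lambda>m. F h m t) \<longlonglongrightarrow> u h t / h" if "t \<in> space (J T)" for t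
    proof -
      have "(\<lambda>m. (\<Sum>k<m. osc A B k t * \<Phi> k h) / h) \<longlonglongrightarrow> u h t / h"
        using that h by (intro tendsto_divide ser tendsto_const) (auto simp: space_restrict_space)
      then show ?thesis by (simp add: F_def sum_divide_distrib)
    qed
    have m: "(\<lambda>t. u h t / h) \<in> borel_measurable (J T)"
      by (rule borel_measurable_LIMSEQ_real[OF lim]) (use Fs in \<open>auto simp: square_integrable_def\<close>)
    have AE: "AE t in J T. (\<lambda>m. F h m t) \<longlonglongrightarrow> u h t / h" by (rule AE_I2) (rule lim)
    have "\<bar>\<Phi> k h / h\<bar> \<le> \<bar>slope k\<bar>" for k using \<Phi>_bound[of h k] h by (simp add: field_simps)
    then have bd: "l2_normsq (J T) (\<lambda>t. F h m t - F h n t) \<le> q" if "n \<le> m" for m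
      unfolding F_def q_def f_def[abs_def] by (intro osc_tail C ing sm that)
    have ev: "eventually (\<lambda>m. l2_normsq (J T) (\<lambda>t. F h m t - F h n t) \<le> q) sequentially"
      using eventually_ge_at_top[of n] by eventually_elim (rule bd)
    show "square_integrable (J T) (\<lambda>t. u h t / h)" by (rule l2_AE_limit(1)[OF Fs m AE Fs ev])
    show "l2_normsq (J T) (\<lambda>t. u h t / h - F h n t) \<le> q" by (rule l2_AE_limit(2)[OF Fs m AE Fs ev])
  qed
  have "sqrt (l2_normsq (J T) (\<lambda>t. g t - G t)) \<le> sqrt q"
  proof (rule field_le_epsilon)
    fix e :: real assume e: "e > 0"
    have e4: "(e / 2)\<^sup>2 > 0" using e by simp
    obtain \<delta> where \<delta>: "\<delta> > 0" "\<And>h. 0 < h \<Longrightarrow> h < \<delta> \<Longrightarrow> h \<le> 1 \<Longrightarrow>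
      (\<integral>\<^sup>+t. ennreal ((u h t / h - g t)\<^sup>2) \<partial>J T) \<le> ennreal ((e / 2)\<^sup>2)"
      by (rule trace_difference_quotient[OF tr e4], rule that)
    have "((\<lambda>h. C * (\<Sum>k<n. ((A k)\<^sup>2 + (B k)\<^sup>2) * (\<Phi> k h / h - slope k)\<^sup>2)) \<longlongrightarrow>
        C * (\<Sum>k<n. ((A k)\<^sup>2 + (B k)\<^sup>2) * (slope k - slope k)\<^sup>2)) (at_right 0)"
      by (intro tendsto_intros \<Phi>_div_tendsto)
    then have "((\<lambda>h. C * (\<Sum>k<n. ((A k)\<^sup>2 + (B k)\<^sup>2) * (\<Phi> k h / h - slope k)\<^sup>2)) \<longlongrightarrow> 0) (at_right 0)"
      by simp
    from order_tendstoD(2)[OF this e4]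
    have "eventually (\<lambda>h. C * (\<Sum>k<n. ((A k)\<^sup>2 + (B k)\<^sup>2) * (\<Phi> k h / h - slope k)\<^sup>2) < (e / 2)\<^sup>2) (at_right 0)" .
    moreover have "eventually (\<lambda>h. h \<in> {0<..<min \<delta> 1}) (at_right 0)"
      by (rule eventually_at_right_real) (use \<delta> in simp)
    ultimately have "eventually (\<lambda>h. h \<in> {0<..<min \<delta> 1} \<and>
        C * (\<Sum>k<n. ((A k)\<^sup>2 + (B k)\<^sup>2) * (\<Phi> k h / h - slope k)\<^sup>2) < (e / 2)\<^sup>2) (at_right 0)"
      by eventually_elim simp
    from eventually_happens'[OF trivial_limit_at_right_real this]
    obtain h where h: "0 < h" "h < \<delta>" "h \<le> 1"
      and small: "C * (\<Sum>k<n. ((A k)\<^sup>2 + (B k)\<^sup>2) * (\<Phi> k h / h - slope k)\<^sup>2) < (e / 2)\<^sup>2"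
      by auto
    note us = uh[OF h(1,3)]
    have 1: "l2_normsq (J T) (\<lambda>t. g t - u h t / h) \<le> (e / 2)\<^sup>2"
    proof -
      have "square_integrable (J T) (\<lambda>t. u h t / h - g t)" by (intro square_integrable_diff us gs)
      then have "ennreal (l2_normsq (J T) (\<lambda>t. u h t / h - g t)) = (\<integral>\<^sup>+t. ennreal ((u h t / h - g t)\<^sup>2) \<partial>J T)"
        unfolding l2_normsq_def by (intro nn_integral_eq_integral[symmetric]) (auto simp: square_integrable_def)
      also have "\<dots> \<le> ennreal ((e / 2)\<^sup>2)" by (rule \<delta>(2)[OF h])
      finally have "l2_normsq (J T) (\<lambda>t. u h t / h - g t) \<le> (e / 2)\<^sup>2" by (subst (asm) ennreal_le_iff) auto
      then show ?thesis by (simp add: l2_normsq_def power2_commute)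
    qed
    have 2: "l2_normsq (J T) (\<lambda>t. F h n t - G t) \<le> (e / 2)\<^sup>2"
    proof -
      have "F h n t - G t = (\<Sum>k<n. osc A B k t * (\<Phi> k h / h - slope k))" for t
        by (simp add: F_def G_def sum_subtractf[symmetric] right_diff_distrib)
      then show ?thesis using ing[of "{..<n}" A B "\<lambda>k. \<Phi> k h / h - slope k"] small by simp
    qed
    have d1: "square_integrable (J T) (\<lambda>t. g t - u h t / h)"
      and d2: "square_integrable (J T) (\<lambda>t. u h t / h - F h n t)"
      and d3: "square_integrable (J T) (\<lambda>t. F h n t - G t)"
      by (intro square_integrable_diff us(1) gs Fs Gs)+
    have "sqrt (l2_normsq (J T) (\<lambda>t. g t - G t))
        = sqrt (l2_normsq (J T) (\<lambda>t. (g t - u h t / h) + ((u h t / h - F h n t) + (F h n t - G t))))"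
      by simp
    also have "\<dots> \<le> sqrt (l2_normsq (J T) (\<lambda>t. g t - u h t / h))
        + sqrt (l2_normsq (J T) (\<lambda>t. (u h t / h - F h n t) + (F h n t - G t)))"
      by (rule l2_triangle[OF d1 square_integrable_add[OF d2 d3]])
    also have "\<dots> \<le> sqrt (l2_normsq (J T) (\<lambda>t. g t - u h t / h))
        + (sqrt (l2_normsq (J T) (\<lambda>t. u h t / h - F h n t)) + sqrt (l2_normsq (J T) (\<lambda>t. F h n t - G t)))"
      by (intro add_left_mono l2_triangle[OF d2 d3])
    also have "\<dots> \<le> e / 2 + (sqrt q + e / 2)"
      using 1 2 us(2) e by (intro add_mono real_sqrt_le_mono real_le_lsqrt) auto
    finally show "sqrt (l2_normsq (J T) (\<lambda>t. g t - G t)) \<le> sqrt q + e" by simp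
  qed
  then show ?thesis by (simp add: q_def f_def[abs_def] G_def)
qed

text \<open>Passing to the limit in Ingham's inequality for the partial sums of the trace bounds the integral
  of \<open>g\<^sup>2\<close> by the series of \<open>(A\<^sub>k\<^sup>2 + B\<^sub>k\<^sup>2) \<Phi>\<^sub>k'(0)\<^sup>2\<close> from both sides, and \<open>slope_bounds\<close> compares
  that series with the energy.\<close>

lemma trace_estimate_holds:
  assumes T: "T > 4 / \<beta>"
  obtains c C where "0 < c" "c \<le> C" "trace_estimate (2 - \<beta>) \<Phi> lam (p - 1 / 2) T c C"
proof -
  have T0: "T > 0" using T b0 by (meson divide_pos_pos less_trans zero_less_numeral)
  obtain c C where cC: "c > 0" "C > 0"
    and lower: "\<And>F A B d. finite F \<Longrightarrow> c * (\<Sum>k\<in>F. ((A k)\<^sup>2 + (B k)\<^sup>2) * (d k)\<^sup>2)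
        \<le> l2_normsq (J T) (\<lambda>t. \<Sum>k\<in>F. osc A B k t * d k)"
    and upper: "\<And>F A B d. finite F \<Longrightarrow> l2_normsq (J T) (\<lambda>t. \<Sum>k\<in>F. osc A B k t * d k)
        \<le> C * (\<Sum>k\<in>F. ((A k)\<^sup>2 + (B k)\<^sup>2) * (d k)\<^sup>2)"
    by (rule ingham_osc[OF T], rule that)
  obtain K1 K2 where K: "0 < K1" "0 < K2"
    "\<And>k. K1 * lam k powr p \<le> (slope k)\<^sup>2" "\<And>k. (slope k)\<^sup>2 \<le> K2 * lam k powr p"
    by (rule slope_bounds, rule that)
  have "c * K1 * wave_energy (2 - \<beta>) \<Phi> lam (p - 1 / 2) u0 u1 \<le> (LINT t:{0<..<T}|lborel. (g t)\<^sup>2) \<and>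
      (LINT t:{0<..<T}|lborel. (g t)\<^sup>2) \<le> C * K2 * wave_energy (2 - \<beta>) \<Phi> lam (p - 1 / 2) u0 u1"
    if u0: "u0 \<in> Hs_space (2 - \<beta>) \<Phi> lam p" and u1: "u1 \<in> Hs_space (2 - \<beta>) \<Phi> lam (p - 1)"
      and sol: "wave_solution (2 - \<beta>) T u0 u1 u" and tr: "dx_trace_at_0 T u g" for u0 u1 u g
  proof -
    define A where "A = coeffA u0"
    define B where "B = coeffB u1"
    define r where "r k = (A k)\<^sup>2 + (B k)\<^sup>2" for k
    define f where "f k = r k * (slope k)\<^sup>2" for k
    define En where "En = wave_energy (2 - \<beta>) \<Phi> lam (p - 1 / 2) u0 u1"
    have smE: "summable (\<lambda>k. r k * lam k powr p)" and En: "En = (\<Sum>k. r k * lam k powr p)"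
      using energy_summable[OF u0 u1] by (simp_all add: r_def A_def B_def En_def)
    have smf: "summable f" using slope_summable smE unfolding f_def[abs_def] r_def by blast
    have r0: "r k \<ge> 0" for k by (simp add: r_def)
    have f0: "f k \<ge> 0" for k by (simp add: f_def r0)
    have tail: "l2_normsq (J T) (\<lambda>t. g t - (\<Sum>k<n. osc A B k t * slope k)) \<le> C * series_tail f n" for n
      using trace_series[OF T0 cC(2) upper, of A B u g n] smf solution_series[OF T0 u0 u1 sol] tr
      by (simp add: f_def[abs_def] r_def A_def B_def)
    have gs: "square_integrable (J T) g" using tr by (simp add: dx_trace_at_0_def)
    define N where "N = l2_normsq (J T) g"
    have N: "N = (LINT t:{0<..<T}|lborel. (g t)\<^sup>2)"
      by (simp add: N_def l2_normsq_def integral_restrict_lborel_Ioo)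
    have up: "N \<le> C * suminf f" using tail[of 0] by (simp add: N_def series_tail_def)
    have lo: "sqrt (c * suminf f) \<le> sqrt N"
    proof (rule LIMSEQ_le)
      show "(\<lambda>n. sqrt (c * (\<Sum>k<n. f k))) \<longlonglongrightarrow> sqrt (c * suminf f)"
        by (intro tendsto_intros summable_LIMSEQ smf)
      have "(\<lambda>n. sqrt N + sqrt (C * series_tail f n)) \<longlonglongrightarrow> sqrt N + sqrt (C * 0)"
        by (intro tendsto_intros series_tail_tendsto smf)
      then show "(\<lambda>n. sqrt N + sqrt (C * series_tail f n)) \<longlonglongrightarrow> sqrt N" by simp
      show "\<exists>M. \<forall>n\<ge>M. sqrt (c * (\<Sum>k<n. f k)) \<le> sqrt N + sqrt (C * series_tail f n)"
      proof (intro exI allI impI)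
        fix n :: nat
        define G where "G = (\<lambda>t. \<Sum>k<n. osc A B k t * slope k)"
        have Gs: "square_integrable (J T) G" unfolding G_def by (rule osc_sum_square_integrable)
        have "sqrt (c * (\<Sum>k<n. f k)) \<le> sqrt (l2_normsq (J T) G)"
          using lower[of "{..<n}" A B slope] by (simp add: f_def r_def G_def)
        also have "\<dots> = sqrt (l2_normsq (J T) (\<lambda>t. g t + (G t - g t)))" by simp
        also have "\<dots> \<le> sqrt N + sqrt (l2_normsq (J T) (\<lambda>t. G t - g t))"
          unfolding N_def by (intro l2_triangle gs square_integrable_diff Gs)
        also have "l2_normsq (J T) (\<lambda>t. G t - g t) = l2_normsq (J T) (\<lambda>t. g t - G t)"
          by (simp add: l2_normsq_def power2_commute)
        also have "sqrt N + sqrt (l2_normsq (J T) (\<lambda>t. g t - G t)) \<le> sqrt N + sqrt (C * series_tail f n)"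
          using tail[of n] by (simp add: G_def)
        finally show "sqrt (c * (\<Sum>k<n. f k)) \<le> sqrt N + sqrt (C * series_tail f n)" .
      qed
    qed
    have f1: "K1 * (r k * lam k powr p) \<le> f k" and f2: "f k \<le> K2 * (r k * lam k powr p)" for k
      using mult_left_mono[OF K(3)[of k] r0[of k]] mult_left_mono[OF K(4)[of k] r0[of k]]
      unfolding f_def by (simp_all add: mult_ac)
    have "K1 * En \<le> suminf f" unfolding En suminf_mult[OF smE, symmetric]
      by (rule suminf_le[OF f1 summable_mult[OF smE] smf])
    then have "c * K1 * En \<le> c * suminf f" using cC by (simp add: mult.assoc)
    also have "\<dots> \<le> N" using lo by simp
    finally have 1: "c * K1 * En \<le> N" .
    have "suminf f \<le> K2 * En" unfolding En suminf_mult[OF smE, symmetric]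
      by (rule suminf_le[OF f2 smf summable_mult[OF smE]])
    then have "C * suminf f \<le> C * K2 * En" using cC by (simp add: mult.assoc)
    with up have "N \<le> C * K2 * En" by simp
    with 1 show ?thesis by (simp add: N En_def)
  qed
  note est = this
  have En0: "wave_energy (2 - \<beta>) \<Phi> lam (p - 1 / 2) u0 u1 \<ge> 0"
    if "u0 \<in> Hs_space (2 - \<beta>) \<Phi> lam p" "u1 \<in> Hs_space (2 - \<beta>) \<Phi> lam (p - 1)" for u0 u1
    unfolding energy_summable(2)[OF that] by (intro suminf_nonneg energy_summable(1)[OF that]) auto
  have "trace_estimate (2 - \<beta>) \<Phi> lam (p - 1 / 2) T (c * K1) (max (c * K1) (C * K2))"
    unfolding trace_estimate_def
  proof (intro allI impI)
    fix u0 u1 u g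
    assume a: "u0 \<in> Hs_space (2 - \<beta>) \<Phi> lam (p - 1 / 2 + 1 / 2)" "u1 \<in> Hs_space (2 - \<beta>) \<Phi> lam (p - 1 / 2 - 1 / 2)"
      "wave_solution (2 - \<beta>) T u0 u1 u" "dx_trace_at_0 T u g"
    then have b: "u0 \<in> Hs_space (2 - \<beta>) \<Phi> lam p" "u1 \<in> Hs_space (2 - \<beta>) \<Phi> lam (p - 1)" by simp_all
    have "C * K2 * wave_energy (2 - \<beta>) \<Phi> lam (p - 1 / 2) u0 u1
        \<le> max (c * K1) (C * K2) * wave_energy (2 - \<beta>) \<Phi> lam (p - 1 / 2) u0 u1"
      by (intro mult_right_mono En0 b) auto
    with est[OF b a(3,4)] show "c * K1 * wave_energy (2 - \<beta>) \<Phi> lam (p - 1 / 2) u0 u1 \<le> (LINT t:{0<..<T}|lborel. (g t)\<^sup>2) \<and>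
        (LINT t:{0<..<T}|lborel. (g t)\<^sup>2) \<le> max (c * K1) (C * K2) * wave_energy (2 - \<beta>) \<Phi> lam (p - 1 / 2) u0 u1"
      by linarith
  qed
  then show ?thesis using that[of "c * K1" "max (c * K1) (C * K2)"] cC K by simp
qed

end

section \<open>Existence of the trace\<close>

lemma borel_measurable_dmode [measurable]:
  assumes "\<beta> > 0" shows "dmode \<beta> l \<in> borel_measurable borel"
proof -
  have "continuous_on UNIV (bessel_G \<beta>)" "continuous_on UNIV (bessel_G' \<beta>)"
    using bessel_G_deriv[OF assms] bessel_G'_deriv[OF assms] DERIV_isCont
    by (auto simp: continuous_on_eq_continuous_at intro: DERIV_isCont)
  then have [measurable]: "bessel_G \<beta> \<in> borel_measurable borel" "bessel_G' \<beta> \<in> borel_measurable borel"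
    by (auto intro: borel_measurable_continuous_onI)
  show ?thesis unfolding dmode_def[abs_def] by measurable
qed

lemma Cauchy_imp_tendsto_lim: "Cauchy X \<Longrightarrow> X \<longlonglongrightarrow> lim X" for X :: "nat \<Rightarrow> real"
  using Cauchy_convergent convergent_LIMSEQ_iff by blast

context wave_basis
begin

lemma abs_osc_le: "\<bar>osc A B k t\<bar> \<le> \<bar>A k\<bar> + \<bar>B k\<bar>"
proof -
  have "\<bar>osc A B k t\<bar> \<le> \<bar>A k\<bar> * \<bar>cos (freq k * t)\<bar> + \<bar>B k\<bar> * \<bar>sin (freq k * t)\<bar>"
    unfolding osc_def by (metis abs_mult abs_triangle_ineq)
  also have "\<dots> \<le> \<bar>A k\<bar> * 1 + \<bar>B k\<bar> * 1" by (intro add_mono mult_left_mono) auto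
  finally show ?thesis by simp
qed

lemma osc_measurable [measurable]: "osc A B k \<in> borel_measurable borel"
  by (rule borel_measurable_continuous_onI[OF osc_continuous])

lemma d\<Phi>_measurable [measurable]: "d\<Phi> k \<in> borel_measurable borel"
  unfolding d\<Phi>_def[abs_def] using borel_measurable_dmode[OF b0] by measurable

lemma J_measurable: "f \<in> borel_measurable borel \<Longrightarrow> f \<in> borel_measurable (J T)"
  by (intro measurable_restrict_space1) simp

text \<open>The differentiated series converges in \<open>L\<^sup>2\<close> in time, uniformly in \<open>x\<close>, and in \<open>L\<^sup>2\<close> in space,
  uniformly in \<open>t\<close>. A subsequence that converges almost everywhere on the rectangle yields a
  jointly measurable weak derivative with both properties.\<close>

lemma trace_exists:
  assumes T: "T > 4 / \<beta>" and u0: "u0 \<in> Hs_space (2 - \<beta>) \<Phi> lam p" and u1: "u1 \<in> Hs_space (2 - \<beta>) \<Phi> lam (p - 1)"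
    and sol: "wave_solution (2 - \<beta>) T u0 u1 u"
  shows "\<exists>g. dx_trace_at_0 T u g"
proof -
  have T0: "T > 0" using T b0 by (meson divide_pos_pos less_trans zero_less_numeral)
  obtain c C where cC: "c > 0" "C > 0"
    and lower: "\<And>F A B d. finite F \<Longrightarrow> c * (\<Sum>k\<in>F. ((A k)\<^sup>2 + (B k)\<^sup>2) * (d k)\<^sup>2)
        \<le> l2_normsq (J T) (\<lambda>t. \<Sum>k\<in>F. osc A B k t * d k)"
    and upper: "\<And>F A B d. finite F \<Longrightarrow> l2_normsq (J T) (\<lambda>t. \<Sum>k\<in>F. osc A B k t * d k)
        \<le> C * (\<Sum>k\<in>F. ((A k)\<^sup>2 + (B k)\<^sup>2) * (d k)\<^sup>2)"
    by (rule ingham_osc[OF T], rule that)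
  define A where "A = coeffA u0"
  define B where "B = coeffB u1"
  define f where "f k = ((A k)\<^sup>2 + (B k)\<^sup>2) * (slope k)\<^sup>2" for k
  have smE: "summable (\<lambda>k. ((A k)\<^sup>2 + (B k)\<^sup>2) * lam k powr p)"
    using energy_summable(1)[OF u0 u1] by (simp add: A_def B_def)
  have smf: "summable f" using slope_summable[OF smE] by (simp add: f_def[abs_def])
  define q where "q n = C * series_tail f n" for n
  have q0: "q \<longlonglongrightarrow> 0"
    using tendsto_mult_left[OF series_tail_tendsto[OF smf], of C] by (simp add: q_def[abs_def])
  define S where "S n x t = (\<Sum>k<n. osc A B k t * d\<Phi> k x)" for n x t
  have Ssq: "square_integrable (J T) (S n x)" for n x
    unfolding S_def[abs_def] by (rule osc_sum_square_integrable)
  have tail: "l2_normsq (J T) (\<lambda>t. S m x t - S n x t) \<le> q n" if "n \<le> m" "x \<ge> 0" for n m x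
    unfolding S_def q_def f_def[abs_def]
    by (rule osc_tail[OF cC(2) upper slope_summable[OF smE] d\<Phi>_bound that(1)]) (use that in auto)
  have tail': "\<exists>N. \<forall>i\<ge>N. \<forall>j\<ge>N. \<forall>x\<ge>0. l2_normsq (J T) (\<lambda>t. S i x t - S j x t) \<le> e" if e: "e > 0" for e
  proof -
    obtain N where N: "\<And>n. n \<ge> N \<Longrightarrow> q n < e"
      using order_tendstoD(2)[OF q0 e] unfolding eventually_sequentially by blast
    have "l2_normsq (J T) (\<lambda>t. S i x t - S j x t) \<le> e" if "i \<ge> N" "j \<ge> N" "x \<ge> 0" for i j x
    proof (cases "j \<le> i")
      case True
      then show ?thesis using tail[of j i x] N[of j] that by simp
    next
      case False
      have "l2_normsq (J T) (\<lambda>t. S i x t - S j x t) = l2_normsq (J T) (\<lambda>t. S j x t - S i x t)"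
        by (simp add: l2_normsq_def power2_commute)
      then show ?thesis using False tail[of i j x] N[of i] that by simp
    qed
    then show ?thesis by blast
  qed
  interpret MI: finite_measure I by (rule finite_measure_interval_measure01)
  interpret MJ: finite_measure "J T" by (rule finite_measure_restrict_lborel_Ioo)
  interpret P: pair_sigma_finite I "J T" ..
  obtain r1 :: "nat \<Rightarrow> nat" where r1: "strict_mono r1" "AE t in J T. Cauchy (\<lambda>i. S (r1 i) 0 t)"
  proof (rule mean_square_Cauchy_AE_subseq[of "J T" "\<lambda>i. S i 0"])
    show "finite_measure (J T)" by (rule MJ.finite_measure_axioms)
    show "S i 0 \<in> borel_measurable (J T)" "integrable (J T) (\<lambda>t. (S i 0 t)\<^sup>2)" for i
      using Ssq[of i 0] by (auto simp: square_integrable_def)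
    show "\<exists>N. \<forall>i\<ge>N. \<forall>j\<ge>N. (\<integral>t. (S i 0 t - S j 0 t)\<^sup>2 \<partial>J T) \<le> e" if "e > 0" for e
      using tail'[OF that] unfolding l2_normsq_def by (meson order_refl)
  qed (rule that)
  define g where "g t = lim (\<lambda>i. S (r1 i) 0 t)" for t
  have Sm: "S n x \<in> borel_measurable (J T)" for n x using Ssq by (simp add: square_integrable_def)
  have gm: "g \<in> borel_measurable (J T)"
    unfolding g_def[abs_def] by (rule borel_measurable_lim_metric) (rule Sm)
  have glim: "AE t in J T. (\<lambda>i. S (r1 i) 0 t) \<longlonglongrightarrow> g t"
    using r1(2) unfolding g_def by eventually_elim (rule Cauchy_imp_tendsto_lim)
  have ev: "eventually (\<lambda>i. l2_normsq (J T) (\<lambda>t. S (r i) x t - S n x t) \<le> q n) sequentially"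
    if "strict_mono r" "x \<ge> 0" for r :: "nat \<Rightarrow> nat" and n x
    using eventually_ge_at_top[of n]
  proof eventually_elim
    case (elim i)
    then show ?case using tail[of n "r i" x] seq_suble[OF that(1), of i] that by simp
  qed
  have gs: "square_integrable (J T) g"
    by (rule l2_AE_limit(1)[OF Ssq gm glim Ssq ev[OF r1(1)]]) simp
  have gd: "l2_normsq (J T) (\<lambda>t. g t - S n 0 t) \<le> q n" for n
    by (rule l2_AE_limit(2)[OF Ssq gm glim Ssq ev[OF r1(1)]]) simp
  \<comment> \<open>One subsequence has to serve almost every \<open>x\<close>, so it is chosen on the rectangle rather than
    separately on each line.\<close>
  let ?P = "I \<Otimes>\<^sub>M J T"
  have idI: "(\<lambda>x. x) \<in> measurable I borel" by (intro measurable_interval_measure01) measurable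
  have idJ: "(\<lambda>x. x) \<in> measurable (J T) borel" by (intro J_measurable) measurable
  have fs: "fst \<in> measurable ?P borel" "snd \<in> measurable ?P borel"
    using measurable_compose[OF measurable_fst idI] measurable_compose[OF measurable_snd idJ] by auto
  have Sb: "(\<lambda>(x, t). S n x t) \<in> borel_measurable (borel \<Otimes>\<^sub>M borel)" for n
    unfolding S_def case_prod_beta' by measurable
  have SP: "(\<lambda>z. S n (fst z) (snd z)) \<in> borel_measurable ?P" for n
    using measurable_compose[OF measurable_Pair[OF fs] Sb] by simp
  have finP: "finite_measure ?P"
    by (rule finite_measure_pair_measure[OF MJ.finite_measure_axioms MI.finite_measure_axioms])
  interpret MP: finite_measure ?P by (rule finP)
  have Sbd: "\<bar>S n x t\<bar> \<le> (\<Sum>k<n. (\<bar>A k\<bar> + \<bar>B k\<bar>) * \<bar>slope k\<bar>)" if "x \<ge> 0" for n x t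
    unfolding S_def
    by (rule order_trans[OF sum_abs]) (auto simp: abs_mult intro!: sum_mono mult_mono abs_osc_le d\<Phi>_bound that)
  have spP: "fst z \<in> {0<..<1}" if "z \<in> space ?P" for z
    using that by (auto simp: space_pair_measure)
  have intP: "integrable ?P (\<lambda>z. (S n (fst z) (snd z))\<^sup>2)" for n
  proof (rule MP.integrable_const_bound[of _ "(\<Sum>k<n. (\<bar>A k\<bar> + \<bar>B k\<bar>) * \<bar>slope k\<bar>)\<^sup>2"])
    show "AE z in ?P. norm ((S n (fst z) (snd z))\<^sup>2) \<le> (\<Sum>k<n. (\<bar>A k\<bar> + \<bar>B k\<bar>) * \<bar>slope k\<bar>)\<^sup>2"
    proof (rule AE_I2)
      fix z assume "z \<in> space ?P"
      then have "0 \<le> fst z" using spP[of z] by simp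
      then have "\<bar>S n (fst z) (snd z)\<bar> \<le> (\<Sum>k<n. (\<bar>A k\<bar> + \<bar>B k\<bar>) * \<bar>slope k\<bar>)"
        by (rule Sbd)
      then show "norm ((S n (fst z) (snd z))\<^sup>2) \<le> (\<Sum>k<n. (\<bar>A k\<bar> + \<bar>B k\<bar>) * \<bar>slope k\<bar>)\<^sup>2"
        using power_mono[of "\<bar>S n (fst z) (snd z)\<bar>" _ 2] by simp
    qed
  qed (intro borel_measurable_power SP)
  have intD: "integrable ?P (\<lambda>z. (S i (fst z) (snd z) - S j (fst z) (snd z))\<^sup>2)" for i j
  proof (rule Bochner_Integration.integrable_bound)
    show "integrable ?P (\<lambda>z. 2 * (S i (fst z) (snd z))\<^sup>2 + 2 * (S j (fst z) (snd z))\<^sup>2)" using intP by simp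
    have "(a - b)\<^sup>2 \<le> 2 * a\<^sup>2 + 2 * b\<^sup>2" for a b :: real
      using zero_le_power2[of "a + b"] by (simp add: power2_sum power2_diff)
    then show "AE z in ?P. norm ((S i (fst z) (snd z) - S j (fst z) (snd z))\<^sup>2)
        \<le> norm (2 * (S i (fst z) (snd z))\<^sup>2 + 2 * (S j (fst z) (snd z))\<^sup>2)" by simp
  qed (intro borel_measurable_power borel_measurable_diff SP)
  have I1: "measure I (space I) = 1"
  proof -
    have "(\<integral>x. 1 \<partial>I) = (LINT x:{0<..<1::real}|lborel. (1::real))"
      unfolding interval_measure01_def by (rule integral_restrict_lborel_Ioo)
    then show ?thesis by (simp add: set_lebesgue_integral_def)
  qed
  obtain r2 :: "nat \<Rightarrow> nat" where r2: "strict_mono r2" "AE z in ?P. Cauchy (\<lambda>i. S (r2 i) (fst z) (snd z))"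
  proof (rule mean_square_Cauchy_AE_subseq[OF finP SP intP])
    fix e :: real assume "e > 0"
    then obtain N where N: "\<And>i j x. i \<ge> N \<Longrightarrow> j \<ge> N \<Longrightarrow> x \<ge> 0 \<Longrightarrow> l2_normsq (J T) (\<lambda>t. S i x t - S j x t) \<le> e"
      using tail' by meson
    have "(\<integral>z. (S i (fst z) (snd z) - S j (fst z) (snd z))\<^sup>2 \<partial>?P) \<le> e" if "i \<ge> N" "j \<ge> N" for i j
    proof -
      have "(\<integral>z. (S i (fst z) (snd z) - S j (fst z) (snd z))\<^sup>2 \<partial>?P) = (\<integral>x. l2_normsq (J T) (\<lambda>t. S i x t - S j x t) \<partial>I)"
        using P.integral_fst'[OF intD[of i j]] by (simp add: l2_normsq_def)
      also have "\<dots> \<le> (\<integral>x. e \<partial>I)"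
        using P.integrable_fst'[OF intD[of i j]] N[OF that] by (intro integral_mono) (auto simp: l2_normsq_def)
      also have "\<dots> = e" using I1 by simp
      finally show ?thesis .
    qed
    then show "\<exists>N. \<forall>i\<ge>N. \<forall>j\<ge>N. (\<integral>z. (S i (fst z) (snd z) - S j (fst z) (snd z))\<^sup>2 \<partial>?P) \<le> e" by blast
  qed (rule that)
  define ux where "ux x t = lim (\<lambda>i. S (r2 i) x t)" for x t
  have uxm: "(\<lambda>(x, t). ux x t) \<in> borel_measurable (borel \<Otimes>\<^sub>M borel)"
    unfolding ux_def case_prod_beta' using Sb[unfolded case_prod_beta'] by (rule borel_measurable_lim_metric)
  have Cset: "{z \<in> space ?P. Cauchy (\<lambda>i. S (r2 i) (fst z) (snd z))} \<in> sets ?P"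
    by (rule sets_Collect_Cauchy) (rule SP)
  have AExt: "AE x in I. AE t in J T. Cauchy (\<lambda>i. S (r2 i) x t)"
    using P.AE_pair[OF r2(2)] by simp
  then have AEtx: "AE t in J T. AE x in I. Cauchy (\<lambda>i. S (r2 i) x t)"
    by (subst (asm) P.AE_commute[OF Cset])
  have uxmx: "(\<lambda>t. ux x t) \<in> borel_measurable (J T)" for x
    unfolding ux_def by (rule borel_measurable_lim_metric) (rule Sm)
  have dSI: "square_integrable I (\<lambda>x. S n x t)" for n t
    unfolding S_def by (intro square_integrable_sum square_integrable_scale d\<Phi>_square_integrable)
  have uxmt: "(\<lambda>x. ux x t) \<in> borel_measurable I" for t
    unfolding ux_def by (rule borel_measurable_lim_metric) (use dSI in \<open>simp add: square_integrable_def\<close>)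
  define f' where "f' k = ((A k)\<^sup>2 + (B k)\<^sup>2) * lam k" for k
  have smf': "summable f'" using summable_lam[OF smE] by (simp add: f'_def[abs_def])
  have "AE t in J T. H10_deriv (\<lambda>x. u x t) (\<lambda>x. ux x t)"
  proof -
    have "AE t in J T. t \<in> {0<..<T}" by (rule AE_I2) (simp add: space_restrict_space)
    with AEtx show ?thesis
    proof eventually_elim
      fix t assume ae: "AE x in I. Cauchy (\<lambda>i. S (r2 i) x t)" and "t \<in> {0<..<T}"
      then have t: "t \<in> {0..T}" by simp
      have lim: "AE x in I. (\<lambda>i. S (r2 i) x t) \<longlonglongrightarrow> ux x t"
        using ae unfolding ux_def by eventually_elim (rule Cauchy_imp_tendsto_lim)
      have bd: "l2_normsq I (\<lambda>x. S m x t - S n x t) \<le> series_tail f' n" if "n \<le> m" for m n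
      proof -
        have "{..<m} - {..<n} = {n..<m}" by auto
        then have "S m x t - S n x t = (\<Sum>k\<in>{n..<m}. osc A B k t * d\<Phi> k x)" for x
          unfolding S_def using that sum_diff[of "{..<m}" "{..<n}" "\<lambda>k. osc A B k t * d\<Phi> k x"] by simp
        then have "l2_normsq I (\<lambda>x. S m x t - S n x t) = (\<Sum>k\<in>{n..<m}. (osc A B k t)\<^sup>2 * lam k)"
          by (simp only:) (rule l2_normsq_orthogonal_sum, auto simp: d\<Phi>_square_integrable d\<Phi>_inner)
        also have "\<dots> \<le> (\<Sum>k\<in>{n..<m}. f' k)"
          unfolding f'_def using lam_pos by (intro sum_mono mult_right_mono osc_sq_le) (simp add: less_imp_le)
        also have "\<dots> \<le> series_tail f' n"
          using lam_pos by (intro series_tail_bound smf' that) (simp add: f'_def less_imp_le)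
        finally show ?thesis .
      qed
      have ev': "eventually (\<lambda>i. l2_normsq I (\<lambda>x. S (r2 i) x t - S n x t) \<le> series_tail f' n) sequentially" for n
        using eventually_ge_at_top[of n]
      proof eventually_elim
        case (elim i)
        then show ?case using bd[of n "r2 i"] seq_suble[OF r2(1), of i] by simp
      qed
      have us: "square_integrable I (\<lambda>x. ux x t)"
        by (rule l2_AE_limit(1)[OF dSI uxmt lim dSI ev'])
      have ud: "l2_normsq I (\<lambda>x. ux x t - S n x t) \<le> series_tail f' n" for n
        by (rule l2_AE_limit(2)[OF dSI uxmt lim dSI ev'])
      obtain dv where v: "H10_deriv (\<lambda>x. u x t) dv" using sol t unfolding wave_solution_def by blast
      have "u x t = (LINT y:{0<..<x}|lborel. ux y t)" if x: "0 \<le> x" "x \<le> 1" for x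
      proof -
        have h10: "H10_deriv (\<lambda>x. \<Sum>k<n. osc A B k t * \<Phi> k x) (\<lambda>x. S n x t)" for n
          unfolding S_def by (rule H10_sum[OF \<Phi>_H10])
        define L where "L = (\<integral>y. ux y t * indicator {..<x} y \<partial>I)"
        have "(L - (\<Sum>k<n. osc A B k t * \<Phi> k x))\<^sup>2 \<le> series_tail f' n" for n
        proof -
          have D: "square_integrable I (\<lambda>y. ux y t - S n y t)" by (intro square_integrable_diff us dSI)
          have "L - (\<Sum>k<n. osc A B k t * \<Phi> k x) = (\<integral>y. ux y t * indicator {..<x} y - S n y t * indicator {..<x} y \<partial>I)"
            unfolding L_def H10_deriv_eq[OF h10 x]
            by (intro Bochner_Integration.integral_diff[symmetric] integrable_times_indicator_I01
                square_integrable_interval_measure01_integrable us dSI)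
          also have "\<dots> = (\<integral>y. (ux y t - S n y t) * indicator {..<x} y \<partial>I)"
            by (simp only: left_diff_distrib)
          finally have "(L - (\<Sum>k<n. osc A B k t * \<Phi> k x))\<^sup>2 \<le> x * (\<integral>y. (ux y t - S n y t)\<^sup>2 * indicator {..<x} y \<partial>I)"
            using l2_normsq_I_truncated(1)[OF D x] by simp
          also have "\<dots> \<le> 1 * (\<integral>y. (ux y t - S n y t)\<^sup>2 * indicator {..<x} y \<partial>I)"
            using x by (intro mult_right_mono integral_nonneg_AE) auto
          also have "\<dots> \<le> 1 * l2_normsq I (\<lambda>y. ux y t - S n y t)"
            unfolding l2_normsq_def using D
            by (intro mult_left_mono integral_mono l2_normsq_I_truncated(2)[OF D x])
              (auto simp: square_integrable_def indicator_def)
          finally show ?thesis using ud[of n] by simp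
        qed
        then have bnd: "\<bar>L - (\<Sum>k<n. osc A B k t * \<Phi> k x)\<bar> \<le> sqrt (series_tail f' n)" for n
          by (metis real_sqrt_abs real_sqrt_le_mono)
        have lim0: "(\<lambda>n. sqrt (series_tail f' n)) \<longlonglongrightarrow> 0"
          using tendsto_real_sqrt[OF series_tail_tendsto[OF smf']] by simp
        have "(\<lambda>n. L - (\<Sum>k<n. osc A B k t * \<Phi> k x)) \<longlonglongrightarrow> 0"
          by (rule Lim_null_comparison[OF _ lim0]) (simp add: bnd)
        then have "(\<lambda>n. L - (L - (\<Sum>k<n. osc A B k t * \<Phi> k x))) \<longlonglongrightarrow> L - 0"
          by (intro tendsto_intros)
        then have "(\<lambda>n. \<Sum>k<n. osc A B k t * \<Phi> k x) \<longlonglongrightarrow> L" by simp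
        moreover have "(\<lambda>n. \<Sum>k<n. osc A B k t * \<Phi> k x) \<longlonglongrightarrow> u x t"
          using solution_series[OF T0 u0 u1 sol t x] by (simp add: A_def B_def)
        ultimately have "u x t = L" using LIMSEQ_unique by blast
        then show ?thesis by (simp add: L_def integral_Ioo_sub_I01[OF x])
      qed
      then show "H10_deriv (\<lambda>x. u x t) (\<lambda>x. ux x t)"
        using us H10_one[OF v] by (auto simp: H10_deriv_def)
    qed
  qed
  then have H: "AE t in lborel. 0 < t \<and> t < T \<longrightarrow> H10_deriv (\<lambda>x. u x t) (\<lambda>x. ux x t)"
    by (simp add: AE_restrict_lborel_Ioo)
  have "\<exists>\<delta>>0. AE x in lborel. 0 < x \<and> x < \<delta> \<longrightarrow> (\<integral>\<^sup>+t. ennreal ((ux x t - g t)\<^sup>2) \<partial>J T) \<le> ennreal \<epsilon>"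
    if e: "\<epsilon> > 0" for \<epsilon>
  proof -
    have e9: "\<epsilon> / 9 > 0" using e by simp
    obtain n where n: "q n \<le> \<epsilon> / 9"
      using order_tendstoD(2)[OF q0 e9] unfolding eventually_sequentially by (meson less_imp_le order_refl)
    have "((\<lambda>x. C * (\<Sum>k<n. ((A k)\<^sup>2 + (B k)\<^sup>2) * (d\<Phi> k x - slope k)\<^sup>2)) \<longlongrightarrow>
        C * (\<Sum>k<n. ((A k)\<^sup>2 + (B k)\<^sup>2) * (slope k - slope k)\<^sup>2)) (at 0 within {0..})"
    proof (intro tendsto_intros)
      fix k show "(d\<Phi> k \<longlongrightarrow> slope k) (at 0 within {0..})"
        using bspec[OF d\<Phi>_continuous[of k, unfolded continuous_on], of 0] by simp
    qed
    then have "((\<lambda>x. C * (\<Sum>k<n. ((A k)\<^sup>2 + (B k)\<^sup>2) * (d\<Phi> k x - slope k)\<^sup>2)) \<longlongrightarrow> 0) (at 0 within {0..})" by simp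
    from order_tendstoD(2)[OF this e9]
    obtain \<delta> where \<delta>: "\<delta> > 0" "\<forall>x\<in>{0..}. x \<noteq> 0 \<and> dist x 0 < \<delta> \<longrightarrow>
        C * (\<Sum>k<n. ((A k)\<^sup>2 + (B k)\<^sup>2) * (d\<Phi> k x - slope k)\<^sup>2) < \<epsilon> / 9"
      unfolding eventually_at by (elim exE conjE)
    have "AE x in I. 0 < x \<and> x < \<delta> \<longrightarrow> (\<integral>\<^sup>+t. ennreal ((ux x t - g t)\<^sup>2) \<partial>J T) \<le> ennreal \<epsilon>"
      using AExt
    proof eventually_elim
      fix x assume ae: "AE t in J T. Cauchy (\<lambda>i. S (r2 i) x t)"
      show "0 < x \<and> x < \<delta> \<longrightarrow> (\<integral>\<^sup>+t. ennreal ((ux x t - g t)\<^sup>2) \<partial>J T) \<le> ennreal \<epsilon>"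
      proof
        assume x: "0 < x \<and> x < \<delta>"
        then have x0: "x \<ge> 0" by simp
        have lim: "AE t in J T. (\<lambda>i. S (r2 i) x t) \<longlonglongrightarrow> ux x t"
          using ae unfolding ux_def by eventually_elim (rule Cauchy_imp_tendsto_lim)
        have us: "square_integrable (J T) (ux x)"
          by (rule l2_AE_limit(1)[OF Ssq uxmx lim Ssq ev[OF r2(1) x0]])
        have ud: "l2_normsq (J T) (\<lambda>t. ux x t - S n x t) \<le> \<epsilon> / 9"
          using l2_AE_limit(2)[OF Ssq uxmx lim Ssq ev[OF r2(1) x0], of n] n by simp
        have gd': "l2_normsq (J T) (\<lambda>t. S n 0 t - g t) \<le> \<epsilon> / 9"
          using gd[of n] n by (simp add: l2_normsq_def power2_commute)
        have "S n x t - S n 0 t = (\<Sum>k<n. osc A B k t * (d\<Phi> k x - slope k))" for t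
          by (simp add: S_def sum_subtractf[symmetric] right_diff_distrib)
        then have md: "l2_normsq (J T) (\<lambda>t. S n x t - S n 0 t) \<le> \<epsilon> / 9"
          using upper[of "{..<n}" A B "\<lambda>k. d\<Phi> k x - slope k"] bspec[OF \<delta>(2), of x] x by (simp add: dist_real_def)
        have d1: "square_integrable (J T) (\<lambda>t. ux x t - S n x t)"
          and d2: "square_integrable (J T) (\<lambda>t. S n x t - S n 0 t)"
          and d3: "square_integrable (J T) (\<lambda>t. S n 0 t - g t)"
          by (intro square_integrable_diff us gs Ssq)+
        have "sqrt (l2_normsq (J T) (\<lambda>t. ux x t - g t))
            = sqrt (l2_normsq (J T) (\<lambda>t. (ux x t - S n x t) + ((S n x t - S n 0 t) + (S n 0 t - g t))))"
          by simp
        also have "\<dots> \<le> sqrt (l2_normsq (J T) (\<lambda>t. ux x t - S n x t))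
            + sqrt (l2_normsq (J T) (\<lambda>t. (S n x t - S n 0 t) + (S n 0 t - g t)))"
          by (rule l2_triangle[OF d1 square_integrable_add[OF d2 d3]])
        also have "\<dots> \<le> sqrt (l2_normsq (J T) (\<lambda>t. ux x t - S n x t))
            + (sqrt (l2_normsq (J T) (\<lambda>t. S n x t - S n 0 t)) + sqrt (l2_normsq (J T) (\<lambda>t. S n 0 t - g t)))"
          by (intro add_left_mono l2_triangle[OF d2 d3])
        also have "\<dots> \<le> sqrt (\<epsilon> / 9) + (sqrt (\<epsilon> / 9) + sqrt (\<epsilon> / 9))"
          by (intro add_mono real_sqrt_le_mono ud md gd')
        also have "\<dots> = sqrt \<epsilon>" by (simp add: real_sqrt_divide)
        finally have N: "l2_normsq (J T) (\<lambda>t. ux x t - g t) \<le> \<epsilon>" by simp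
        have "square_integrable (J T) (\<lambda>t. ux x t - g t)" by (intro square_integrable_diff us gs)
        then have "(\<integral>\<^sup>+t. ennreal ((ux x t - g t)\<^sup>2) \<partial>J T) = ennreal (l2_normsq (J T) (\<lambda>t. ux x t - g t))"
          unfolding l2_normsq_def by (intro nn_integral_eq_integral) (auto simp: square_integrable_def)
        then show "(\<integral>\<^sup>+t. ennreal ((ux x t - g t)\<^sup>2) \<partial>J T) \<le> ennreal \<epsilon>" using N by (simp add: ennreal_leI)
      qed
    qed
    then have "AE x in lborel. 0 < x \<and> x < 1 \<longrightarrow> 0 < x \<and> x < \<delta> \<longrightarrow> (\<integral>\<^sup>+t. ennreal ((ux x t - g t)\<^sup>2) \<partial>J T) \<le> ennreal \<epsilon>"
      unfolding interval_measure01_def AE_restrict_lborel_Ioo .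
    then have "AE x in lborel. 0 < x \<and> x < min \<delta> 1 \<longrightarrow> (\<integral>\<^sup>+t. ennreal ((ux x t - g t)\<^sup>2) \<partial>J T) \<le> ennreal \<epsilon>"
      by eventually_elim auto
    then show ?thesis using \<delta>(1) by (intro exI[of _ "min \<delta> 1"]) auto
  qed
  then show ?thesis unfolding dx_trace_at_0_def using gs uxm H by blast
qed

end

section \<open>Finite superpositions of modes\<close>

context wave_basis
begin

definition mode_sum :: "nat set \<Rightarrow> (nat \<Rightarrow> real) \<Rightarrow> (nat \<Rightarrow> real) \<Rightarrow> real \<Rightarrow> real \<Rightarrow> real" where
  "mode_sum F A B x t = (\<Sum>k\<in>F. osc A B k t * \<Phi> k x)"

definition dosc :: "(nat \<Rightarrow> real) \<Rightarrow> (nat \<Rightarrow> real) \<Rightarrow> nat \<Rightarrow> real \<Rightarrow> real" where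
  "dosc A B k t = freq k * osc B (\<lambda>k. - A k) k t"

lemma osc_deriv: "(osc A B k has_real_derivative dosc A B k t) (at t within X)"
  unfolding osc_def[abs_def] dosc_def
  by (auto intro!: derivative_eq_intros simp: osc_def algebra_simps)

lemma dosc_deriv: "(dosc A B k has_real_derivative - lam k * osc A B k t) (at t within X)"
proof -
  have "(dosc A B k has_real_derivative freq k * dosc B (\<lambda>k. - A k) k t) (at t within X)"
    unfolding dosc_def[of A B, abs_def] by (intro DERIV_cmult osc_deriv)
  also have "freq k * dosc B (\<lambda>k. - A k) k t = - (freq k)\<^sup>2 * osc A B k t"
    by (simp add: dosc_def osc_def power2_eq_square algebra_simps)
  finally show ?thesis by (simp add: freq_sq)
qed

lemma W_normsq_sum:
  assumes "finite F"
  shows "l2_normsq W (\<lambda>x. \<Sum>k\<in>F. c k * \<Phi> k x) = (\<Sum>k\<in>F. (c k)\<^sup>2)"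
  using l2_normsq_orthogonal_sum[OF assms, of W \<Phi> "\<lambda>_. 1" c] by (simp add: \<Phi>_square_integrable \<Phi>_inner)

lemma I_normsq_sum:
  assumes "finite F"
  shows "l2_normsq I (\<lambda>x. \<Sum>k\<in>F. c k * d\<Phi> k x) = (\<Sum>k\<in>F. (c k)\<^sup>2 * lam k)"
  by (rule l2_normsq_orthogonal_sum[OF assms]) (auto simp: d\<Phi>_square_integrable d\<Phi>_inner)

lemma mode_sum_solution:
  assumes F: "finite F"
  shows "wave_solution (2 - \<beta>) T (\<lambda>x. \<Sum>k\<in>F. A k * \<Phi> k x) (\<lambda>x. \<Sum>k\<in>F. freq k * B k * \<Phi> k x) (mode_sum F A B)"
proof -
  define ux where "ux x t = (\<Sum>k\<in>F. osc A B k t * d\<Phi> k x)" for x t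
  define ut where "ut x t = (\<Sum>k\<in>F. dosc A B k t * \<Phi> k x)" for x t
  have cont: "(osc A B k \<longlongrightarrow> osc A B k t) (at t within X)" "(dosc A B k \<longlongrightarrow> dosc A B k t) (at t within X)" for k t X
    using DERIV_continuous[OF osc_deriv] DERIV_continuous[OF dosc_deriv] by (auto simp: continuous_within)
  have "H10_deriv (\<lambda>x. mode_sum F A B x t) (\<lambda>x. ux x t)" for t
    unfolding mode_sum_def ux_def by (rule H10_sum[OF \<Phi>_H10])
  moreover have uts: "square_integrable W (\<lambda>x. ut x t)" for t
    unfolding ut_def by (intro square_integrable_sum square_integrable_scale \<Phi>_square_integrable)
  moreover have "((\<lambda>s. l2_normsq I (\<lambda>x. ux x s - ux x t)) \<longlongrightarrow> 0) (at t within {0..T})" for t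
  proof -
    have "l2_normsq I (\<lambda>x. ux x s - ux x t) = (\<Sum>k\<in>F. (osc A B k s - osc A B k t)\<^sup>2 * lam k)" for s
      unfolding I_normsq_sum[OF F, symmetric] by (simp add: ux_def sum_subtractf left_diff_distrib)
    moreover have "((\<lambda>s. \<Sum>k\<in>F. (osc A B k s - osc A B k t)\<^sup>2 * lam k) \<longlongrightarrow>
        (\<Sum>k\<in>F. (osc A B k t - osc A B k t)\<^sup>2 * lam k)) (at t within {0..T})"
      by (intro tendsto_intros cont)
    ultimately show ?thesis by simp
  qed
  moreover have "((\<lambda>s. l2_normsq W (\<lambda>x. (mode_sum F A B x s - mode_sum F A B x t) / (s - t) - ut x t)) \<longlongrightarrow> 0) (at t within {0..T})" for t
  proof -
    have "l2_normsq W (\<lambda>x. (mode_sum F A B x s - mode_sum F A B x t) / (s - t) - ut x t)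
        = (\<Sum>k\<in>F. ((osc A B k s - osc A B k t) / (s - t) - dosc A B k t)\<^sup>2)" for s
      unfolding W_normsq_sum[OF F, symmetric]
      by (simp add: mode_sum_def ut_def sum_subtractf[symmetric] sum_divide_distrib left_diff_distrib diff_divide_distrib)
    moreover have "((\<lambda>s. \<Sum>k\<in>F. ((osc A B k s - osc A B k t) / (s - t) - dosc A B k t)\<^sup>2) \<longlongrightarrow>
        (\<Sum>k\<in>F. (dosc A B k t - dosc A B k t)\<^sup>2)) (at t within {0..T})"
      by (intro tendsto_intros osc_deriv[unfolded has_field_derivative_iff])
    ultimately show ?thesis by simp
  qed
  moreover have "((\<lambda>s. l2_normsq W (\<lambda>x. ut x s - ut x t)) \<longlongrightarrow> 0) (at t within {0..T})" for t
  proof -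
    have "l2_normsq W (\<lambda>x. ut x s - ut x t) = (\<Sum>k\<in>F. (dosc A B k s - dosc A B k t)\<^sup>2)" for s
      unfolding W_normsq_sum[OF F, symmetric] by (simp add: ut_def sum_subtractf left_diff_distrib)
    moreover have "((\<lambda>s. \<Sum>k\<in>F. (dosc A B k s - dosc A B k t)\<^sup>2) \<longlongrightarrow>
        (\<Sum>k\<in>F. (dosc A B k t - dosc A B k t)\<^sup>2)) (at t within {0..T})"
      by (intro tendsto_intros cont)
    ultimately show ?thesis by simp
  qed
  moreover have "((\<lambda>s. l2_inner W (\<lambda>x. ut x s) v) has_real_derivative - l2_inner I (\<lambda>x. ux x t) dv) (at t within {0..T})"
    if v: "H10_deriv v dv" for t v dv
  proof -
    have vs: "square_integrable W v"
      by (rule H10_square_integrable_weighted[OF _ v]) (use b0 in simp)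
    have dvs: "square_integrable I dv" using v by (simp add: H10_deriv_def)
    have 1: "l2_inner W (\<lambda>x. ut x s) v = (\<Sum>k\<in>F. dosc A B k s * l2_inner W (\<Phi> k) v)" for s
      unfolding ut_def by (rule l2_inner_sum_left[OF \<Phi>_square_integrable vs])
    have 2: "- l2_inner I (\<lambda>x. ux x t) dv = (\<Sum>k\<in>F. - lam k * osc A B k t * l2_inner W (\<Phi> k) v)"
      unfolding ux_def l2_inner_sum_left[OF d\<Phi>_square_integrable dvs] \<Phi>_integration_by_parts[OF v]
      by (simp add: sum_negf[symmetric] mult_ac)
    show ?thesis unfolding 1 2 by (intro DERIV_sum DERIV_cmult_right dosc_deriv)
  qed
  moreover have "mode_sum F A B x 0 = (\<Sum>k\<in>F. A k * \<Phi> k x)" for x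
    by (simp add: mode_sum_def osc_def)
  moreover have "ut x 0 = (\<Sum>k\<in>F. freq k * B k * \<Phi> k x)" for x
    by (simp add: ut_def dosc_def osc_def)
  ultimately show ?thesis unfolding wave_solution_def by (intro exI[of _ ux] exI[of _ ut]) simp
qed

text \<open>The derivative of a finite sum converges uniformly in \<open>t\<close> as \<open>x\<close> tends to 0, so the trace exists
  for every \<open>T\<close>.\<close>

lemma mode_sum_trace:
  assumes F: "finite F"
  shows "dx_trace_at_0 T (mode_sum F A B) (\<lambda>t. \<Sum>k\<in>F. osc A B k t * slope k)"
  unfolding dx_trace_at_0_def
proof (intro conjI exI[of _ "\<lambda>x t. \<Sum>k\<in>F. osc A B k t * d\<Phi> k x"] allI impI)
  let ?g = "\<lambda>t. \<Sum>k\<in>F. osc A B k t * slope k" and ?ux = "\<lambda>x t. \<Sum>k\<in>F. osc A B k t * d\<Phi> k x"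
  show "square_integrable (J T) ?g" by (rule osc_sum_square_integrable)
  show "(\<lambda>(x, t). ?ux x t) \<in> borel_measurable (borel \<Otimes>\<^sub>M borel)"
    unfolding case_prod_beta' by measurable
  show "AE t in lborel. 0 < t \<and> t < T \<longrightarrow> H10_deriv (\<lambda>x. mode_sum F A B x t) (\<lambda>x. ?ux x t)"
    unfolding mode_sum_def by (intro always_eventually allI impI H10_sum \<Phi>_H10)
  fix e :: real assume e: "e > 0"
  define M where "M = measure (J T) (space (J T))"
  interpret MJ: finite_measure "J T" by (rule finite_measure_restrict_lborel_Ioo)
  define b where "b x = (\<Sum>k\<in>F. (\<bar>A k\<bar> + \<bar>B k\<bar>) * \<bar>d\<Phi> k x - slope k\<bar>)" for x
  have "((\<lambda>x. (b x)\<^sup>2 * M) \<longlongrightarrow> (\<Sum>k\<in>F. (\<bar>A k\<bar> + \<bar>B k\<bar>) * \<bar>slope k - slope k\<bar>)\<^sup>2 * M) (at 0 within {0..})"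
    unfolding b_def
  proof (intro tendsto_intros)
    fix k show "(d\<Phi> k \<longlongrightarrow> slope k) (at 0 within {0..})"
      using bspec[OF d\<Phi>_continuous[of k, unfolded continuous_on], of 0] by simp
  qed
  then have "((\<lambda>x. (b x)\<^sup>2 * M) \<longlongrightarrow> 0) (at 0 within {0..})" by simp
  from order_tendstoD(2)[OF this e]
  obtain \<delta> where \<delta>: "\<delta> > 0" "\<forall>x\<in>{0..}. x \<noteq> 0 \<and> dist x 0 < \<delta> \<longrightarrow> (b x)\<^sup>2 * M < e"
    unfolding eventually_at by (elim exE conjE)
  have "(\<integral>\<^sup>+t. ennreal ((?ux x t - ?g t)\<^sup>2) \<partial>J T) \<le> ennreal e" if x: "0 < x" "x < \<delta>" for x
  proof -
    have "(?ux x t - ?g t)\<^sup>2 \<le> (b x)\<^sup>2" for t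
    proof -
      have "\<bar>?ux x t - ?g t\<bar> = \<bar>\<Sum>k\<in>F. osc A B k t * (d\<Phi> k x - slope k)\<bar>"
        by (simp add: sum_subtractf[symmetric] right_diff_distrib)
      also have "\<dots> \<le> b x"
        unfolding b_def
        by (rule order_trans[OF sum_abs]) (auto simp: abs_mult intro!: sum_mono mult_right_mono abs_osc_le)
      finally show ?thesis using power_mono[of "\<bar>?ux x t - ?g t\<bar>" "b x" 2] by simp
    qed
    then have "(\<integral>\<^sup>+t. ennreal ((?ux x t - ?g t)\<^sup>2) \<partial>J T) \<le> (\<integral>\<^sup>+t. ennreal ((b x)\<^sup>2) \<partial>J T)"
      by (intro nn_integral_mono ennreal_leI)
    also have "\<dots> = ennreal ((b x)\<^sup>2 * M)"
      by (simp add: M_def MJ.emeasure_eq_measure ennreal_mult)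
    also have "\<dots> \<le> ennreal e"
      using bspec[OF \<delta>(2), of x] x by (intro ennreal_leI) (simp add: dist_real_def)
    finally show ?thesis .
  qed
  then show "\<exists>\<delta>>0. AE x in lborel. 0 < x \<and> x < \<delta> \<longrightarrow> (\<integral>\<^sup>+t. ennreal ((?ux x t - ?g t)\<^sup>2) \<partial>J T) \<le> ennreal e"
    using \<delta>(1) by (intro exI[of _ \<delta>]) auto
qed

lemma mode_sum_data:
  fixes A B :: "nat \<Rightarrow> real" and F :: "nat set"
  assumes F: "finite F"
  defines "u0 \<equiv> \<lambda>x. \<Sum>k\<in>F. A k * \<Phi> k x" and "u1 \<equiv> \<lambda>x. \<Sum>k\<in>F. freq k * B k * \<Phi> k x"
  shows "u0 \<in> Hs_space (2 - \<beta>) \<Phi> lam s" and "u1 \<in> Hs_space (2 - \<beta>) \<Phi> lam s"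
    and "wave_energy (2 - \<beta>) \<Phi> lam (p - 1 / 2) u0 u1 = (\<Sum>k\<in>F. ((A k)\<^sup>2 + (B k)\<^sup>2) * lam k powr p)"
proof -
  have in0: "l2_inner W (\<lambda>x. \<Sum>k\<in>F. c k * \<Phi> k x) (\<Phi> j) = (if j \<in> F then c j else 0)" for c j
  proof -
    have "l2_inner W (\<lambda>x. \<Sum>k\<in>F. c k * \<Phi> k x) (\<Phi> j) = (\<Sum>k\<in>F. if k = j then c k else 0)"
      unfolding l2_inner_sum_left[OF \<Phi>_square_integrable \<Phi>_square_integrable]
      by (intro sum.cong) (auto simp: \<Phi>_inner)
    then show ?thesis using F by (simp add: sum.delta)
  qed
  have sp: "(\<lambda>x. \<Sum>k\<in>F. c k * \<Phi> k x) \<in> Hs_space (2 - \<beta>) \<Phi> lam s" for c s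
    unfolding Hs_space_def
    by (auto simp: in0 intro!: square_integrable_sum square_integrable_scale \<Phi>_square_integrable summable_finite[OF F])
  show "u0 \<in> Hs_space (2 - \<beta>) \<Phi> lam s" "u1 \<in> Hs_space (2 - \<beta>) \<Phi> lam s"
    unfolding u0_def u1_def by (rule sp)+
  have "wave_energy (2 - \<beta>) \<Phi> lam (p - 1 / 2) u0 u1
      = (\<Sum>k. ((coeffA u0 k)\<^sup>2 + (coeffB u1 k)\<^sup>2) * lam k powr p)"
    unfolding u0_def u1_def by (rule energy_summable(2)[OF sp sp])
  also have "\<dots> = (\<Sum>k\<in>F. ((coeffA u0 k)\<^sup>2 + (coeffB u1 k)\<^sup>2) * lam k powr p)"
    by (rule suminf_finite[OF F]) (simp add: coeffA_def coeffB_def u0_def u1_def in0)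
  also have "\<dots> = (\<Sum>k\<in>F. ((A k)\<^sup>2 + (B k)\<^sup>2) * lam k powr p)"
    by (intro sum.cong refl) (simp add: coeffA_def coeffB_def u0_def u1_def in0 freq_pos less_imp_neq[symmetric])
  finally show "wave_energy (2 - \<beta>) \<Phi> lam (p - 1 / 2) u0 u1 = (\<Sum>k\<in>F. ((A k)\<^sup>2 + (B k)\<^sup>2) * lam k powr p)" .
qed

section \<open>Optimality of the observation time\<close>

text \<open>Dividing each amplitude by the boundary slope of its mode turns the lower trace estimate into a
  lower bound for nonharmonic Fourier series alone.\<close>

lemma trace_estimate_imp_Riesz:
  assumes est: "trace_estimate (2 - \<beta>) \<Phi> lam (p - 1 / 2) T c C" and c: "c > 0"
  obtains c' where "c' > 0" "\<And>F a b. finite F \<Longrightarrow>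
    c' * (\<Sum>k\<in>F. (a k)\<^sup>2 + (b k)\<^sup>2) \<le> (LINT t:{0<..<T}|lborel. (\<Sum>k\<in>F. osc a b k t)\<^sup>2)"
proof -
  obtain K1 K2 where K: "0 < K1" "0 < K2"
    "\<And>k. K1 * lam k powr p \<le> (slope k)\<^sup>2" "\<And>k. (slope k)\<^sup>2 \<le> K2 * lam k powr p"
    by (rule slope_bounds, rule that)
  have "c / K2 * (\<Sum>k\<in>F. (a k)\<^sup>2 + (b k)\<^sup>2) \<le> (LINT t:{0<..<T}|lborel. (\<Sum>k\<in>F. osc a b k t)\<^sup>2)"
    if F: "finite F" for F a b
  proof -
    define A where "A k = a k / slope k" for k
    define B where "B k = b k / slope k" for k
    have o: "osc A B k t * slope k = osc a b k t" for k t
      using slope_nonzero[of k] by (simp add: osc_def A_def B_def field_simps)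
    have "c * (\<Sum>k\<in>F. ((A k)\<^sup>2 + (B k)\<^sup>2) * lam k powr p) \<le> (LINT t:{0<..<T}|lborel. (\<Sum>k\<in>F. osc A B k t * slope k)\<^sup>2)"
      using est[unfolded trace_estimate_def, rule_format, OF mode_sum_data(1)[OF F, of A] mode_sum_data(2)[OF F, of B]
          mode_sum_solution[OF F, of T A B] mode_sum_trace[OF F, of T A B], THEN conjunct1]
      unfolding mode_sum_data(3)[OF F] .
    then have le: "c * (\<Sum>k\<in>F. ((A k)\<^sup>2 + (B k)\<^sup>2) * lam k powr p) \<le> (LINT t:{0<..<T}|lborel. (\<Sum>k\<in>F. osc a b k t)\<^sup>2)"
      by (simp only: o)
    have "((a k)\<^sup>2 + (b k)\<^sup>2) / K2 \<le> ((A k)\<^sup>2 + (B k)\<^sup>2) * lam k powr p" for k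
    proof -
      have "(a k)\<^sup>2 + (b k)\<^sup>2 = ((A k)\<^sup>2 + (B k)\<^sup>2) * (slope k)\<^sup>2"
        using slope_nonzero[of k] by (simp add: A_def B_def power_divide distrib_right)
      also have "\<dots> \<le> ((A k)\<^sup>2 + (B k)\<^sup>2) * (K2 * lam k powr p)"
        by (intro mult_left_mono K) auto
      finally show ?thesis using K(2) by (simp add: field_simps)
    qed
    then have "(\<Sum>k\<in>F. ((a k)\<^sup>2 + (b k)\<^sup>2) / K2) \<le> (\<Sum>k\<in>F. ((A k)\<^sup>2 + (B k)\<^sup>2) * lam k powr p)"
      by (rule sum_mono)
    then have "c * ((\<Sum>k\<in>F. (a k)\<^sup>2 + (b k)\<^sup>2) / K2) \<le> c * (\<Sum>k\<in>F. ((A k)\<^sup>2 + (B k)\<^sup>2) * lam k powr p)"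
      using c by (intro mult_left_mono) (auto simp: sum_divide_distrib)
    then show ?thesis using le by simp
  qed
  then show ?thesis using that[of "c / K2"] c K by simp
qed

end

lemma Dirichlet_kernel_bound:
  fixes a x :: real
  shows "\<bar>sin x\<bar> * \<bar>\<Sum>n<M. cos (a + 2 * real n * x)\<bar> \<le> 1"
proof -
  have "2 * sin x * (\<Sum>n<M. cos (a + 2 * real n * x)) = sin (a + (2 * real M - 1) * x) - sin (a - x)"
  proof (induction M)
    case 0
    then show ?case by (simp add: algebra_simps)
  next
    case (Suc M)
    have "2 * sin x * cos (a + 2 * real M * x) = sin ((a + 2 * real M * x) + x) - sin ((a + 2 * real M * x) - x)"
      by (simp only: sin_add sin_diff) simp
    also have "(a + 2 * real M * x) + x = a + (2 * real (Suc M) - 1) * x" by (simp add: algebra_simps)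
    also have "(a + 2 * real M * x) - x = a + (2 * real M - 1) * x" by (simp add: algebra_simps)
    finally show ?case using Suc by (simp add: distrib_left)
  qed
  then have "\<bar>2 * sin x * (\<Sum>n<M. cos (a + 2 * real n * x))\<bar> \<le> \<bar>sin (a + (2 * real M - 1) * x)\<bar> + \<bar>sin (a - x)\<bar>"
    by (simp only: abs_triangle_ineq4)
  also have "\<dots> \<le> 1 + 1" by (intro add_mono abs_sin_le_one)
  finally show ?thesis by (simp add: abs_mult)
qed

lemma abs_cos_diff_le: "\<bar>cos x - cos y\<bar> \<le> \<bar>x - y\<bar>" for x y :: real
proof -
  have "norm (cos y - cos x) \<le> 1 * norm (y - x)"
  proof (rule field_differentiable_bound[of UNIV cos "\<lambda>z. - sin z"])
    show "(cos has_field_derivative - sin z) (at z within UNIV)" for z :: real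
      by (auto intro!: derivative_eq_intros)
  qed auto
  then show ?thesis by (simp add: abs_minus_commute)
qed

context wave_basis
begin

text \<open>High up in the spectrum there are \<open>M\<close> frequencies as close as desired to an arithmetic
  progression with step \<open>\<gamma> = \<beta> \<pi> / 2\<close>. With phases chosen so that the corresponding Dirichlet kernel
  peaks at a time \<open>\<theta>/\<gamma>\<close> strictly between \<open>T\<close> and the period \<open>2 \<pi> / \<gamma> = 4 / \<beta>\<close>, the sum stays bounded on
  \<open>[0, T]\<close> independently of \<open>M\<close>, while its energy is \<open>M\<close>.\<close>

lemma no_estimate_for_short_time:
  assumes T: "0 < T" "T < 4 / \<beta>" and c: "c > 0"
  shows "\<not> trace_estimate (2 - \<beta>) \<Phi> lam (p - 1 / 2) T c C"
proof
  assume est: "trace_estimate (2 - \<beta>) \<Phi> lam (p - 1 / 2) T c C"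
  obtain c' where c': "c' > 0" and R: "\<And>F a b. finite F \<Longrightarrow>
    c' * (\<Sum>k\<in>F. (a k)\<^sup>2 + (b k)\<^sup>2) \<le> (LINT t:{0<..<T}|lborel. (\<Sum>k\<in>F. osc a b k t)\<^sup>2)"
    by (rule trace_estimate_imp_Riesz[OF est c], rule that)
  define \<gamma> where "\<gamma> = \<beta> / 2 * pi"
  have g: "\<gamma> > 0" using b0 by (simp add: \<gamma>_def)
  have gT: "\<gamma> * T < 2 * pi"
  proof -
    have "\<beta> / 2 * T < 2" using T b0 by (simp add: field_simps)
    then show ?thesis using mult_strict_right_mono[of "\<beta> / 2 * T" 2 pi] by (simp add: \<gamma>_def mult_ac)
  qed
  define \<theta> where "\<theta> = (\<gamma> * T + 2 * pi) / 2"
  have th: "\<gamma> * T < \<theta>" "\<theta> < 2 * pi" using gT by (simp_all add: \<theta>_def mult.commute)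
  have "\<exists>x\<in>{0..T}. \<forall>y\<in>{0..T}. sin ((\<theta> - \<gamma> * x) / 2) \<le> sin ((\<theta> - \<gamma> * y) / 2)"
    using T by (intro continuous_attains_inf) (auto intro!: continuous_intros)
  then obtain t0 where t0: "t0 \<in> {0..T}" "\<And>t. t \<in> {0..T} \<Longrightarrow> sin ((\<theta> - \<gamma> * t0) / 2) \<le> sin ((\<theta> - \<gamma> * t) / 2)"
    by blast
  define s where "s = sin ((\<theta> - \<gamma> * t0) / 2)"
  have s: "s > 0"
  proof -
    have "\<gamma> * t0 \<le> \<gamma> * T" "0 \<le> \<gamma> * t0" using t0(1) g by (auto intro: mult_left_mono)
    then have "0 < \<theta> - \<gamma> * t0" "\<theta> - \<gamma> * t0 < 2 * pi" using th by linarith+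
    then have "0 < (\<theta> - \<gamma> * t0) / 2" "(\<theta> - \<gamma> * t0) / 2 < pi" by simp_all
    then show ?thesis unfolding s_def by (rule sin_gt_zero)
  qed
  define D where "D = 1 / s + 1"
  obtain M :: nat where M: "real M > T * D\<^sup>2 / c'" using reals_Archimedean2 by blast
  have "0 \<le> T * D\<^sup>2 / c'" using T c' by simp
  then have M0: "real M > 0" using M by linarith
  (* With this spacing error, replacing the M frequencies by an arithmetic progression changes the
     sum by at most 1 on [0, T]. *)
  define e where "e = 2 / (\<beta> * (real M)\<^sup>2 * T)"
  have e: "e > 0" using b0 T M0 by (simp add: e_def)
  obtain z :: "nat \<Rightarrow> real" where z: "\<And>n. z n > 0" "\<And>n. w (z n) = 0" "strict_mono z"
    "\<And>n. real n * pi \<le> z n - z 0 \<and> z n - z 0 \<le> real n * (pi + e)"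
    by (rule zero_progression[OF e], rule that)
  have "\<exists>k. freq k = \<beta> / 2 * z n" for n using zeros_are_eigenvalues[OF z(1) z(2)] by metis
  then obtain idx where idx: "\<And>n. freq (idx n) = \<beta> / 2 * z n" by metis
  have near: "\<bar>freq (idx n) - (freq (idx 0) + real n * \<gamma>)\<bar> \<le> \<beta> / 2 * (real n * e)" for n
  proof -
    have "freq (idx n) - (freq (idx 0) + real n * \<gamma>) = \<beta> / 2 * (z n - z 0 - real n * pi)"
      by (simp add: idx \<gamma>_def algebra_simps)
    moreover have "\<bar>z n - z 0 - real n * pi\<bar> \<le> real n * e"
      using z(4)[of n] by (simp add: algebra_simps)
    then have "\<bar>\<beta> / 2 * (z n - z 0 - real n * pi)\<bar> \<le> \<beta> / 2 * (real n * e)"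
      unfolding abs_mult using b0 by (intro mult_mono) auto
    ultimately show ?thesis by (simp only:)
  qed
  define a where "a k = cos (\<theta> * real (inv_into {..<M} idx k))" for k
  define b where "b k = sin (\<theta> * real (inv_into {..<M} idx k))" for k
  have inj: "inj_on idx {..<M}"
  proof (rule inj_onI)
    fix m n assume "idx m = idx n"
    then have "z m = z n" using idx[of m] idx[of n] b0 by simp
    then show "m = n" using strict_mono_eq[OF z(3)] by simp
  qed
  define F where "F = idx ` {..<M}"
  have F: "finite F" by (simp add: F_def)
  have "(\<Sum>k\<in>F. (a k)\<^sup>2 + (b k)\<^sup>2) = real M"
    using inj by (simp add: a_def b_def F_def card_image)
  then have lower: "c' * real M \<le> (LINT t:{0<..<T}|lborel. (\<Sum>k\<in>F. osc a b k t)\<^sup>2)"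
    using R[OF F, of a b] by simp
  have bound: "\<bar>\<Sum>k\<in>F. osc a b k t\<bar> \<le> D" if t: "t \<in> {0<..<T}" for t
  proof -
    define \<phi> where "\<phi> = (\<gamma> * t - \<theta>) / 2"
    define m0 where "m0 = freq (idx 0)"
    have "(\<Sum>k\<in>F. osc a b k t) = (\<Sum>n<M. osc a b (idx n) t)"
      unfolding F_def by (rule sum.reindex_cong[OF inj]) auto
    also have "\<dots> = (\<Sum>n<M. cos (freq (idx n) * t - \<theta> * real n))"
      using inj by (intro sum.cong refl) (simp add: osc_def a_def b_def cos_diff mult_ac)
    finally have eq: "(\<Sum>k\<in>F. osc a b k t) = (\<Sum>n<M. cos (freq (idx n) * t - \<theta> * real n))" .
    have "\<bar>\<Sum>n<M. cos (freq (idx n) * t - \<theta> * real n) - cos (m0 * t + 2 * real n * \<phi>)\<bar>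
        \<le> (\<Sum>n<M. \<beta> / 2 * (real M * e) * T)"
    proof (rule order_trans[OF sum_abs sum_mono])
      fix n assume n: "n \<in> {..<M}"
      have "\<bar>cos (freq (idx n) * t - \<theta> * real n) - cos (m0 * t + 2 * real n * \<phi>)\<bar>
          \<le> \<bar>(freq (idx n) * t - \<theta> * real n) - (m0 * t + 2 * real n * \<phi>)\<bar>"
        by (rule abs_cos_diff_le)
      also have "(freq (idx n) * t - \<theta> * real n) - (m0 * t + 2 * real n * \<phi>) = (freq (idx n) - (m0 + real n * \<gamma>)) * t"
        by (simp add: \<phi>_def field_simps)
      also have "\<bar>(freq (idx n) - (m0 + real n * \<gamma>)) * t\<bar> \<le> (\<beta> / 2 * (real n * e)) * T"
        unfolding abs_mult m0_def using near[of n] t b0 e by (intro mult_mono) auto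
      also have "\<dots> \<le> \<beta> / 2 * (real M * e) * T"
        using n b0 e T by (intro mult_right_mono mult_left_mono) auto
      finally show "\<bar>cos (freq (idx n) * t - \<theta> * real n) - cos (m0 * t + 2 * real n * \<phi>)\<bar> \<le> \<beta> / 2 * (real M * e) * T" .
    qed
    also have "\<dots> = 1" using b0 T M0 by (simp add: e_def power2_eq_square)
    finally have 1: "\<bar>\<Sum>n<M. cos (freq (idx n) * t - \<theta> * real n) - cos (m0 * t + 2 * real n * \<phi>)\<bar> \<le> 1" .
    have "s \<le> sin ((\<theta> - \<gamma> * t) / 2)" unfolding s_def using t by (intro t0(2)) auto
    also have "(\<theta> - \<gamma> * t) / 2 = - \<phi>" by (simp add: \<phi>_def field_simps)
    also have "sin (- \<phi>) = - sin \<phi>" by simp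
    finally have "s \<le> \<bar>sin \<phi>\<bar>" by linarith
    then have "s * \<bar>\<Sum>n<M. cos (m0 * t + 2 * real n * \<phi>)\<bar> \<le> \<bar>sin \<phi>\<bar> * \<bar>\<Sum>n<M. cos (m0 * t + 2 * real n * \<phi>)\<bar>"
      by (intro mult_right_mono) auto
    also have "\<dots> \<le> 1" by (rule Dirichlet_kernel_bound)
    finally have 2: "\<bar>\<Sum>n<M. cos (m0 * t + 2 * real n * \<phi>)\<bar> \<le> 1 / s" using s by (simp add: field_simps)
    show ?thesis using 1 2 unfolding eq D_def sum_subtractf by linarith
  qed
  have "(LINT t:{0<..<T}|lborel. (\<Sum>k\<in>F. osc a b k t)\<^sup>2) \<le> (LINT t:{0<..<T}|lborel. D\<^sup>2)"
  proof (rule set_integral_mono)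
    show "set_integrable lborel {0<..<T} (\<lambda>t. (\<Sum>k\<in>F. osc a b k t)\<^sup>2)"
      by (intro set_integrable_continuous_Ioo continuous_intros osc_continuous)
    show "set_integrable lborel {0<..<T} (\<lambda>t. D\<^sup>2)"
      by (intro set_integrable_continuous_Ioo continuous_intros)
    show "(\<Sum>k\<in>F. osc a b k t)\<^sup>2 \<le> D\<^sup>2" if "t \<in> {0<..<T}" for t
      using power_mono[OF bound[OF that], of 2] by simp
  qed
  also have "\<dots> = T * D\<^sup>2" using T by (simp add: set_lebesgue_integral_def)
  finally have "c' * real M \<le> T * D\<^sup>2" using lower by simp
  with M c' show False by (simp add: field_simps)
qed

end

theorem theorem3:
  fixes \<alpha> \<nu> \<kappa> :: real and \<Phi> :: "nat \<Rightarrow> real \<Rightarrow> real" and lam :: "nat \<Rightarrow> real"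
  assumes "0 < \<alpha>" and "\<alpha> < 2"
    and "\<nu> = 1 / (2 - \<alpha>)" and "\<kappa> = 1 - \<alpha> / 2"
    and "dirichlet_eigenbasis \<alpha> \<Phi> lam"
  shows "(\<forall>T > 2 / \<kappa>.
            (\<forall>u0 \<in> Hs_space \<alpha> \<Phi> lam (\<nu> + 1/2). \<forall>u1 \<in> Hs_space \<alpha> \<Phi> lam (\<nu> - 1/2). \<forall>u.
               wave_solution \<alpha> T u0 u1 u \<longrightarrow> (\<exists>g. dx_trace_at_0 T u g)) \<and>
            (\<exists>c C. 0 < c \<and> c \<le> C \<and> trace_estimate \<alpha> \<Phi> lam \<nu> T c C)) \<and>
         (\<forall>T. 0 < T \<and> T < 2 / \<kappa> \<longrightarrow>
            \<not> (\<exists>c C. 0 < c \<and> c \<le> C \<and> trace_estimate \<alpha> \<Phi> lam \<nu> T c C))"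
proof -
  interpret wave_basis "2 - \<alpha>" \<Phi> lam
    using assms by unfold_locales auto
  \<comment> \<open>All lemmas are in terms of \<open>\<beta> = 2 - \<alpha>\<close>; the threshold \<open>2/\<kappa>\<close> is \<open>4/\<beta>\<close>.\<close>
  have \<nu>: "\<nu> = p - 1 / 2" and T: "2 / \<kappa> = 4 / (2 - \<alpha>)"
    using assms(2-4) by (auto simp: p_def field_simps)
  have e: "p - 1 / 2 + 1 / 2 = p" "p - 1 / 2 - 1 / 2 = p - 1" and \<alpha>: "2 - (2 - \<alpha>) = \<alpha>" by simp_all
  note exists = trace_exists[unfolded \<alpha>] and holds = trace_estimate_holds[unfolded \<alpha>]
    and fails = no_estimate_for_short_time[unfolded \<alpha>]
  show ?thesis
    unfolding \<nu> T e
  proof (intro conjI allI impI ballI)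
    fix T :: real and u0 u1 u
    assume "4 / (2 - \<alpha>) < T" "u0 \<in> Hs_space \<alpha> \<Phi> lam p" "u1 \<in> Hs_space \<alpha> \<Phi> lam (p - 1)"
      "wave_solution \<alpha> T u0 u1 u"
    then show "\<exists>g. dx_trace_at_0 T u g" by (rule exists)
  next
    fix T :: real assume "4 / (2 - \<alpha>) < T"
    from holds[OF this] show "\<exists>c C. 0 < c \<and> c \<le> C \<and> trace_estimate \<alpha> \<Phi> lam (p - 1 / 2) T c C"
      by metis
  next
    fix T :: real assume "0 < T \<and> T < 4 / (2 - \<alpha>)"
    then show "\<not> (\<exists>c C. 0 < c \<and> c \<le> C \<and> trace_estimate \<alpha> \<Phi> lam (p - 1 / 2) T c C)"
      using fails by blast
  qed
qed

end
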